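(* Let $X\subset\mathcal A^{\mathbb N}$ be a shift space with language $\mathcal L=\mathcal L(X)$. Suppose that there is $\mathcal G\subset\mathcal L$ which has $(W)$-specification and such that $\mathcal L$ is edit approachable by $\mathcal G$. Then for every $f\in C(X)$ with $P_{\rm inf}(\sigma,f)<P_{\rm top}(\sigma,f)$, $$P_H(\sigma,f)=P_{\rm top}(\sigma,f),$$ where $H=\{x\in X:\lim_{\varepsilon\to0}\frac{\log\mathcal E_x(\varepsilon)}{-\log\varepsilon}=\infty\}$ is the set of points with high pointwise emergence.
   Context: Let $\mathcal A=\{1,\dots,m\}$ be a finite alphabet; $\mathcal A^{\mathbb N}=\{(x_i)_{i\ge1}\}$ carries the metric $d(x,y)=\sum_{j\ge1}|x_j-y_j|2^{-j}$ and the left shift $\sigma$. A shift space is a nonempty compact $X\subset\mathcal A^{\mathbb N}$ with $\sigma(X)\subset X$. $\mathcal L_n(X)$ is the set of words of length $n$ occurring in some $x\in X$, and $\mathcal L(X)=\bigcup_{n\ge1}\mathcal L_n(X)$ is the language; $|u|$ is the length of a word $u$ and $[u]$ is the cylinder of points of $X$ beginning with $u$; $[x]_n=[x_1\cdots x_n]$. A subset $\mathcal G\subset\mathcal L$ has $(W)$-specification if there is $\tau\in\mathbb N$ such that for all $u,v\in\mathcal G$ there exists $w\in\mathcal L$ with $|w|\le\tau$ and $uwv\in\mathcal G$. An edit of a word is a substitution of one symbol, an insertion of one symbol, or a deletion of one symbol; the edit distance $\hat d(v,w)$ is the minimal number of edits transforming $v$ into $w$. A mistake function is a nondecreasing $g:\mathbb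 N\to\mathbb N$ with $g(n)/n\to0$. $\mathcal L$ is edit approachable by $\mathcal G$ if there is a mistake function $g$ such that for every $w\in\mathcal L$ there is $v\in\mathcal G$ with $\hat d(w,v)\le g(|w|)$. $\mathcal M(X)$, $\mathcal M_\sigma(X)$ denote Borel probability measures and $\sigma$-invariant ones with the weak* topology. For $f\in C(X)$: $P_\mu(\sigma,f)=h_\mu(\sigma)+\int f\,d\mu$ (with $h_\mu$ the measure-theoretic entropy), $P_{\rm top}(\sigma,f)$ is the topological pressure, and $P_{\rm inf}(\sigma,f)=\inf\{P_\mu(\sigma,f):\mu\in\mathcal M_\sigma(X)\}$. $S_nf(x)=\sum_{i=0}^{n-1}f(\sigma^ix)$. Pesin–Pitskel pressure: for $Z\subset X$, $s\in\mathbb R$, $N\in\mathbb N$, let $M(Z,s,N)=\inf_\alpha\sum_{[u]\in\alpha}\exp\big(-s|u|+\sup_{x\in[u]}S_{|u|}f(x)\big)$, infimum over finite or countable families $\alpha$ of cylinders of length at least $N$ covering $Z$; $M(Z,s)=\lim_{N\to\infty}M(Z,s,N)$ and $P_Z(\sigma,f)=\inf\{s: M(Z,s)=0\}$. Wasserstein metric on $\mathcal M(X)$: $W(\mu,\nu)=\sup\{|\int\varphi\,d\mu-\int\varphi\,d\nu|\}$ over $\varphi:X\to[-1,1]$ with Lipschitz constant $\le1$. Empirical measures $\delta_x^n=\frac1n\sum_{k=0}^{n-1}\delta_{\sigma^kx}$; $V(x)$ is the set of weak* limit points of $(\delta_x^n)_n$. The pointwise emergence is $\mathcal E_x(\varepsilon)=N(V(x),\varepsilon)$,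 the minimal number $N$ of measures $\mu_1,\dots,\mu_N\in\mathcal M(X)$ with $\limsup_{n\to\infty}\min_{j}W(\delta_x^n,\mu_j)\le\varepsilon$ (the $\varepsilon$-covering number of $V(x)$ in the metric $W$). *)

theory Defs
  imports "HOL-Probability.Probability"
begin

(* Points of A^N are sequences nat => nat; index 0 corresponds to x_1 of the paper.
   The topology on nat => nat is the product topology (discrete nat), which on the
   full shift coincides with the topology of the metric d below. *)
type_synonym seq = "nat \<Rightarrow> nat"

definition shift :: "seq \<Rightarrow> seq" where
  "shift x = (\<lambda>i. x (Suc i))"

definition full_shift :: "nat \<Rightarrow> seq set" where
  "full_shift m = {x. \<forall>i. x i \<in> {1..m}}"

definition sdist :: "seq \<Rightarrow> seq \<Rightarrow> real" where
  "sdist x y = (\<Sum>j. \<bar>real (x j) - real (y j)\<bar> / 2 ^ Suc j)"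

definition shift_space :: "nat \<Rightarrow> seq set \<Rightarrow> bool" where
  "shift_space m X \<longleftrightarrow> X \<noteq> {} \<and> compact X \<and> X \<subseteq> full_shift m \<and> shift ` X \<subseteq> X"

definition occurs :: "nat list \<Rightarrow> seq \<Rightarrow> bool" where
  "occurs u x \<longleftrightarrow> (\<exists>i. \<forall>k<length u. x (i + k) = u ! k)"

definition lang_n :: "seq set \<Rightarrow> nat \<Rightarrow> nat list set" where
  "lang_n X n = {u. length u = n \<and> (\<exists>x\<in>X. occurs u x)}"

definition lang :: "seq set \<Rightarrow> nat list set" where
  "lang X = (\<Union>n\<in>{n. 1 \<le> n}. lang_n X n)"

definition cyl :: "seq set \<Rightarrow> nat list \<Rightarrow> seq set" where
  "cyl X u = {x\<in>X. \<forall>k<length u. x k = u ! k}"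

definition W_spec :: "seq set \<Rightarrow> nat list set \<Rightarrow> bool" where
  "W_spec X G \<longleftrightarrow> (\<exists>\<tau>::nat. \<forall>u\<in>G. \<forall>v\<in>G. \<exists>w\<in>lang X. length w \<le> \<tau> \<and> u @ w @ v \<in> G)"

definition edit1 :: "nat list \<Rightarrow> nat list \<Rightarrow> bool" where
  "edit1 v w \<longleftrightarrow>
     (\<exists>xs a b ys. v = xs @ a # ys \<and> w = xs @ b # ys) \<or>
     (\<exists>xs a ys. v = xs @ ys \<and> w = xs @ a # ys) \<or>
     (\<exists>xs a ys. v = xs @ a # ys \<and> w = xs @ ys)"

definition edit_dist :: "nat list \<Rightarrow> nat list \<Rightarrow> nat" where
  "edit_dist v w = (LEAST n. (edit1 ^^ n) v w)"

definition mistake_function :: "(nat \<Rightarrow> nat) \<Rightarrow> bool" where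
  "mistake_function g \<longleftrightarrow> mono g \<and> (\<lambda>n. real (g n) / real n) \<longlonglongrightarrow> 0"

definition edit_approachable :: "seq set \<Rightarrow> nat list set \<Rightarrow> bool" where
  "edit_approachable X G \<longleftrightarrow>
     (\<exists>g. mistake_function g \<and> (\<forall>w\<in>lang X. \<exists>v\<in>G. edit_dist w v \<le> g (length w)))"

definition prob_measures :: "seq set \<Rightarrow> seq measure set" where
  "prob_measures X = {\<mu>. sets \<mu> = sets (restrict_space borel X) \<and> prob_space \<mu>}"

definition inv_measures :: "seq set \<Rightarrow> seq measure set" where
  "inv_measures X = {\<mu>\<in>prob_measures X.
      \<forall>A\<in>sets \<mu>. measure \<mu> (shift -` A \<inter> X) = measure \<mu> A}"

definition eta :: "real \<Rightarrow> real" where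
  "eta t = (if t = 0 then 0 else - t * ln t)"

definition is_partition :: "seq measure \<Rightarrow> seq set set \<Rightarrow> bool" where
  "is_partition \<mu> P \<longleftrightarrow> finite P \<and> P \<subseteq> sets \<mu> \<and> {} \<notin> P \<and> \<Union>P = space \<mu> \<and> disjoint P"

definition part_entropy :: "seq measure \<Rightarrow> seq set set \<Rightarrow> real" where
  "part_entropy \<mu> P = (\<Sum>A\<in>P. eta (measure \<mu> A))"

definition pjoin :: "seq set set \<Rightarrow> seq set set \<Rightarrow> seq set set" where
  "pjoin P Q = {A \<inter> B | A B. A \<in> P \<and> B \<in> Q \<and> A \<inter> B \<noteq> {}}"

definition pull :: "seq set \<Rightarrow> seq set set \<Rightarrow> nat \<Rightarrow> seq set set" where
  "pull X P k = {(shift ^^ k) -` A \<inter> X | A. A \<in> P}"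

fun joinn :: "seq set \<Rightarrow> seq set set \<Rightarrow> nat \<Rightarrow> seq set set" where
  "joinn X P 0 = {X}"
| "joinn X P (Suc n) = pjoin (joinn X P n) (pull X P n)"

definition ent_part :: "seq set \<Rightarrow> seq measure \<Rightarrow> seq set set \<Rightarrow> real" where
  "ent_part X \<mu> P = lim (\<lambda>n. part_entropy \<mu> (joinn X P n) / real n)"

definition ks_entropy :: "seq set \<Rightarrow> seq measure \<Rightarrow> real" where
  "ks_entropy X \<mu> = (SUP P\<in>{P. is_partition \<mu> P}. ent_part X \<mu> P)"

definition birk :: "(seq \<Rightarrow> real) \<Rightarrow> nat \<Rightarrow> seq \<Rightarrow> real" where
  "birk f n x = (\<Sum>i<n. f ((shift ^^ i) x))"

definition pressure_mu :: "seq set \<Rightarrow> (seq \<Rightarrow> real) \<Rightarrow> seq measure \<Rightarrow> real" where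
  "pressure_mu X f \<mu> = ks_entropy X \<mu> + integral\<^sup>L \<mu> f"

definition P_inf :: "seq set \<Rightarrow> (seq \<Rightarrow> real) \<Rightarrow> real" where
  "P_inf X f = (INF \<mu>\<in>inv_measures X. pressure_mu X f \<mu>)"

definition P_top :: "seq set \<Rightarrow> (seq \<Rightarrow> real) \<Rightarrow> real" where
  "P_top X f = lim (\<lambda>n. ln (\<Sum>u\<in>lang_n X n. exp (SUP x\<in>cyl X u. birk f n x)) / real n)"

definition PP_M :: "seq set \<Rightarrow> (seq \<Rightarrow> real) \<Rightarrow> seq set \<Rightarrow> real \<Rightarrow> nat \<Rightarrow> ennreal" where
  "PP_M X f Z s N =
     (INF U\<in>{U. U \<subseteq> lang X \<and> (\<forall>u\<in>U. N \<le> length u) \<and> Z \<subseteq> (\<Union>u\<in>U. cyl X u)}.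
        \<integral>\<^sup>+ u. ennreal (exp (- s * real (length u) + (SUP x\<in>cyl X u. birk f (length u) x)))
          \<partial>count_space U)"

definition PP_M_lim :: "seq set \<Rightarrow> (seq \<Rightarrow> real) \<Rightarrow> seq set \<Rightarrow> real \<Rightarrow> ennreal" where
  "PP_M_lim X f Z s = lim (\<lambda>N. PP_M X f Z s N)"

definition PP_pressure :: "seq set \<Rightarrow> (seq \<Rightarrow> real) \<Rightarrow> seq set \<Rightarrow> real" where
  "PP_pressure X f Z = Inf {s. PP_M_lim X f Z s = 0}"

definition lip1 :: "seq set \<Rightarrow> (seq \<Rightarrow> real) \<Rightarrow> bool" where
  "lip1 X \<phi> \<longleftrightarrow> (\<forall>x\<in>X. \<bar>\<phi> x\<bar> \<le> 1) \<and> (\<forall>x\<in>X. \<forall>y\<in>X. \<bar>\<phi> x - \<phi> y\<bar> \<le> sdist x y)"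

(* integral of phi against the empirical measure delta_x^n *)
definition emp_int :: "seq \<Rightarrow> nat \<Rightarrow> (seq \<Rightarrow> real) \<Rightarrow> real" where
  "emp_int x n \<phi> = (\<Sum>k<n. \<phi> ((shift ^^ k) x)) / real n"

definition wass_emp :: "seq set \<Rightarrow> seq \<Rightarrow> nat \<Rightarrow> seq measure \<Rightarrow> real" where
  "wass_emp X x n \<mu> = Sup {\<bar>emp_int x n \<phi> - integral\<^sup>L \<mu> \<phi>\<bar> | \<phi>. lip1 X \<phi>}"

definition emergence :: "seq set \<Rightarrow> seq \<Rightarrow> real \<Rightarrow> nat" where
  "emergence X x \<epsilon> = (LEAST N. 1 \<le> N \<and> (\<exists>\<mu>s. (\<forall>j<N. \<mu>s j \<in> prob_measures X) \<and>
      limsup (\<lambda>n. ereal (Min ((\<lambda>j. wass_emp X x n (\<mu>s j)) ` {..<N}))) \<le> ereal \<epsilon>))"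

definition high_emergence :: "seq set \<Rightarrow> seq set" where
  "high_emergence X = {x\<in>X. filterlim (\<lambda>\<epsilon>. ln (real (emergence X x \<epsilon>)) / (- ln \<epsilon>)) at_top (at_right 0)}"

end

(* If long words of G could be glued in essentially one way only, the space would be the edit closure of a
   single periodic orbit: all entropies and pressures would then be determined by that orbit, and P_inf = P_top.
   Hence P_inf < P_top forces positive entropy, which yields two words of G with different statistics and, by
   gluing, for every k, k + 1 types of words of G whose window statistics live on disjoint sets.

   A near-maximal family W of words of G of equal length carries almost all of the pressure. Stages are long
   repetitions of cycles that insert, after many words from W, a small proportion of the k + 1 types in prescribed
   relative frequencies. Gluing the stages with gaps of length at most tau, with free choices in W, gives a set on
   which the uniform product measure satisfies the mass distribution principle with exponent close to P_top.
   Along each of its points every mixture on a grid of (M + 1)^k frequency vectors is the approximate statistics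
   at infinitely many times. The mixtures are 1/M-separated, so an epsilon-cover of the limit measures needs at
   least about epsilon^(-k) elements, for every k: the emergence is superpolynomial. *)

theory Submission
  imports Defs "HOL-Real_Asymp.Real_Asymp"
begin

section \<open>Words and almost additive functions\<close>

text \<open>Two obstacles shape the proof. A word is only known to be close in edit distance to a
  word of \<open>G\<close>, and an edit path may leave the language, where Birkhoff sums of
  \<open>f\<close> have no meaning. So \<open>f\<close> is replaced by a function of
  \<open>l\<close> letters and its window sums are taken on arbitrary lists. They are additive up to
  a constant, hence one edit moves them by a bounded amount and sublinearly many edits are
  negligible. The gaps are an unknown choice, so gluing need not be injective. A cylinder is
  therefore charged once for each way of parsing it; with k gaps there are at most (\<tau> + 1)^k
  ways, a small exponential rate once all glued words are long. The k + 1 types all come from one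
  observable: an intermediate value argument gives it k + 1 separated averages, and long windows
  reveal which average is present. The matrix of type statistics is then close to the identity, so
  mixtures can be told apart. The separation must be a constant times 1/M with a constant
  independent of M, because the order epsilon^(-k) appears as M grows with k fixed; for this reason
  the proportion between main family and types is fixed by \<open>f\<close> and the exponent s
  alone.\<close>

definition pre :: "nat \<Rightarrow> seq \<Rightarrow> nat list" where
  "pre n x = map x [0..<n]"

lemma length_pre [simp]: "length (pre n x) = n"
  by (simp add: pre_def)

lemma nth_pre [simp]: "i < n \<Longrightarrow> pre n x ! i = x i"
  by (simp add: pre_def)

lemma shift_pow: "(shift ^^ i) x = (\<lambda>j. x (j + i))"
  by (induction i arbitrary: x) (auto simp: shift_def)

lemma pre_0 [simp]: "pre 0 x = []"
  by (simp add: pre_def)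

lemma pre_Suc: "pre (Suc n) x = x 0 # pre n (shift x)"
  by (rule nth_equalityI) (auto simp: nth_Cons shift_def split: nat.splits)

lemma take_pre [simp]: "take k (pre n x) = pre (min k n) x"
  by (rule nth_equalityI) auto

lemma drop_pre: "drop k (pre n x) = pre (n - k) ((shift ^^ k) x)"
  by (rule nth_equalityI) (auto simp: shift_pow add.commute)

lemma pre_add: "pre (a + b) x = pre a x @ pre b ((shift ^^ a) x)"
  using append_take_drop_id[of a "pre (a + b) x"] by (simp add: drop_pre)

lemma pre_eq_iff: "pre n x = pre n y \<longleftrightarrow> (\<forall>k<n. x k = y k)"
  by (auto simp: list_eq_iff_nth_eq)

lemma pre_eq_mono: "pre n x = pre n y \<Longrightarrow> k \<le> n \<Longrightarrow> pre k x = pre k y"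
  by (auto simp: pre_eq_iff)

text \<open>The windows are read from the list alone, so the sum is meaningful for edited words
  outside the language. A window that does not fit contributes 0.\<close>

fun wsum :: "nat \<Rightarrow> (nat list \<Rightarrow> real) \<Rightarrow> nat list \<Rightarrow> real" where
  "wsum l \<psi> [] = 0"
| "wsum l \<psi> (a # w) = (if l \<le> length (a # w) then \<psi> (take l (a # w)) else 0) + wsum l \<psi> w"

text \<open>Both bounds range over all lists because an edit path may leave the language. The defect
  \<kappa> is a constant: a defect proportional to the length would let a single edit change the
  average.\<close>

definition almost_additive :: "real \<Rightarrow> real \<Rightarrow> (nat list \<Rightarrow> real) \<Rightarrow> bool" where
  "almost_additive \<kappa> B F \<longleftrightarrow> 0 \<le> \<kappa> \<and> 0 \<le> B \<and>
     (\<forall>u v. \<bar>F (u @ v) - F u - F v\<bar> \<le> \<kappa>) \<and> (\<forall>u. \<bar>F u\<bar> \<le> B * length u)"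

lemma almost_additiveD:
  assumes "almost_additive \<kappa> B F"
  shows "\<bar>F (u @ v) - F u - F v\<bar> \<le> \<kappa>" "\<bar>F u\<bar> \<le> B * length u" "0 \<le> \<kappa>" "0 \<le> B"
  using assms by (auto simp: almost_additive_def)

lemma wsum_bound:
  assumes "\<And>w. \<bar>\<psi> w\<bar> \<le> B"
  shows "\<bar>wsum l \<psi> w\<bar> \<le> B * length w"
proof (induction w)
  case (Cons a w)
  have "\<bar>wsum l \<psi> (a # w)\<bar> \<le> B + B * length w"
    using Cons assms[of "take l (a # w)"] by (auto simp: abs_le_iff)
  then show ?case by (simp add: algebra_simps)
qed simp

text \<open>Only windows that start in \<open>u\<close> and run past its end matter. The minimum is
  what the induction needs: as long as \<open>u\<close> is shorter than \<open>l\<close>, each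
  letter put in front adds one such window.\<close>

lemma wsum_append:
  fixes u v :: "nat list"
  assumes "\<And>w. \<bar>\<psi> w\<bar> \<le> B" "0 \<le> B"
  shows "\<bar>wsum l \<psi> (u @ v) - wsum l \<psi> u - wsum l \<psi> v\<bar> \<le> B * min l (length u)"
proof (induction u)
  case (Cons a u)
  show ?case
  proof (cases "l \<le> length (a # u)")
    case True
    then have "take l (a # u @ v) = take l (a # u)" by (cases l) auto
    moreover have "B * min l (length u) \<le> B * min l (length (a # u))"
      using assms(2) by (intro mult_left_mono) auto
    ultimately show ?thesis using Cons True by auto
  next
    case False
    then have "B * min l (length (a # u)) = B * min l (length u) + B"
      by (simp add: min_def algebra_simps)
    then show ?thesis using Cons False assms(1)[of "take l (a # u @ v)"] by auto
  qed
qed simp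

lemma almost_additive_wsum:
  fixes B :: real and l :: nat
  assumes "\<And>w. \<bar>\<psi> w\<bar> \<le> B"
  shows "almost_additive (B * l) B (wsum l \<psi>)"
proof -
  have B: "0 \<le> B" using assms[of "[]"] by linarith
  have "\<bar>wsum l \<psi> (u @ v) - wsum l \<psi> u - wsum l \<psi> v\<bar> \<le> B * l" for u v :: "nat list"
    using wsum_append[where ?l = l and ?u = u and ?v = v and ?\<psi> = \<psi>, OF assms B] mult_left_mono[OF _ B, of "real (min l (length u))" "real l"]
    by auto
  then show ?thesis using B wsum_bound[OF assms] by (auto simp: almost_additive_def)
qed

lemma wsum_pre:
  "wsum l \<psi> (pre n x) = (\<Sum>i<n. if i + l \<le> n then \<psi> (pre l ((shift ^^ i) x)) else 0)"
proof (induction n arbitrary: x)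
  case (Suc n)
  have "wsum l \<psi> (pre (Suc n) x) = (if l \<le> Suc n then \<psi> (pre l x) else 0) + wsum l \<psi> (pre n (shift x))"
    using take_pre[of l "Suc n" x] by (simp add: pre_Suc min_def)
  also have "\<dots> = (\<Sum>i<Suc n. if i + l \<le> Suc n then \<psi> (pre l ((shift ^^ i) x)) else 0)"
    unfolding Suc sum.lessThan_Suc_shift by (simp add: shift_pow shift_def del: funpow.simps cong: if_cong)
  finally show ?case .
qed simp

text \<open>Each complete window costs \<eta>. At most \<open>l\<close> positions near the end have
  an incomplete window; there the value of \<open>f\<close> is lost, which costs
  \<open>B\<close>.\<close>

lemma birk_wsum:
  assumes "\<And>i. i < n \<Longrightarrow> \<bar>f ((shift ^^ i) x) - \<psi> (pre l ((shift ^^ i) x))\<bar> \<le> \<eta>"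
    and "\<And>i. i < n \<Longrightarrow> \<bar>f ((shift ^^ i) x)\<bar> \<le> B" and "0 \<le> \<eta>" "0 \<le> B"
  shows "\<bar>birk f n x - wsum l \<psi> (pre n x)\<bar> \<le> n * \<eta> + B * l"
proof -
  let ?I = "{i. i < n \<and> \<not> i + l \<le> n}"
  have "card ?I \<le> card {n - l..<n}" by (rule card_mono) auto
  then have c: "card ?I \<le> l" by simp
  have "\<bar>birk f n x - wsum l \<psi> (pre n x)\<bar> \<le>
    (\<Sum>i<n. \<bar>f ((shift ^^ i) x) - (if i + l \<le> n then \<psi> (pre l ((shift ^^ i) x)) else 0)\<bar>)"
    by (simp add: birk_def wsum_pre flip: sum_subtractf)
  also have "\<dots> \<le> (\<Sum>i<n. \<eta> + (if i \<in> ?I then B else 0))"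
    using assms by (intro sum_mono) fastforce
  also have "\<dots> = n * \<eta> + (\<Sum>i<n. (if i \<in> ?I then B else 0))"
    by (simp add: sum.distrib)
  also have "(\<Sum>i<n. (if i \<in> ?I then B else 0)) = card ?I * B"
    by (subst sum.inter_restrict[symmetric]) (auto simp: Int_def)
  also have "real (card ?I) * B \<le> B * l"
    using c assms(4) by (simp add: mult.commute mult_left_mono)
  finally show ?thesis by simp
qed

subsection \<open>Edit distance\<close>

lemma edit1_delete_all: "(edit1 ^^ length v) v []"
proof (induction v)
  case (Cons a v)
  have "edit1 (a # v) v" unfolding edit1_def by (metis append_Nil)
  then show ?case using Cons by (simp add: relpowp_Suc_I2 del: relpowp.simps)
qed simp

lemma edit1_insert_all: "(edit1 ^^ length v) [] v"
proof (induction v)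
  case (Cons a v)
  have "edit1 v (a # v)" unfolding edit1_def by (metis append_Nil)
  then show ?case using Cons by auto
qed simp

text \<open>The \<open>LEAST\<close> is attained: deleting \<open>v\<close> letter by letter and
  then inserting \<open>w\<close> is an edit path.\<close>

lemma edit1_edit_dist: "(edit1 ^^ edit_dist v w) v w"
proof -
  have "(edit1 ^^ (length v + length w)) v w"
    using edit1_delete_all edit1_insert_all by (auto simp: relpowp_add)
  then show ?thesis unfolding edit_dist_def by (rule LeastI)
qed

lemma relpowp_real_bound:
  fixes F :: "'a \<Rightarrow> real"
  assumes "\<And>v w. R v w \<Longrightarrow> \<bar>F v - F w\<bar> \<le> K" "(R ^^ n) v w"
  shows "\<bar>F v - F w\<bar> \<le> n * K"
  using assms(2)
proof (induction n arbitrary: w)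
  case (Suc n)
  then obtain y where y: "(R ^^ n) v y" "R y w" by auto
  show ?case using Suc(1)[OF y(1)] assms(1)[OF y(2)] by (simp add: algebra_simps abs_if split: if_splits)
qed simp

text \<open>Cut both words at the edited place: each value is \<open>F xs + F ys\<close> up to
  2\<kappa> + B, whether or not a letter stands in between.\<close>

lemma edit1_almost_additive:
  fixes F :: "nat list \<Rightarrow> real"
  assumes F: "almost_additive \<kappa> B F" and "edit1 v w"
  shows "\<bar>F v - F w\<bar> \<le> 4 * \<kappa> + 2 * B"
proof -
  note D = almost_additiveD[OF F]
  have k: "\<bar>F (xs @ a # ys) - F xs - F ys\<bar> \<le> 2 * \<kappa> + B" for xs a ys
    using D(1)[of xs "a # ys"] D(1)[of "[a]" ys] D(2)[of "[a]"] by simp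
  have k2: "\<bar>F (xs @ ys) - F xs - F ys\<bar> \<le> 2 * \<kappa> + B" for xs ys
    using D(1)[of xs ys] D(3,4) by linarith
  show ?thesis using assms(2) unfolding edit1_def
  proof (elim disjE exE conjE)
    fix xs a b ys assume "v = xs @ a # ys" "w = xs @ b # ys"
    then show ?thesis using k[of xs a ys] k[of xs b ys] by simp
  next
    fix xs a ys assume "v = xs @ ys" "w = xs @ a # ys"
    then show ?thesis using k[of xs a ys] k2[of xs ys] by simp
  next
    fix xs a ys assume "w = xs @ ys" "v = xs @ a # ys"
    then show ?thesis using k[of xs a ys] k2[of xs ys] by simp
  qed
qed

lemma edit_dist_almost_additive:
  fixes F :: "nat list \<Rightarrow> real" and \<kappa> B :: real
  assumes "almost_additive \<kappa> B F"
  shows "\<bar>F v - F w\<bar> \<le> edit_dist v w * (4 * \<kappa> + 2 * B)"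
  using relpowp_real_bound[OF edit1_almost_additive[OF assms] edit1_edit_dist] .

lemma edit_dist_length: "\<bar>real (length v) - real (length w)\<bar> \<le> edit_dist v w"
proof -
  have "\<bar>real (length v) - real (length w)\<bar> \<le> real (edit_dist v w) * 1"
    by (rule relpowp_real_bound[OF _ edit1_edit_dist]) (auto simp: edit1_def)
  then show ?thesis by simp
qed

text \<open>A left-to-right normal form of a sequence of edits; it makes the words in an edit ball countable by recursion.\<close>

inductive aligned :: "nat \<Rightarrow> nat list \<Rightarrow> nat list \<Rightarrow> bool" where
  Nil: "aligned k [] []"
| Match: "aligned k v w \<Longrightarrow> aligned k (a # v) (a # w)"
| Sub: "aligned k v w \<Longrightarrow> aligned (Suc k) (a # v) (b # w)"
| Ins: "aligned k v w \<Longrightarrow> aligned (Suc k) v (b # w)"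
| Del: "aligned k v w \<Longrightarrow> aligned (Suc k) (a # v) w"

lemma aligned_Suc: "aligned k v w \<Longrightarrow> aligned (Suc k) v w"
  by (induction rule: aligned.induct) (auto intro: aligned.intros)

lemma aligned_refl: "aligned k v v"
  by (induction v) (auto intro: aligned.intros)

text \<open>Here and in the next two lemmas a later edit is merged into the operation that produced
  the letter it touches: a match becomes a substitution or a deletion, an inserted letter is
  replaced or dropped. Thus edits made in any order take the left-to-right form.\<close>

lemma aligned_edit_sub: "aligned k v w \<Longrightarrow> w = xs @ a # ys \<Longrightarrow> aligned (Suc k) v (xs @ b # ys)"
proof (induction arbitrary: xs rule: aligned.induct)
  case (Match k v w c)
  then show ?case by (cases xs) (auto intro: aligned.intros)
next
  case (Sub k v w c d)
  then show ?case by (cases xs) (auto intro: aligned.intros aligned_Suc)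
next
  case (Ins k v w c)
  then show ?case by (cases xs) (auto intro: aligned.intros aligned_Suc)
next
  case (Del k v w c)
  then show ?case by (auto intro: aligned.intros)
qed auto

lemma aligned_edit_ins: "aligned k v w \<Longrightarrow> w = xs @ ys \<Longrightarrow> aligned (Suc k) v (xs @ b # ys)"
proof (induction arbitrary: xs rule: aligned.induct)
  case (Nil k)
  then show ?case by (auto intro: aligned.intros)
next
  case (Match k v w c)
  then show ?case
    by (cases xs) (auto intro: aligned.intros)
next
  case (Sub k v w c d)
  then show ?case by (cases xs) (auto intro: aligned.intros)
next
  case (Ins k v w c)
  then show ?case by (cases xs) (auto intro: aligned.intros)
next
  case (Del k v w c)
  then show ?case by (auto intro: aligned.intros)
qed

lemma aligned_edit_del: "aligned k v w \<Longrightarrow> w = xs @ a # ys \<Longrightarrow> aligned (Suc k) v (xs @ ys)"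
proof (induction arbitrary: xs rule: aligned.induct)
  case (Match k v w c)
  then show ?case by (cases xs) (auto intro: aligned.intros)
next
  case (Sub k v w c d)
  then show ?case by (cases xs) (auto intro: aligned.intros aligned_Suc)
next
  case (Ins k v w c)
  then show ?case by (cases xs) (auto intro: aligned.intros aligned_Suc)
next
  case (Del k v w c)
  then show ?case by (auto intro: aligned.intros)
qed auto

lemma aligned_edit1: "aligned k v w \<Longrightarrow> edit1 w w' \<Longrightarrow> aligned (Suc k) v w'"
  unfolding edit1_def
  by (elim disjE exE conjE) (simp_all add: aligned_edit_sub aligned_edit_ins aligned_edit_del)

lemma aligned_edits: "(edit1 ^^ n) v w \<Longrightarrow> aligned n v w"
  by (induction n arbitrary: w) (auto intro: aligned_refl aligned_edit1)

lemma edit1_sym: "edit1 v w \<Longrightarrow> edit1 w v"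
  unfolding edit1_def by blast

lemma edits_sym: "(edit1 ^^ n) v w \<Longrightarrow> (edit1 ^^ n) w v"
proof (induction n arbitrary: w)
  case (Suc n)
  then obtain y where "(edit1 ^^ n) v y" "edit1 y w" by auto
  then show ?case using Suc(1) edit1_sym by (metis relpowp_Suc_I2)
qed auto

section \<open>Counting the words in an edit ball\<close>

definition ball_words :: "nat \<Rightarrow> nat list \<Rightarrow> nat \<Rightarrow> nat list set" where
  "ball_words m v k = {w. set w \<subseteq> {1..m} \<and> aligned k v w}"

lemma aligned_length: "aligned k v w \<Longrightarrow> length w \<le> length v + k"
  by (induction rule: aligned.induct) auto

lemma finite_ball_words: "finite (ball_words m v k)"
  by (rule finite_subset[OF _ finite_lists_length_le[of "{1..m}" "length v + k"]])
     (auto simp: ball_words_def dest: aligned_length)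

lemma card_cons_le: "finite A \<Longrightarrow> card (\<Union>b\<in>{1..m::nat}. (#) b ` A) \<le> m * card A"
  using card_UN_le[of "{1..m}" "\<lambda>b. (#) b ` A"] card_image_le[of A]
  by (smt (verit) card_atLeastAtMost diff_Suc_1 finite_atLeastAtMost le_trans mult.commute
      sum_bounded_above of_nat_id)

lemma ball_words_Nil: "ball_words m [] k \<subseteq> insert [] (if k = 0 then {} else \<Union>b\<in>{1..m}. (#) b ` ball_words m [] (k - 1))"
proof
  fix w assume "w \<in> ball_words m [] k"
  then have w: "set w \<subseteq> {1..m}" "aligned k [] w" by (auto simp: ball_words_def)
  from w(2) show "w \<in> insert [] (if k = 0 then {} else \<Union>b\<in>{1..m}. (#) b ` ball_words m [] (k - 1))"
    by (cases rule: aligned.cases) (use w(1) in \<open>auto simp: ball_words_def\<close>)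
qed

lemma ball_words_Cons: "ball_words m (a # v) k \<subseteq> (#) a ` ball_words m v k \<union>
  (if k = 0 then {} else (\<Union>b\<in>{1..m}. (#) b ` ball_words m v (k - 1)) \<union> (\<Union>b\<in>{1..m}. (#) b ` ball_words m (a # v) (k - 1))
     \<union> ball_words m v (k - 1))"
proof
  fix w assume "w \<in> ball_words m (a # v) k"
  then have w: "set w \<subseteq> {1..m}" "aligned k (a # v) w" by (auto simp: ball_words_def)
  from w(2) show "w \<in> (#) a ` ball_words m v k \<union>
  (if k = 0 then {} else (\<Union>b\<in>{1..m}. (#) b ` ball_words m v (k - 1)) \<union> (\<Union>b\<in>{1..m}. (#) b ` ball_words m (a # v) (k - 1))
     \<union> ball_words m v (k - 1))"
    by (cases rule: aligned.cases) (use w(1) in \<open>auto simp: ball_words_def\<close>)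
qed

text \<open>An edit is charged 1/t and a letter of \<open>v\<close> is charged r. Splitting by the
  first operation, a match contributes 1, the substitutions m t, the deletion t, and the insertions,
  which leave \<open>v\<close> whole, m t r; the condition on r says that these sum to at most r.
  Small t brings r close to 1 and makes edits expensive, which is harmless when they are
  few.\<close>

lemma card_ball_words:
  fixes t r :: real and m k :: nat and v :: "nat list"
  assumes "0 < t" "t \<le> 1" and mt: "m * t \<le> 1 / 2" and r: "r * (1 - m * t) \<ge> 1 + m * t + t" "1 \<le> r"
  shows "card (ball_words m v k) \<le> 2 * (1 / t) ^ k * r ^ length v"
proof (induction "length v + k" arbitrary: v k rule: less_induct)
  case less
  have cU: "real (card (\<Union>b\<in>{1..m}. (#) b ` ball_words m w j)) \<le> m * card (ball_words m w j)" for w :: "nat list" and j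
    using card_cons_le[OF finite_ball_words[of m w j], of m] by (metis of_nat_le_iff of_nat_mult)
  show ?case
  proof (cases v)
    case Nil
    show ?thesis
    proof (cases k)
      case 0
      then have "ball_words m v k \<subseteq> {[]}" using ball_words_Nil[of m k] Nil by auto
      then have "card (ball_words m v k) \<le> 1" by (metis card_mono finite.simps card.empty card_insert_if empty_iff One_nat_def)
      then show ?thesis using Nil 0 by simp
    next
      case (Suc j)
      have "card (ball_words m v k) \<le> card (insert [] (\<Union>b\<in>{1..m}. (#) b ` ball_words m [] j))"
        using ball_words_Nil[of m k] Nil Suc by (intro card_mono) (auto simp: finite_ball_words)
      also have "\<dots> \<le> Suc (card (\<Union>b\<in>{1..m}. (#) b ` ball_words m [] j))"
        by (rule card_insert_le_m1) auto
      finally have "real (card (ball_words m v k)) \<le> 1 + m * card (ball_words m [] j)"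
        using cU[of "[]" j] by linarith
      also have "\<dots> \<le> 1 + m * (2 * (1 / t) ^ j)"
        using less[of "[]" j] Suc Nil by (auto intro!: mult_left_mono)
      also have "\<dots> = 1 + 2 * (m * t) * (1 / t) ^ k" using Suc assms(1) by (simp add: field_simps)
      also have "\<dots> \<le> (1 / t) ^ k + 1 * (1 / t) ^ k"
        using mt assms by (intro add_mono mult_right_mono one_le_power) (auto simp: field_simps)
      finally show ?thesis using Nil by simp
    qed
  next
    case (Cons a u)
    let ?P = "2 * (1 / t) ^ k * r ^ length u"
    have P: "0 \<le> ?P" using assms by simp
    have c1: "card ((#) a ` ball_words m u k) \<le> ?P"
      using card_image_le[OF finite_ball_words, of "(#) a" m u k] less[of u k] Cons by fastforce
    show ?thesis
    proof (cases k)
      case 0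
      have "card (ball_words m v k) \<le> card ((#) a ` ball_words m u k)"
        using ball_words_Cons[of m a u k] Cons 0 by (intro card_mono) (auto simp: finite_ball_words)
      then have "card (ball_words m v k) \<le> ?P" using c1 by linarith
      also have "\<dots> \<le> ?P * r" using P r mult_left_mono[of 1 r ?P] by simp
      finally show ?thesis using Cons by (simp add: mult_ac)
    next
      case (Suc j)
      let ?A = "(#) a ` ball_words m u k" let ?B = "\<Union>b\<in>{1..m}. (#) b ` ball_words m u j"
      let ?C = "\<Union>b\<in>{1..m}. (#) b ` ball_words m v j" let ?D = "ball_words m u j"
      have "card (ball_words m v k) \<le> card (?A \<union> ((?B \<union> ?C) \<union> ?D))"
        using ball_words_Cons[of m a u k] Cons Suc by (intro card_mono) (auto simp: finite_ball_words)
      also have "\<dots> \<le> card ?A + (card ?B + card ?C + card ?D)"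
        by (meson add_mono card_Un_le le_trans order_refl)
      finally have "real (card (ball_words m v k)) \<le> real (card ?A) + (card ?B + card ?C + card ?D)"
        by linarith
      also have "\<dots> \<le> ?P + (m * (t * ?P) + m * (t * ?P * r) + t * ?P)"
      proof -
        have e: "2 * (1 / t) ^ j * r ^ length u = t * ?P" using Suc assms(1) by (simp add: field_simps)
        have "card ?D \<le> 2 * (1 / t) ^ j * r ^ length u" by (rule less) (use Cons Suc in simp)
        then have d: "card ?D \<le> t * ?P" unfolding e .
        have "card (ball_words m v j) \<le> 2 * (1 / t) ^ j * r ^ length v" by (rule less) (use Cons Suc in simp)
        also have "\<dots> = t * ?P * r" unfolding e[symmetric] using Cons by simp
        finally have v: "card (ball_words m v j) \<le> t * ?P * r" .
        have "card ?B \<le> m * (t * ?P)" using cU[of u j] d mult_left_mono[OF d, of "real m"] by simp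
        moreover have "card ?C \<le> m * (t * ?P * r)" using cU[of v j] mult_left_mono[OF v, of "real m"] by simp
        ultimately show ?thesis using c1 d by linarith
      qed
      also have "\<dots> = ?P * (1 + m * t + t + m * t * r)" by (simp add: algebra_simps)
      also have "\<dots> \<le> ?P * r" using P r by (intro mult_left_mono) (auto simp: algebra_simps)
      finally show ?thesis using Cons by (simp add: mult_ac)
    qed
  qed
qed

section \<open>Languages and topological pressure\<close>

lemma open_cylinder: "open {y :: seq. pre n y = u}"
proof (cases "length u = n")
  case True
  have "open ((\<lambda>y :: seq. y k) -` {u ! k})" for k
    by (rule open_vimage[OF _ continuous_on_product_coordinates]) (rule Topological_Spaces.open_discrete)
  moreover have "{y :: seq. pre n y = u} = (\<Inter>k\<in>{..<n}. (\<lambda>y :: seq. y k) -` {u ! k})"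
    using True by (auto simp: list_eq_iff_nth_eq)
  ultimately show ?thesis by (simp add: open_INT)
next
  case False
  then have "{y :: seq. pre n y = u} = {}" by auto
  then show ?thesis by simp
qed

lemma open_contains_cylinder:
  assumes "open U" "x \<in> U"
  shows "\<exists>n. {y :: seq. pre n y = pre n x} \<subseteq> U"
proof -
  have "openin (product_topology (\<lambda>i. euclidean) UNIV) U" using assms(1) by (simp add: open_fun_def)
  from product_topology_open_contains_basis[OF this assms(2)] obtain V where V: "x \<in> (\<Pi>\<^sub>E i\<in>UNIV. V i)"
    "finite {i. V i \<noteq> topspace euclidean}" "(\<Pi>\<^sub>E i\<in>UNIV. V i) \<subseteq> U" by metis
  obtain n where n: "\<forall>i\<in>{i. V i \<noteq> topspace euclidean}. i < n" using V(2) finite_nat_set_iff_bounded by blast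
  have "y \<in> U" if "pre n y = pre n x" for y :: seq
  proof -
    have "y i \<in> V i" for i
      using V(1) n that by (cases "i < n") (fastforce simp: pre_eq_iff PiE_iff)+
    then show ?thesis using V(3) by (auto simp: PiE_iff)
  qed
  then show ?thesis by blast
qed

text \<open>The linear lower bound makes the infimum of \<open>a n / n\<close> finite, and this
  infimum is the limit. Since \<open>P_top\<close> is defined through \<open>lim\<close>,
  convergence must be known before the pressure says anything about partition sums.\<close>

lemma Fekete:
  fixes a :: "nat \<Rightarrow> real"
  assumes sub: "\<And>m n. a (m + n) \<le> a m + a n" and lb: "\<And>n. - B * real n \<le> a n"
  shows "convergent (\<lambda>n. a n / n)"
proof -
  define L where "L = (INF n\<in>{1..}. a n / n)"
  have bdd: "bdd_below ((\<lambda>n. a n / real n) ` {1..})"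
    using lb by (intro bdd_belowI[of _ "-B"]) (auto simp: field_simps)
  have low: "L \<le> a n / n" if "n \<ge> 1" for n
    unfolding L_def using bdd that by (intro cINF_lower) auto
  have "(\<lambda>n. a n / n) \<longlonglongrightarrow> L"
  proof (rule LIMSEQ_I)
    fix e :: real assume "0 < e"
    then have "L < L + e / 2" by simp
    then obtain k where k: "k \<ge> 1" "a k / k < L + e / 2"
      using cINF_less_iff[OF _ bdd, of "L + e / 2"] by (auto simp: L_def)
    define c where "c = a k / k"
    define M where "M = Max ((\<lambda>r. \<bar>a r\<bar>) ` {..<k})"
    have mult: "a (q * k + r) \<le> q * a k + a r" for q r
    proof (induction q)
      case (Suc q)
      then show ?case using sub[of k "q * k + r"] by (simp add: algebra_simps)
    qed simp
    \<comment> \<open>Division with remainder by k: the full blocks contribute the average c, and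
      the remainder costs a constant that does not grow with n.\<close>
    have up: "a n \<le> n * c + \<bar>c\<bar> * k + M" for n
    proof -
      have "\<bar>a (n mod k)\<bar> \<le> M" unfolding M_def using k(1) by (intro Max_ge) auto
      then have M: "a (n mod k) \<le> M" by simp
      have "a n \<le> (n div k) * a k + a (n mod k)" using mult[of "n div k" "n mod k"] by simp
      also note M
      also have "(n div k) * a k = (real n - real (n mod k)) * c"

      proof -
        have "real n = real (n div k * k + n mod k)" by simp
        then have "real n - real (n mod k) = (n div k) * real k" unfolding of_nat_add of_nat_mult by simp
        then show ?thesis using k(1) by (simp add: c_def)
      qed
      also have "\<dots> \<le> n * c + \<bar>c\<bar> * k"
      proof -
        have "- (real (n mod k) * c) \<le> real (n mod k) * \<bar>c\<bar>"
          by (metis abs_ge_minus_self mult_left_mono mult_minus_right of_nat_0_le_iff)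
        also have "\<dots> \<le> k * \<bar>c\<bar>" using k(1) by (intro mult_right_mono) auto
        finally show ?thesis by (simp add: algebra_simps)
      qed
      finally show ?thesis by simp
    qed
    obtain N where N: "real N > (\<bar>c\<bar> * k + M) / (e / 2)" using reals_Archimedean2 by blast
    have "norm (a n / n - L) < e" if n: "n \<ge> Suc N" for n
    proof -
      have "(\<bar>c\<bar> * k + M) / (e / 2) < n" using N n by linarith
      then have "(\<bar>c\<bar> * k + M) / n < e / 2" using \<open>0 < e\<close> n by (simp add: field_simps)
      moreover have "a n / n \<le> c + (\<bar>c\<bar> * k + M) / n" using up[of n] n by (simp add: field_simps)
      moreover have "L \<le> a n / n" "c < L + e / 2" using low[of n] k(2) n by (auto simp: c_def)
      ultimately show ?thesis using \<open>0 < e\<close> unfolding real_norm_def abs_less_iff by (intro conjI; linarith)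
    qed
    then show "\<exists>no. \<forall>n\<ge>no. norm (a n / n - L) < e" by blast
  qed
  then show ?thesis by (rule convergentI)
qed

section \<open>Words and points of a shift space\<close>

locale subshift =
  fixes m :: nat and X :: "seq set"
  assumes shift_space: "shift_space m X"
begin

lemma X_nonempty: "X \<noteq> {}" and compact_X: "compact X"
  and X_letters: "x \<in> X \<Longrightarrow> x i \<in> {1..m}"
  using shift_space by (auto simp: shift_space_def full_shift_def)

lemma shift_in: "x \<in> X \<Longrightarrow> (shift ^^ i) x \<in> X"
  using shift_space by (induction i) (auto simp: shift_space_def)

lemma m_pos: "1 \<le> m"
  using X_nonempty X_letters by fastforce

lemma lang_n_eq: "lang_n X n = pre n ` X"
proof safe
  fix u assume "u \<in> lang_n X n"
  then obtain x i where x: "x \<in> X" "length u = n" "\<forall>k<n. x (i + k) = u ! k"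
    by (auto simp: lang_n_def occurs_def)
  then have "u = pre n ((shift ^^ i) x)"
    by (intro nth_equalityI) (auto simp: shift_pow add.commute)
  then show "u \<in> pre n ` X" using shift_in[OF x(1)] by auto
next
  fix x assume "x \<in> X"
  then show "pre n x \<in> lang_n X n"
    by (auto simp: lang_n_def occurs_def intro!: bexI[of _ x] exI[of _ 0])
qed

lemma lang_iff: "u \<in> lang X \<longleftrightarrow> u \<noteq> [] \<and> (\<exists>x\<in>X. u = pre (length u) x)"
  by (auto simp: lang_def lang_n_eq Suc_le_eq dest: arg_cong[of _ _ length] intro!: exI[of _ "length u"])

lemma pre_in_lang: "x \<in> X \<Longrightarrow> 1 \<le> n \<Longrightarrow> pre n x \<in> lang X"
  by (auto simp: lang_def lang_n_eq)

lemma cyl_eq: "cyl X u = {x \<in> X. pre (length u) x = u}"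
  by (auto simp: cyl_def list_eq_iff_nth_eq)

lemma pre_letters: "x \<in> X \<Longrightarrow> set (pre n x) \<subseteq> {1..m}"
  using X_letters by (auto simp: pre_def)

lemma lang_letters: "u \<in> lang X \<Longrightarrow> set u \<subseteq> {1..m}"
  unfolding lang_iff using pre_letters by metis

lemma lang_n_letters: "u \<in> lang_n X n \<Longrightarrow> set u \<subseteq> {1..m} \<and> length u = n"
  using pre_letters unfolding lang_n_eq by (metis imageE length_pre)

lemma finite_lang_n [simp]: "finite (lang_n X n)"
  by (rule finite_subset[OF _ finite_lists_length_eq[of "{1..m}" n]]) (use lang_n_letters in auto)

lemma lang_n_nonempty: "lang_n X n \<noteq> {}"
  using X_nonempty by (auto simp: lang_n_eq)

text \<open>Closedness of \<open>X\<close>, by a finite subcover: if x is not in \<open>X\<close>,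
  finitely many coordinates already separate x from every point of \<open>X\<close>. It places
  sequences that are limits of words of \<open>G\<close> in the space.\<close>

lemma limit_in:
  assumes "\<And>n. \<exists>k\<ge>n. \<exists>y\<in>X. pre k x = pre k y"
  shows "x \<in> X"
proof (rule ccontr)
  assume "x \<notin> X"
  define U where "U k = {y :: seq. y k \<noteq> x k}" for k
  have "open (U k)" for k
  proof -
    have "open ((\<lambda>y :: seq. y k) -` (- {x k}))"
      by (rule open_vimage[OF _ continuous_on_product_coordinates]) (rule Topological_Spaces.open_discrete)
    then show ?thesis by (simp add: U_def vimage_def Compl_eq)
  qed
  moreover have "X \<subseteq> (\<Union>k\<in>UNIV. U k)"
  proof
    fix y assume "y \<in> X"
    then have "y \<noteq> x" using \<open>x \<notin> X\<close> by blast
    then obtain k where "y k \<noteq> x k" by blast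
    then show "y \<in> (\<Union>k\<in>UNIV. U k)" unfolding U_def by blast
  qed
  ultimately obtain C where C: "finite C" "X \<subseteq> (\<Union>k\<in>C. U k)"
    using compactE_image[OF compact_X, of UNIV U] by metis
  obtain n where n: "\<forall>i\<in>C. i < n" using C(1) finite_nat_set_iff_bounded by blast
  obtain k y where y: "k \<ge> n" "y \<in> X" "pre k x = pre k y" using assms by blast
  then show False using n C(2) by (force simp: U_def pre_eq_iff)
qed

end

section \<open>Partition sums and the two notions of pressure\<close>

locale potential = subshift +
  fixes f :: "seq \<Rightarrow> real"
  assumes cont: "continuous_on X f"
begin

definition fB :: real where "fB = (SOME B. 1 \<le> B \<and> (\<forall>x\<in>X. \<bar>f x\<bar> \<le> B))"

lemma fB: "1 \<le> fB" "x \<in> X \<Longrightarrow> \<bar>f x\<bar> \<le> fB"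
proof -
  have "bounded (f ` X)" using compact_continuous_image[OF cont compact_X] compact_imp_bounded by blast
  then obtain B where "\<forall>x\<in>X. \<bar>f x\<bar> \<le> B" by (auto simp: bounded_iff)
  then have "\<exists>B. 1 \<le> B \<and> (\<forall>x\<in>X. \<bar>f x\<bar> \<le> B)" by (intro exI[of _ "max 1 B"]) (auto simp: le_max_iff_disj)
  from someI_ex[OF this, folded fB_def] show "1 \<le> fB" "x \<in> X \<Longrightarrow> \<bar>f x\<bar> \<le> fB" by auto
qed

lemma birk_bound: "x \<in> X \<Longrightarrow> \<bar>birk f n x\<bar> \<le> fB * n"
proof -
  assume "x \<in> X"
  then have "\<bar>birk f n x\<bar> \<le> (\<Sum>i<n. fB)"
    unfolding birk_def using fB(2) shift_in by (intro order_trans[OF sum_abs] sum_mono) auto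
  then show ?thesis by (simp add: mult.commute)
qed

lemma birk_add: "birk f (a + b) x = birk f a x + birk f b ((shift ^^ a) x)"
  unfolding birk_def by (induction b) (auto simp: shift_pow add_ac)

definition sbirk :: "nat list \<Rightarrow> real" where
  "sbirk u = (SUP x\<in>cyl X u. birk f (length u) x)"

lemma sbirk_ge: "x \<in> X \<Longrightarrow> birk f n x \<le> sbirk (pre n x)"
proof -
  assume x: "x \<in> X"
  have "bdd_above ((\<lambda>x. birk f n x) ` cyl X (pre n x))"
    by (rule bdd_aboveI[of _ "fB * n"]) (use birk_bound[of _ n] in \<open>auto simp: cyl_eq abs_le_iff\<close>)
  then show ?thesis unfolding sbirk_def using x by (intro cSUP_upper2[where x = x]) (auto simp: cyl_eq)
qed

lemma sbirk_le: "u \<in> lang_n X n \<Longrightarrow> (\<And>x. x \<in> X \<Longrightarrow> pre n x = u \<Longrightarrow> birk f n x \<le> c) \<Longrightarrow> sbirk u \<le> c"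
  unfolding sbirk_def by (rule cSUP_least) (auto simp: cyl_eq lang_n_eq)

definition Zn :: "nat \<Rightarrow> real" where "Zn n = (\<Sum>u\<in>lang_n X n. exp (sbirk u))"

lemma P_top_alt: "P_top X f = lim (\<lambda>n. ln (Zn n) / real n)"
  unfolding P_top_def Zn_def sbirk_def using lang_n_letters
  by (intro arg_cong[where f = lim] ext arg_cong2[where f = "(/)"] arg_cong[where f = ln] sum.cong) auto

lemma Zn_ge: "exp (- fB * n) \<le> Zn n"
proof -
  obtain x where x: "x \<in> X" using X_nonempty by blast
  have "- fB * n \<le> birk f n x" using birk_bound[OF x, of n] by linarith
  also have "\<dots> \<le> sbirk (pre n x)" by (rule sbirk_ge[OF x])
  finally have "exp (- fB * n) \<le> exp (sbirk (pre n x))" by simp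
  also have "\<dots> \<le> Zn n" unfolding Zn_def
    by (rule member_le_sum) (use x in \<open>auto simp: lang_n_eq[symmetric]\<close>, simp add: lang_n_eq)
  finally show ?thesis .
qed

lemma Zn_pos: "0 < Zn n"
  using Zn_ge[of n] exp_gt_zero[of "- fB * n"] by linarith

lemma Zn_add: "Zn (a + b) \<le> Zn a * Zn b"
proof -
  let ?g = "\<lambda>w. (take a w, drop a w)"
  have "Zn (a + b) \<le> (\<Sum>w\<in>lang_n X (a + b). exp (sbirk (take a w)) * exp (sbirk (drop a w)))"
    unfolding Zn_def
  proof (rule sum_mono)
    fix w assume w: "w \<in> lang_n X (a + b)"
    have "sbirk w \<le> sbirk (take a w) + sbirk (drop a w)"
    proof (rule sbirk_le[OF w])
      fix x assume "x \<in> X" "pre (a + b) x = w"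
      then show "birk f (a + b) x \<le> sbirk (take a w) + sbirk (drop a w)"
        using sbirk_ge[of x a] sbirk_ge[OF shift_in[of x a], of b] by (auto simp: birk_add pre_add)
    qed
    then show "exp (sbirk w) \<le> exp (sbirk (take a w)) * exp (sbirk (drop a w))" by (simp flip: exp_add)
  qed
  also have "\<dots> = (\<Sum>(u, v)\<in>?g ` lang_n X (a + b). exp (sbirk u) * exp (sbirk v))"
    by (subst sum.reindex) (auto simp: inj_on_def append_eq_conv_conj[symmetric] intro: trans[OF append_take_drop_id[symmetric]], metis append_take_drop_id)
  also have "\<dots> \<le> (\<Sum>(u, v)\<in>lang_n X a \<times> lang_n X b. exp (sbirk u) * exp (sbirk v))"
    by (rule sum_mono2) (auto simp: lang_n_eq drop_pre shift_in, simp add: lang_n_eq[symmetric])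
  also have "\<dots> = Zn a * Zn b"
    unfolding Zn_def by (simp add: sum_product sum.cartesian_product)
  finally show ?thesis .
qed

lemma P_top_lim: "(\<lambda>n. ln (Zn n) / n) \<longlonglongrightarrow> P_top X f"
proof -
  have "convergent (\<lambda>n. ln (Zn n) / real n)"
  proof (rule Fekete)
    show "ln (Zn (a + b)) \<le> ln (Zn a) + ln (Zn b)" for a b
      using Zn_add[of a b] Zn_pos by (simp flip: ln_mult_pos)
    show "- fB * real n \<le> ln (Zn n)" for n
      using Zn_ge[of n] Zn_pos[of n] by (simp add: ln_ge_iff)
  qed
  then show ?thesis by (simp add: P_top_alt convergent_LIMSEQ_iff)
qed

lemma PP_M_alt: "PP_M X f Z s N =
     (INF U\<in>{U. U \<subseteq> lang X \<and> (\<forall>u\<in>U. N \<le> length u) \<and> Z \<subseteq> (\<Union>u\<in>U. cyl X u)}.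
        \<integral>\<^sup>+ u. ennreal (exp (- s * real (length u) + sbirk u)) \<partial>count_space U)"
  unfolding PP_M_def sbirk_def ..

text \<open>The upper bound for the pressure. The words of one length n form a cover whose sum is
  exp(-s n) Z_n, at most exp(-d n) when d is half of the excess of s over
  \<open>P_top\<close>.\<close>

lemma PP_M_zero:
  assumes Z: "Z \<subseteq> X" and s: "P_top X f < s"
  shows "PP_M X f Z s N = 0"
proof -
  define d where "d = (s - P_top X f) / 2"
  have d: "0 < d" using s by (simp add: d_def)
  have "PP_M X f Z s N \<le> 0"
  proof (rule ennreal_le_epsilon)
    fix e :: real assume "0 < e"
    have "\<forall>\<^sub>F n in sequentially. ln (Zn n) / n < P_top X f + d"
      using order_tendstoD(2)[OF P_top_lim] d by simp
    moreover have "\<forall>\<^sub>F n in sequentially. exp (- d * real n) < e"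
    proof -
      have "(\<lambda>n. exp (- d) ^ n) \<longlonglongrightarrow> 0" using d by (intro LIMSEQ_realpow_zero) auto
      then have "\<forall>\<^sub>F n in sequentially. exp (- d) ^ n < e" using order_tendstoD(2) \<open>0 < e\<close> by blast
      then show ?thesis by (simp add: exp_of_nat_mult[symmetric] mult.commute)
    qed
    ultimately have "\<forall>\<^sub>F n in sequentially. n \<ge> max N 1 \<and> ln (Zn n) / n < P_top X f + d \<and> exp (- d * real n) < e"
      using eventually_ge_at_top[of "max N 1"] by eventually_elim auto
    then obtain n where n: "n \<ge> N" "n \<ge> 1" "ln (Zn n) / n < P_top X f + d" "exp (- d * real n) < e"
      using eventually_happens by (metis (mono_tags, lifting) max.bounded_iff sequentially_bot)
    have "ln (Zn n) < (P_top X f + d) * n" using n by (simp add: field_simps)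
    then have "exp (ln (Zn n)) < exp ((P_top X f + d) * n)" by simp
    then have Z1: "Zn n < exp ((P_top X f + d) * n)" using Zn_pos by simp
    have "PP_M X f Z s N \<le> (\<integral>\<^sup>+ u. ennreal (exp (- s * real (length u) + sbirk u)) \<partial>count_space (lang_n X n))"
      unfolding PP_M_alt using n(1,2) Z
      by (intro INF_lower) (auto simp: lang_def cyl_eq dest: lang_n_letters, auto simp: lang_n_eq)
    also have "\<dots> = ennreal (\<Sum>u\<in>lang_n X n. exp (- s * real (length u) + sbirk u))"
      by (simp add: nn_integral_count_space_finite sum_ennreal)
    also have "(\<Sum>u\<in>lang_n X n. exp (- s * real (length u) + sbirk u)) = exp (- s * n) * Zn n"
      unfolding Zn_def sum_distrib_left using lang_n_letters by (intro sum.cong) (auto simp: exp_add[symmetric])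
    also have "\<dots> \<le> exp (- s * n) * exp ((P_top X f + d) * n)"
      using Z1 by (intro mult_left_mono) auto
    also have "\<dots> = exp (- d * n)" unfolding exp_add[symmetric] by (simp add: d_def field_simps)
    finally show "PP_M X f Z s N \<le> 0 + ennreal e" using n(4) by (simp add: order.trans ennreal_leI)
  qed
  then show ?thesis by simp
qed

lemma PP_M_mono: "M \<le> N \<Longrightarrow> PP_M X f Z s M \<le> PP_M X f Z s N"
  unfolding PP_M_def by (rule INF_superset_mono) auto

lemma PP_M_lim_SUP: "PP_M_lim X f Z s = (SUP N. PP_M X f Z s N)"
  unfolding PP_M_lim_def by (intro limI LIMSEQ_SUP) (auto simp: incseq_def PP_M_mono)

text \<open>Reduces the theorem to a lower bound: since \<open>PP_M\<close> increases with N,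
  positivity for a single N excludes s from the set whose infimum is the pressure.\<close>

lemma PP_pressure_eqI:
  assumes Z: "Z \<subseteq> X" and low: "\<And>s. s < P_top X f \<Longrightarrow> \<exists>N. 0 < PP_M X f Z s N"
  shows "PP_pressure X f Z = P_top X f"
proof -
  let ?S = "{s. PP_M_lim X f Z s = 0}"
  have 1: "s \<in> ?S" if "P_top X f < s" for s
    using PP_M_zero[OF Z that] by (simp add: PP_M_lim_SUP)
  have 2: "P_top X f \<le> s" if "s \<in> ?S" for s
  proof (rule ccontr)
    assume "\<not> P_top X f \<le> s"
    then obtain N where N: "0 < PP_M X f Z s N" using low[of s] by auto
    have "PP_M X f Z s N \<le> PP_M_lim X f Z s" unfolding PP_M_lim_SUP by (rule SUP_upper) auto
    then show False using that N by simp
  qed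
  have "Inf ?S = P_top X f"
  proof (rule antisym)
    show "P_top X f \<le> Inf ?S" using 1[of "P_top X f + 1"] 2 by (intro cInf_greatest) auto
    show "Inf ?S \<le> P_top X f"
    proof (rule field_le_epsilon)
      fix e :: real assume "0 < e"
      then show "Inf ?S \<le> P_top X f + e"
        using 1[of "P_top X f + e"] by (intro cInf_lower bdd_belowI[of _ "P_top X f"] 2) auto
    qed
  qed
  then show ?thesis by (simp add: PP_pressure_def)
qed

text \<open>Uniform continuity of \<open>f\<close> on the compact space: a finite subcover by
  cylinders on which \<open>f\<close> varies by less than \<eta>/2 gives one length that serves all
  points.\<close>

lemma local_approx:
  assumes "0 < \<eta>"
  shows "\<exists>l \<psi>. (\<forall>w. \<bar>\<psi> w\<bar> \<le> fB) \<and> (\<forall>x\<in>X. \<bar>f x - \<psi> (pre l x)\<bar> \<le> \<eta>)"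
proof -
  have "\<exists>n. \<forall>y\<in>X. pre n y = pre n x \<longrightarrow> \<bar>f y - f x\<bar> < \<eta> / 2" if "x \<in> X" for x
  proof -
    obtain A where A: "open A" "f -` ball (f x) (\<eta> / 2) \<inter> X = A \<inter> X"
      using cont open_ball unfolding continuous_on_open_invariant by metis
    have "x \<in> f -` ball (f x) (\<eta> / 2) \<inter> X" using that assms by simp
    then have "x \<in> A" using A(2) by blast
    from open_contains_cylinder[OF A(1) this] obtain n where n: "{y. pre n y = pre n x} \<subseteq> A" by blast
    have "\<bar>f y - f x\<bar> < \<eta> / 2" if "y \<in> X" "pre n y = pre n x" for y
    proof -
      have "y \<in> f -` ball (f x) (\<eta> / 2) \<inter> X" unfolding A(2) using n that by blast
      then show ?thesis by (simp add: dist_real_def abs_minus_commute)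
    qed
    then show ?thesis by blast
  qed
  then obtain N where N: "\<And>x y. x \<in> X \<Longrightarrow> y \<in> X \<Longrightarrow> pre (N x) y = pre (N x) x \<Longrightarrow> \<bar>f y - f x\<bar> < \<eta> / 2" by metis
  obtain C where C: "C \<subseteq> X" "finite C" "X \<subseteq> (\<Union>z\<in>C. {y. pre (N z) y = pre (N z) z})"
    by (rule compactE_image[OF compact_X, of X "\<lambda>z. {y. pre (N z) y = pre (N z) z}"]) (auto simp: open_cylinder)
  define l where "l = Max (insert 0 (N ` C))"
  have l: "\<bar>f y - f x\<bar> < \<eta>" if xy: "x \<in> X" "y \<in> X" "pre l y = pre l x" for x y
  proof -
    obtain z where z: "z \<in> C" "pre (N z) x = pre (N z) z" using C(3) xy(1) by blast
    have "N z \<le> l" unfolding l_def using z C(2) by (intro Max_ge) auto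
    then have "pre (N z) y = pre (N z) z" using pre_eq_mono[OF xy(3)] z by metis
    then show ?thesis using N[of z x] N[of z y] z C(1) xy by (smt (verit) field_sum_of_halves subset_iff)
  qed
  \<comment> \<open>The value at a word is that of \<open>f\<close> at a chosen point of its
    cylinder. Words that do not occur get 0, so the bound \<open>fB\<close> holds on all
    lists.\<close>
  define \<psi> where "\<psi> w = (if \<exists>y\<in>X. pre l y = w then f (SOME y. y \<in> X \<and> pre l y = w) else 0)" for w
  have some: "(SOME y. y \<in> X \<and> pre l y = w) \<in> X \<and> pre l (SOME y. y \<in> X \<and> pre l y = w) = w"
    if "y \<in> X" "pre l y = w" for y w using someI[of "\<lambda>y. y \<in> X \<and> pre l y = w" y] that by blast
  have "\<bar>\<psi> w\<bar> \<le> fB" for w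
    unfolding \<psi>_def using some fB(2) order_trans[OF zero_le_one fB(1)] by auto
  moreover have "\<bar>f x - \<psi> (pre l x)\<bar> \<le> \<eta>" if "x \<in> X" for x
  proof -
    let ?y = "SOME y. y \<in> X \<and> pre l y = pre l x"
    have "\<bar>f ?y - f x\<bar> < \<eta>" using some[of x "pre l x"] that by (intro l) auto
    moreover have "\<psi> (pre l x) = f ?y" using that unfolding \<psi>_def by auto
    ultimately show ?thesis by simp
  qed
  ultimately show ?thesis by blast
qed

end

section \<open>Gluing words and the entropy dichotomy\<close>

definition has_period :: "nat \<Rightarrow> nat list \<Rightarrow> bool" where
  "has_period d v \<longleftrightarrow> (\<forall>j. j + d < length v \<longrightarrow> v ! (j + d) = v ! j)"

text \<open>Equivalently, one word is a prefix of the other; two words read from the start of one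
  point are so related.\<close>

definition compat :: "nat list \<Rightarrow> nat list \<Rightarrow> bool" where
  "compat a b \<longleftrightarrow> (\<forall>i. i < length a \<longrightarrow> i < length b \<longrightarrow> a ! i = b ! i)"

lemma compat_sym: "compat a b \<Longrightarrow> compat b a"
  by (auto simp: compat_def)

lemma has_period_mod:
  assumes "has_period d v" "1 \<le> d" "j < length v"
  shows "v ! j = v ! (j mod d)"
  using assms(3)
proof (induction j rule: less_induct)
  case (less j)
  show ?case
  proof (cases "j < d")
    case False
    then have "v ! j = v ! (j - d)" using assms(1) less(2) unfolding has_period_def by (metis le_add_diff_inverse2 not_less)
    also have "\<dots> = v ! ((j - d) mod d)" using less(1)[of "j - d"] less(2) False assms(2) by simp
    also have "(j - d) mod d = j mod d" using False by (simp add: le_mod_geq)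
    finally show ?thesis .
  qed simp
qed

text \<open>A weak form of the Fine--Wilf theorem, for a word of length at least the sum of two periods.\<close>

lemma has_period_unique_extension:
  assumes "has_period d v" "1 \<le> d" "has_period e v" "1 \<le> e" "d + e \<le> length v"
  shows "v ! (j mod d) = v ! (j mod e)"
proof (induction j rule: less_induct)
  case (less j)
  show ?case
  proof (cases "j < d + e")
    case True
    then have "j < length v" using assms(5) by simp
    then show ?thesis using has_period_mod assms by metis
  next
    case False
    have "v ! (j mod d) = v ! ((j - d) mod d)" using False by (simp add: le_mod_geq)
    also have "\<dots> = v ! ((j - d) mod e)" using less[of "j - d"] assms False by simp
    also have "\<dots> = v ! ((j - d - e) mod e)" using False by (simp add: le_mod_geq)
    also have "\<dots> = v ! ((j - e - d) mod d)" using less[of "j - d - e"] assms False by (simp add: add.commute)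
    also have "\<dots> = v ! ((j - e) mod d)" using False by (simp add: le_mod_geq)
    also have "\<dots> = v ! ((j - e) mod e)" using less[of "j - e"] assms False by simp
    also have "\<dots> = v ! (j mod e)" using False by (simp add: le_mod_geq)
    finally show ?thesis .
  qed
qed

text \<open>In the second word the last displayed \<open>v\<close> starts d places later than the
  \<open>v\<close> of the first word. Comparing the two copies letter by letter gives
  \<open>v\<close> the period d, and d is positive because \<open>u\<close> is longer than the gap
  \<open>w\<close>.\<close>

lemma compat_overlap:
  assumes c: "compat (s @ w @ v @ r) (s @ w1 @ u @ w2 @ v @ r')"
    and l: "length w \<le> \<tau>" "\<tau> < length u" "length w1 \<le> \<tau>" "length w2 \<le> \<tau>"
  shows "\<exists>d. 1 \<le> d \<and> d \<le> length u + 2 * \<tau> \<and> has_period d v"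
proof -
  define d where "d = length w1 + length u + length w2 - length w"
  have d: "1 \<le> d" "d \<le> length u + 2 * \<tau>" "length w + d = length w1 + length u + length w2" using l by (auto simp: d_def)
  have "v ! (j + d) = v ! j" if "j + d < length v" for j
  proof -
    let ?i = "length s + (length w + (j + d))"
    have "(s @ w @ v @ r) ! ?i = (s @ w1 @ u @ w2 @ v @ r') ! ?i"
    proof -
      have "?i < length (s @ w @ v @ r)" "?i < length (s @ w1 @ u @ w2 @ v @ r')" using that d(3) by auto
      then show ?thesis using c unfolding compat_def by blast
    qed
    moreover have "(s @ w @ v @ r) ! ?i = v ! (j + d)" using that by (simp add: nth_append)
    moreover have "?i = length s + (length w1 + (length u + (length w2 + j)))" using d(3) by simp
    then have "(s @ w1 @ u @ w2 @ v @ r') ! ?i = v ! j" using that by (simp only: nth_append_length_plus) (simp add: nth_append)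
    ultimately show ?thesis by simp
  qed
  then show ?thesis using d by (auto simp: has_period_def)
qed

locale spec_shift = potential +
  fixes G :: "nat list set" and \<tau> :: nat and g :: "nat \<Rightarrow> nat"
  assumes G_lang: "G \<subseteq> lang X"
    and spec: "\<And>u v. u \<in> G \<Longrightarrow> v \<in> G \<Longrightarrow> \<exists>w\<in>lang X. length w \<le> \<tau> \<and> u @ w @ v \<in> G"
    and mistake: "mistake_function g"
    and approach: "\<And>w. w \<in> lang X \<Longrightarrow> \<exists>v\<in>G. edit_dist w v \<le> g (length w)"
begin

text \<open>The gap is fixed once and for all as a function of both words. Only its length and its
  membership in the language are controlled, so \<open>glue\<close> need not be injective.\<close>

definition glue :: "nat list \<Rightarrow> nat list \<Rightarrow> nat list" where
  "glue u v = u @ (SOME w. w \<in> lang X \<and> length w \<le> \<tau> \<and> u @ w @ v \<in> G) @ v"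

lemma glueE:
  assumes "u \<in> G" "v \<in> G"
  obtains w where "glue u v = u @ w @ v" "length w \<le> \<tau>" "w \<in> lang X" "glue u v \<in> G"
proof -
  define w where "w = (SOME w. w \<in> lang X \<and> length w \<le> \<tau> \<and> u @ w @ v \<in> G)"
  have "w \<in> lang X \<and> length w \<le> \<tau> \<and> u @ w @ v \<in> G"
    unfolding w_def by (rule someI_ex) (use spec[OF assms] in blast)
  then show ?thesis using that[of w] unfolding glue_def w_def by blast
qed

lemma glue_in: "u \<in> G \<Longrightarrow> v \<in> G \<Longrightarrow> glue u v \<in> G"
  by (rule glueE)

lemma length_glue:
  assumes "u \<in> G" "v \<in> G"
  shows "length u + length v \<le> length (glue u v)" "length (glue u v) \<le> length u + length v + \<tau>"
proof -
  obtain w where "glue u v = u @ w @ v" "length w \<le> \<tau>" using glueE[OF assms] by metis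
  then show "length u + length v \<le> length (glue u v)" "length (glue u v) \<le> length u + length v + \<tau>" by simp_all
qed

lemma glue_prefix: "u \<in> G \<Longrightarrow> v \<in> G \<Longrightarrow> take (length u) (glue u v) = u"
  by (simp add: glue_def)

lemma G_pre: "u \<in> G \<Longrightarrow> \<exists>x\<in>X. pre (length u) x = u"
  using G_lang by (force simp: lang_iff)

lemma G_length: "u \<in> G \<Longrightarrow> 1 \<le> length u"
  using G_lang by (force simp: lang_iff Suc_le_eq)

lemma G_nonempty: "\<exists>u. u \<in> G"
  using X_nonempty pre_in_lang[of _ 1] approach by (metis ex_in_conv order_refl)

lemma g_lim: "(\<lambda>n. real (g n) / real n) \<longlonglongrightarrow> 0"
  using mistake by (auto simp: mistake_function_def)

lemma g_small: "0 < (e :: real) \<Longrightarrow> \<forall>\<^sub>F n in sequentially. real (g n) \<le> e * n"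
proof -
  assume "0 < e"
  then have *: "\<forall>\<^sub>F n in sequentially. real (g n) / n < e" by (rule order_tendstoD(2)[OF g_lim])
  show ?thesis using * eventually_gt_at_top[of 0] by eventually_elim (simp add: field_simps)
qed

definition appr :: "nat list \<Rightarrow> nat list" where
  "appr w = (SOME v. v \<in> G \<and> edit_dist w v \<le> g (length w))"

lemma appr: "w \<in> lang X \<Longrightarrow> appr w \<in> G" "w \<in> lang X \<Longrightarrow> edit_dist w (appr w) \<le> g (length w)"
  using someI_ex[of "\<lambda>v. v \<in> G \<and> edit_dist w v \<le> g (length w)"] approach[of w]
  by (auto simp: appr_def Bex_def)

lemma appr_almost_additive:
  fixes \<kappa> B :: real and F :: "nat list \<Rightarrow> real"
  assumes "almost_additive \<kappa> B F" "w \<in> lang X"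
  shows "\<bar>F w - F (appr w)\<bar> \<le> g (length w) * (4 * \<kappa> + 2 * B)"
proof -
  have "\<bar>F w - F (appr w)\<bar> \<le> edit_dist w (appr w) * (4 * \<kappa> + 2 * B)"
    by (rule edit_dist_almost_additive[OF assms(1)])
  also have "\<dots> \<le> g (length w) * (4 * \<kappa> + 2 * B)"
    using appr(2)[OF assms(2)] almost_additiveD(3,4)[OF assms(1)] by (intro mult_right_mono) auto
  finally show ?thesis .
qed

lemma appr_length: "w \<in> lang X \<Longrightarrow> \<bar>real (length w) - real (length (appr w))\<bar> \<le> g (length w)"
  using edit_dist_length[of w "appr w"] appr(2)[of w] by linarith

fun reps :: "nat list \<Rightarrow> nat \<Rightarrow> nat list" where
  "reps u 0 = u"
| "reps u (Suc n) = glue (reps u n) u"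

lemma reps_in: "u \<in> G \<Longrightarrow> reps u n \<in> G"
  by (induction n) (auto intro: glue_in)

lemma length_reps: "u \<in> G \<Longrightarrow> Suc n * length u \<le> length (reps u n)"
proof (induction n)
  case (Suc n)
  then show ?case using length_glue(1)[OF reps_in[OF Suc(2)] Suc(2), of n] by simp
qed simp

lemma G_long: "\<exists>u\<in>G. n \<le> length u"
proof -
  obtain u where u: "u \<in> G" using G_nonempty by blast
  have "n \<le> Suc n * length u" using G_length[OF u] by (cases "length u") auto
  then show ?thesis using length_reps[OF u, of n] reps_in[OF u, of n] by (meson le_trans)
qed

section \<open>Branching gives positive entropy; no branching gives a periodic orbit\<close>

fun stream :: "nat list \<Rightarrow> nat list \<Rightarrow> nat list \<Rightarrow> bool list \<Rightarrow> nat list" where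
  "stream u v s [] = s"
| "stream u v s (b # bs) = stream u v (glue (if b then glue s u else s) v) bs"

lemma stream_in:
  assumes "u \<in> G" "v \<in> G" "s \<in> G"
  shows "stream u v s bs \<in> G"
  using assms(3)
proof (induction bs arbitrary: s)
  case (Cons b bs)
  then show ?case using assms(1,2) by (simp add: glue_in)
qed simp

lemma stream_prefix:
  assumes "u \<in> G" "v \<in> G" "s \<in> G"
  shows "\<exists>r. stream u v s bs = s @ r"
  using assms(3)
proof (induction bs arbitrary: s)
  case (Cons b bs)
  show ?case
  proof (cases b)
    case True
    then show ?thesis using Cons(1)[OF glue_in[OF glue_in[OF Cons(2) assms(1)] assms(2)]]
      by (auto simp: glue_def)
  next
    case False
    then show ?thesis using Cons(1)[OF glue_in[OF Cons(2) assms(2)]] by (auto simp: glue_def)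
  qed
qed simp

lemma length_stream:
  assumes "u \<in> G" "v \<in> G" "s \<in> G"
  shows "length (stream u v s bs) \<le> length s + length bs * (length u + length v + 2 * \<tau>)"
  using assms(3)
proof (induction bs arbitrary: s)
  case (Cons b bs)
  let ?s = "glue (if b then glue s u else s) v"
  have "length ?s \<le> length s + (length u + length v + 2 * \<tau>)"
    using length_glue(2)[OF Cons(2) assms(1)] length_glue(2)[OF Cons(2) assms(2)]
      length_glue(2)[OF glue_in[OF Cons(2) assms(1)] assms(2)] by auto
  moreover have "?s \<in> G" using assms Cons(2) by (auto intro: glue_in)
  ultimately show ?case using Cons(1)[of ?s] by simp
qed simp

text \<open>A copy of \<open>v\<close> follows every bit, and \<open>u\<close> is put before it only
  for \<open>True\<close>. At a differing bit the next copies of \<open>v\<close> are therefore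
  displaced against each other, and compatible continuations force a period on
  \<open>v\<close>.\<close>

lemma stream_branch:
  assumes G: "u \<in> G" "v \<in> G" "s \<in> G" and u: "\<tau> < length u"
    and c: "compat (stream u v s (False # bs)) (stream u v s (True # cs))"
  shows "\<exists>d. 1 \<le> d \<and> d \<le> length u + 2 * \<tau> \<and> has_period d v"
proof -
  obtain w where w: "glue s v = s @ w @ v" "length w \<le> \<tau>" using glueE[OF G(3,2)] by metis
  obtain w1 where w1: "glue s u = s @ w1 @ u" "length w1 \<le> \<tau>" using glueE[OF G(3,1)] by metis
  obtain w2 where w2: "glue (glue s u) v = glue s u @ w2 @ v" "length w2 \<le> \<tau>"
    using glueE[OF glue_in[OF G(3,1)] G(2)] by metis
  obtain r where r: "stream u v s (False # bs) = (s @ w @ v) @ r"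
    using stream_prefix[OF G(1,2) glue_in[OF G(3,2)], of bs] w by auto
  obtain r' where r': "stream u v s (True # cs) = (s @ w1 @ u @ w2 @ v) @ r'"
    using stream_prefix[OF G(1,2) glue_in[OF glue_in[OF G(3,1)] G(2)], of cs] w1 w2 by auto
  show ?thesis using c compat_overlap[of s w v r w1 u w2 r' \<tau>] w w1 w2 u unfolding r r' by simp
qed

lemma stream_incompat:
  assumes G: "u \<in> G" "v \<in> G" "s \<in> G" and u: "\<tau> < length u"
    and no: "\<not> (\<exists>d. 1 \<le> d \<and> d \<le> length u + 2 * \<tau> \<and> has_period d v)"
    and "length bs = length cs" "compat (stream u v s bs) (stream u v s cs)"
  shows "bs = cs"
  using assms(6,7) G(3)
proof (induction bs cs arbitrary: s rule: list_induct2)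
  case (Cons b bs c cs)
  show ?case
  proof (cases "b = c")
    case True
    then show ?thesis using Cons(2)[of "glue (if b then glue s u else s) v"] Cons(3,4) G(1,2) by (simp add: glue_in)
  next
    case False
    have br: "\<not> compat (stream u v s (False # xs)) (stream u v s (True # ys))" for xs ys
      using stream_branch[OF G(1,2) Cons(4) u] no by blast
    from False consider "b = False" "c = True" | "b = True" "c = False" by blast
    then show ?thesis
    proof cases
      case 1
      then show ?thesis using Cons(3) br by blast
    next
      case 2
      then show ?thesis using compat_sym[OF Cons(3)] br by blast
    qed
  qed
qed simp

text \<open>Positive topological entropy, as an eventual exponential lower bound with some rate. Its
  negation yields arbitrarily long lengths with few words.\<close>

definition pos_entropy :: bool where
  "pos_entropy \<longleftrightarrow> (\<exists>\<rho>>0. \<exists>N0. \<forall>N\<ge>N0. exp (\<rho> * real N) \<le> real (card (lang_n X N)))"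

text \<open>Distinct bit strings of equal length give incompatible streams, hence points with
  distinct prefixes. A bit lengthens the stream by at most \<open>K\<close>, so n bits yield 2^n
  words of length |v| + n K.\<close>

lemma no_period_pos_entropy:
  assumes G: "u \<in> G" "v \<in> G" and u: "\<tau> < length u"
    and no: "\<not> (\<exists>d. 1 \<le> d \<and> d \<le> length u + 2 * \<tau> \<and> has_period d v)"
  shows pos_entropy
proof -
  define K where "K = length u + length v + 2 * \<tau>"
  have K: "1 \<le> K" using u by (simp add: K_def)
  have count: "2 ^ n \<le> card (lang_n X N)" if N: "length v + n * K \<le> N" for n N
  proof -
    define A where "A = {bs :: bool list. length bs = n}"
    have "\<forall>bs. \<exists>x. x \<in> X \<and> pre (length (stream u v v bs)) x = stream u v v bs"
      using G_pre[OF stream_in[OF G G(2)]] by blast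
    then obtain x where x: "\<And>bs. x bs \<in> X" "\<And>bs. pre (length (stream u v v bs)) (x bs) = stream u v v bs" by metis
    have "inj_on (\<lambda>bs. pre N (x bs)) A"
    proof (rule inj_onI)
      fix bs cs assume A: "bs \<in> A" "cs \<in> A" "pre N (x bs) = pre N (x cs)"
      have l: "length (stream u v v bs) \<le> N" if "bs \<in> A" for bs
        using length_stream[OF G G(2), of bs] N that by (auto simp: A_def K_def)
      have "compat (stream u v v bs) (stream u v v cs)"
        unfolding compat_def
      proof (intro allI impI)
        fix i assume i: "i < length (stream u v v bs)" "i < length (stream u v v cs)"
        have "x bs i = x cs i" using A(3) l[OF A(1)] i(1) by (auto simp: pre_eq_iff)
        then show "stream u v v bs ! i = stream u v v cs ! i"
          using x(2)[of bs] x(2)[of cs] i by (metis nth_pre)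
      qed
      then show "bs = cs" using stream_incompat[OF G G(2) u no] A by (auto simp: A_def)
    qed
    moreover have "(\<lambda>bs. pre N (x bs)) ` A \<subseteq> lang_n X N" using x(1) by (auto simp: lang_n_eq)
    ultimately have "card A \<le> card (lang_n X N)" by (rule card_inj_on_le) simp
    moreover have "card A = 2 ^ n" unfolding A_def using card_lists_length_eq[of "UNIV :: bool set" n] by simp
    ultimately show ?thesis by simp
  qed
  \<comment> \<open>The factor 2 in the denominator absorbs the initial \<open>v\<close> and the
    remainder of the division by K, both at most half of N together.\<close>
  have "exp (ln 2 / (2 * K) * real N) \<le> real (card (lang_n X N))" if N: "2 * (length v + K) \<le> N" for N
  proof -
    define n where "n = (N - length v) div K"
    have "real (N - length v) = real (n * K + (N - length v) mod K)" unfolding n_def by simp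
    also have "\<dots> \<le> real (n * K + K)" using K by (intro of_nat_mono add_left_mono) (auto intro: less_imp_le)
    finally have "real N \<le> 2 * (real n * K)" using N by (simp add: of_nat_diff)
    then have "ln 2 / (2 * K) * N \<le> ln 2 * n" using K by (simp add: field_simps)
    then have "exp (ln 2 / (2 * K) * N) \<le> exp (ln 2 * n)" by simp
    also have "\<dots> = 2 ^ n" by (simp add: exp_of_nat2_mult)
    also have "\<dots> \<le> card (lang_n X N)"
    proof -
      have "n * K \<le> N - length v" unfolding n_def by simp
      moreover have "length v \<le> N" using N by simp
      ultimately have "length v + n * K \<le> N" by (simp add: le_diff_conv2 add.commute)
      then show ?thesis using count[of n N] by (metis of_nat_le_iff of_nat_numeral of_nat_power)
    qed
    finally show ?thesis .
  qed
  then have "\<forall>N\<ge>2 * (length v + K). exp (ln 2 / (2 * K) * real N) \<le> real (card (lang_n X N))" by simp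
  moreover have "0 < ln 2 / (2 * K)" using K by simp
  ultimately show ?thesis unfolding pos_entropy_def by (intro exI[of _ "ln 2 / (2 * K)"] conjI exI)
qed

text \<open>Without entropy every word of \<open>G\<close> has a period at most \<open>D\<close>,
  where \<open>D\<close> comes from one fixed word \<open>u\<close>. This applies to
  \<open>glue v0 v\<close> as well; as v0 is long, it determines the periodic continuation, and
  \<open>v\<close> is forced to lie on it.\<close>

lemma periodic_case:
  assumes "\<not> pos_entropy"
  shows "\<exists>c d. 1 \<le> d \<and> c \<in> X \<and> (\<forall>i. c (i + d) = c i) \<and> (\<forall>v\<in>G. \<exists>i. v = pre (length v) ((shift ^^ i) c))"
proof -
  obtain u where u: "u \<in> G" "Suc \<tau> \<le> length u" using G_long by blast
  define D where "D = length u + 2 * \<tau>"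
  have per: "\<exists>d. 1 \<le> d \<and> d \<le> D \<and> has_period d v" if "v \<in> G" for v
    using no_period_pos_entropy[OF u(1) that] u(2) assms unfolding D_def by auto
  \<comment> \<open>The length 2 D exceeds the sum of any two admissible periods, as the Fine-Wilf
    argument requires.\<close>
  obtain v0 where v0: "v0 \<in> G" "2 * D \<le> length v0" using G_long by blast
  obtain e where e: "1 \<le> e" "e \<le> D" "has_period e v0" using per[OF v0(1)] by blast
  define c where "c = (\<lambda>j. v0 ! (j mod e))"
  have key: "\<exists>w. glue v0 v = v0 @ w @ v \<and> pre (length (glue v0 v)) c = glue v0 v" if v: "v \<in> G" for v
  proof -
    obtain w where w: "glue v0 v = v0 @ w @ v" "glue v0 v \<in> G" using glueE[OF v0(1) v] by metis
    obtain d where d: "1 \<le> d" "d \<le> D" "has_period d (glue v0 v)" using per[OF w(2)] by blast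
    have d0: "has_period d v0"
      unfolding has_period_def
    proof (intro allI impI)
      fix j assume j: "j + d < length v0"
      then have "j + d < length (v0 @ w @ v)" by simp
      then have "(v0 @ w @ v) ! (j + d) = (v0 @ w @ v) ! j" using d(3) unfolding has_period_def w by blast
      then show "v0 ! (j + d) = v0 ! j" using j by (simp add: nth_append)
    qed
    have "glue v0 v ! j = c j" if "j < length (glue v0 v)" for j
    proof -
      have "j mod d < d" using d(1) by simp
      then have "j mod d < length v0" using d(2) v0(2) by linarith
      have "glue v0 v ! j = glue v0 v ! (j mod d)" by (rule has_period_mod[OF d(3,1) that])
      also have "\<dots> = v0 ! (j mod d)" using \<open>j mod d < length v0\<close> by (simp add: w nth_append)
      also have "\<dots> = v0 ! (j mod e)" by (rule has_period_unique_extension[OF d0 d(1) e(3,1)]) (use d e v0 in auto)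
      finally show ?thesis by (simp add: c_def)
    qed
    then have "pre (length (glue v0 v)) c = glue v0 v" by (intro nth_equalityI) auto
    then show ?thesis using w by blast
  qed
  have "c \<in> X"
  proof (rule limit_in)
    fix n
    obtain v where v: "v \<in> G" "n \<le> length v" using G_long by blast
    obtain y where y: "y \<in> X" "pre (length (glue v0 v)) y = glue v0 v" using G_pre[OF glue_in[OF v0(1) v(1)]] by blast
    show "\<exists>k\<ge>n. \<exists>y\<in>X. pre k c = pre k y"
      using key[OF v(1)] y v length_glue(1)[OF v0(1) v(1)]
      by (intro exI[of _ "length (glue v0 v)"] conjI bexI[of _ y]) auto
  qed
  moreover have "\<exists>i. v = pre (length v) ((shift ^^ i) c)" if v: "v \<in> G" for v
  proof -
    obtain w where w: "glue v0 v = v0 @ w @ v" "pre (length (v0 @ w @ v)) c = v0 @ w @ v" using key[OF v] by metis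
    have "drop (length (v0 @ w)) (pre (length (v0 @ w @ v)) c) = v" unfolding w(2) by simp
    then have "v = pre (length v) ((shift ^^ length (v0 @ w)) c)" by (simp add: drop_pre)
    then show ?thesis by blast
  qed
  moreover have "c (i + e) = c i" for i by (simp add: c_def)
  ultimately show ?thesis using e(1) by blast
qed

end

section \<open>Invariant measures in the absence of entropy\<close>

definition emp_measure :: "seq set \<Rightarrow> seq \<Rightarrow> nat \<Rightarrow> seq measure" where
  "emp_measure X x n = distr (uniform_count_measure {..<n}) (restrict_space borel X) (\<lambda>i. (shift ^^ i) x)"

lemma continuous_shift: "continuous_on UNIV shift"
  unfolding shift_def by (rule continuous_on_coordinatewise_then_product) (rule continuous_on_product_coordinates)

context subshift
begin

lemma emp_orbit_measurable:
  "x \<in> X \<Longrightarrow> (\<lambda>i. (shift ^^ i) x) \<in> measurable (uniform_count_measure {..<n}) (restrict_space borel X)"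
  using shift_in by (auto simp: measurable_def space_uniform_count_measure sets_uniform_count_measure space_restrict_space)

lemma emp_prob:
  assumes "x \<in> X" "1 \<le> n"
  shows "emp_measure X x n \<in> prob_measures X"
proof -
  have "prob_space (uniform_count_measure {..<n})"
    using assms(2) by (intro prob_space_uniform_count_measure) (auto simp: lessThan_empty_iff)
  then have "prob_space (emp_measure X x n)"
    unfolding emp_measure_def using emp_orbit_measurable[OF assms(1)] by (intro prob_space.prob_space_distr)
  then show ?thesis by (simp add: prob_measures_def emp_measure_def)
qed

lemma emp_integral:
  fixes \<phi> :: "seq \<Rightarrow> real"
  assumes "x \<in> X" "\<phi> \<in> borel_measurable (restrict_space borel X)"
  shows "integral\<^sup>L (emp_measure X x n) \<phi> = emp_int x n \<phi>"
proof -
  have "integral\<^sup>L (emp_measure X x n) \<phi> = integral\<^sup>L (uniform_count_measure {..<n}) (\<lambda>i. \<phi> ((shift ^^ i) x))"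
    unfolding emp_measure_def by (rule integral_distr[OF emp_orbit_measurable[OF assms(1)] assms(2)])
  also have "\<dots> = emp_int x n \<phi>"
    unfolding uniform_count_measure_def
    by (subst lebesgue_integral_point_measure_finite) (auto simp: emp_int_def sum_divide_distrib)
  finally show ?thesis .
qed

lemma emp_measure_eq:
  assumes "x \<in> X" "A \<in> sets (restrict_space borel X)"
  shows "measure (emp_measure X x n) A = (\<Sum>k<n. indicat_real A ((shift ^^ k) x)) / n"
proof -
  have s: "sets (emp_measure X x n) = sets (restrict_space borel X)" by (simp add: emp_measure_def)
  have "A \<subseteq> space (emp_measure X x n)" using assms(2) s sets.sets_into_space by metis
  then have "measure (emp_measure X x n) A = integral\<^sup>L (emp_measure X x n) (indicat_real A)"
    by (simp add: Int_absorb2)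
  also have "\<dots> = emp_int x n (indicat_real A)"
    by (rule emp_integral) (use assms in auto)
  finally show ?thesis by (simp add: emp_int_def)
qed

lemma inv_measureD:
  assumes "\<mu> \<in> inv_measures X"
  shows "prob_space \<mu>" "sets \<mu> = sets (restrict_space borel X)" "space \<mu> = X"
    "A \<in> sets \<mu> \<Longrightarrow> measure \<mu> (shift -` A \<inter> X) = measure \<mu> A"
proof -
  show s: "sets \<mu> = sets (restrict_space borel X)"
    using assms by (auto simp: inv_measures_def prob_measures_def)
  show "space \<mu> = X" using sets_eq_imp_space_eq[OF s] by (simp add: space_restrict_space)
  show "prob_space \<mu>" "A \<in> sets \<mu> \<Longrightarrow> measure \<mu> (shift -` A \<inter> X) = measure \<mu> A"
    using assms by (auto simp: inv_measures_def prob_measures_def)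
qed

lemma shift_X: "x \<in> X \<Longrightarrow> shift x \<in> X"
  using shift_in[of x 1] by simp

lemma shift_measurable: "shift \<in> measurable (restrict_space borel X) (restrict_space borel X)"
proof -
  have "shift \<in> borel_measurable (restrict_space borel X)"
    by (rule measurable_restrict_space1) (rule borel_measurable_continuous_onI[OF continuous_shift])
  then show ?thesis
    by (rule measurable_restrict_space2[rotated]) (auto simp: space_restrict_space shift_X)
qed

lemma inv_distr:
  assumes "\<mu> \<in> inv_measures X"
  shows "distr \<mu> \<mu> shift = \<mu>"
proof (rule measure_eqI)
  note D = inv_measureD[OF assms]
  interpret prob_space \<mu> by (rule D(1))
  fix A assume A: "A \<in> sets (distr \<mu> \<mu> shift)"
  have "shift \<in> measurable \<mu> \<mu>" using shift_measurable by (simp cong: measurable_cong_sets add: D(2))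
  then have "emeasure (distr \<mu> \<mu> shift) A = emeasure \<mu> (shift -` A \<inter> X)"
    using A by (simp add: emeasure_distr D(3))
  also have "\<dots> = emeasure \<mu> A" using D(4)[of A] A by (simp add: emeasure_eq_measure)
  finally show "emeasure (distr \<mu> \<mu> shift) A = emeasure \<mu> A" .
qed simp

lemma inv_integral_shift:
  fixes \<phi> :: "seq \<Rightarrow> real"
  assumes "\<mu> \<in> inv_measures X" "\<phi> \<in> borel_measurable (restrict_space borel X)"
  shows "(\<lambda>x. \<phi> ((shift ^^ i) x)) \<in> borel_measurable (restrict_space borel X)
    \<and> integral\<^sup>L \<mu> (\<lambda>x. \<phi> ((shift ^^ i) x)) = integral\<^sup>L \<mu> \<phi>"
proof (induction i)
  case (Suc i)
  note D = inv_measureD[OF assms(1)]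
  let ?\<psi> = "\<lambda>x. \<phi> ((shift ^^ i) x)"
  have m: "?\<psi> \<in> borel_measurable \<mu>" using Suc D(2) by (simp cong: measurable_cong_sets)
  have s: "shift \<in> measurable \<mu> \<mu>" using shift_measurable by (simp cong: measurable_cong_sets add: D(2))
  have eq: "(\<lambda>x. \<phi> ((shift ^^ Suc i) x)) = (\<lambda>x. ?\<psi> (shift x))" by (simp add: funpow_swap1)
  have "(\<lambda>x. ?\<psi> (shift x)) \<in> borel_measurable (restrict_space borel X)"
    using measurable_compose[OF shift_measurable] Suc by blast
  moreover have "integral\<^sup>L \<mu> (\<lambda>x. ?\<psi> (shift x)) = integral\<^sup>L (distr \<mu> \<mu> shift) ?\<psi>"
    by (rule integral_distr[OF s m, symmetric])
  ultimately show ?case using Suc inv_distr[OF assms(1)] unfolding eq by simp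
qed (use assms in simp)

lemma inv_integral_birk:
  assumes "\<mu> \<in> inv_measures X" "\<phi> \<in> borel_measurable (restrict_space borel X)" "\<And>x. x \<in> X \<Longrightarrow> \<bar>\<phi> x\<bar> \<le> B"
  shows "integral\<^sup>L \<mu> (birk \<phi> n) = n * integral\<^sup>L \<mu> \<phi>"
proof -
  note D = inv_measureD[OF assms(1)]
  interpret prob_space \<mu> by (rule D(1))
  have "integrable \<mu> (\<lambda>x. \<phi> ((shift ^^ i) x))" for i
    using inv_integral_shift[OF assms(1,2), of i] assms(3) shift_in
    by (intro integrable_const_bound[of _ B] AE_I2) (auto simp: D(3) cong: measurable_cong_sets simp: D(2))
  then have "integral\<^sup>L \<mu> (birk \<phi> n) = (\<Sum>i<n. integral\<^sup>L \<mu> (\<lambda>x. \<phi> ((shift ^^ i) x)))"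
    unfolding birk_def by (intro Bochner_Integration.integral_sum) auto
  also have "\<dots> = n * integral\<^sup>L \<mu> \<phi>" using inv_integral_shift[OF assms(1,2)] by simp
  finally show ?thesis .
qed

lemma joinn_props: "finite P \<Longrightarrow> disjoint P \<Longrightarrow> finite (joinn X P n) \<and> disjoint (joinn X P n)"
proof (induction n)
  case (Suc n)
  let ?J = "joinn X P n" and ?Q = "pull X P n"
  have f: "finite ?J" "disjoint ?J" using Suc by auto
  have "?Q = (\<lambda>A. (shift ^^ n) -` A \<inter> X) ` P" by (auto simp: pull_def)
  then have Qf: "finite ?Q" using Suc(2) by simp
  have Qd: "disjoint ?Q"
  proof (rule disjointI)
    fix A B assume "A \<in> ?Q" "B \<in> ?Q" "A \<noteq> B"
    then obtain A' B' where "A = (shift ^^ n) -` A' \<inter> X" "A' \<in> P" "B = (shift ^^ n) -` B' \<inter> X" "B' \<in> P" "A' \<noteq> B'"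
      by (auto simp: pull_def)
    then show "A \<inter> B = {}" using disjointD[OF Suc(3), of A' B'] by auto
  qed
  have "pjoin ?J ?Q \<subseteq> (\<lambda>(A, B). A \<inter> B) ` (?J \<times> ?Q)" by (auto simp: pjoin_def)
  then have "finite (pjoin ?J ?Q)" by (rule finite_subset) (use f Qf in auto)
  moreover have "disjoint (pjoin ?J ?Q)"
  proof (rule disjointI)
    fix A B assume "A \<in> pjoin ?J ?Q" "B \<in> pjoin ?J ?Q" "A \<noteq> B"
    then obtain a a' b b' where *: "A = a \<inter> a'" "B = b \<inter> b'" "a \<in> ?J" "b \<in> ?J" "a' \<in> ?Q" "b' \<in> ?Q" "a \<noteq> b \<or> a' \<noteq> b'"
      by (auto simp: pjoin_def)
    then have "a \<inter> b = {} \<or> a' \<inter> b' = {}" using disjointD[OF f(2)] disjointD[OF Qd] by metis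
    then show "A \<inter> B = {}" using * by auto
  qed
  ultimately show ?case by simp
qed auto

lemma eta_bounds:
  assumes "0 \<le> t" "t \<le> 1"
  shows "0 \<le> eta t" "eta t \<le> 1"
proof -
  show "0 \<le> eta t" using assms by (auto simp: eta_def mult_nonneg_nonpos)
  show "eta t \<le> 1"
  proof (cases "t = 0")
    case False
    then have "0 < t" using assms by simp
    have "- ln t = ln (1 / t)" using \<open>0 < t\<close> by (simp add: ln_div)
    also have "\<dots> \<le> 1 / t" using ln_bound[of "1 / t"] \<open>0 < t\<close> by simp
    finally have "t * (- ln t) \<le> t * (1 / t)" using \<open>0 < t\<close> by (intro mult_left_mono) auto
    then show ?thesis using \<open>0 < t\<close> by (simp add: eta_def)
  qed (simp add: eta_def)
qed

text \<open>At most \<open>card O'\<close> cells of any refined partition meet the support, and each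
  contributes at most 1. The partition entropies stay bounded, so dividing by n sends them to
  0.\<close>

lemma ks_entropy_finite_support:
  assumes \<mu>: "\<mu> \<in> inv_measures X" and O: "finite O'" "AE x in \<mu>. x \<in> O'"
  shows "ks_entropy X \<mu> = 0"
proof -
  note D = inv_measureD[OF \<mu>]
  interpret prob_space \<mu> by (rule D(1))
  have zero: "ent_part X \<mu> P = 0" if P: "is_partition \<mu> P" for P
  proof -
    have bound: "0 \<le> part_entropy \<mu> (joinn X P n) \<and> part_entropy \<mu> (joinn X P n) \<le> card O'" for n
    proof -
      let ?J = "joinn X P n"
      have J: "finite ?J" "disjoint ?J" using joinn_props[of P n] P by (auto simp: is_partition_def)
      define J' where "J' = {A \<in> ?J. A \<inter> O' \<noteq> {}}"
      \<comment> \<open>A cell outside \<open>sets \<mu>\<close> has \<open>measure\<close> 0 by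
        convention, so this covers cells of every kind.\<close>
      have null: "measure \<mu> A = 0" if "A \<inter> O' = {}" for A
      proof (cases "A \<in> sets \<mu>")
        case True
        have "AE x in \<mu>. x \<notin> A" using O(2) by eventually_elim (use that in auto)
        then show ?thesis using True by (simp add: AE_iff_measurable[OF True] measure_def AE_iff_null_sets[symmetric] null_setsD1)
      qed (rule measure_notin_sets)
      have "part_entropy \<mu> ?J = (\<Sum>A\<in>J'. eta (measure \<mu> A))"
        unfolding part_entropy_def J'_def using J(1) null
        by (intro sum.mono_neutral_right) (auto simp: eta_def)
      moreover have "(\<Sum>A\<in>J'. eta (measure \<mu> A)) \<le> card J' * 1"
        using eta_bounds(2) by (intro sum_bounded_above[where K = "1::real", THEN order_trans]) auto
      moreover have "card J' \<le> card O'"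
      proof -
        define p where "p A = (SOME x. x \<in> A \<inter> O')" for A
        have p: "p A \<in> A \<inter> O'" if "A \<in> J'" for A
        proof -
          have "\<exists>x. x \<in> A \<inter> O'" using that by (auto simp: J'_def)
          then show ?thesis unfolding p_def by (rule someI_ex)
        qed
        have "inj_on p J'"
        proof (rule inj_onI)
          fix A B assume *: "A \<in> J'" "B \<in> J'" "p A = p B"
          then have "p A \<in> A \<inter> B" using p[of A] p[of B] by auto
          then show "A = B" using disjointD[OF J(2), of A B] * by (auto simp: J'_def)
        qed
        then show ?thesis by (rule card_inj_on_le) (use p O(1) in auto)
      qed
      moreover have "0 \<le> (\<Sum>A\<in>J'. eta (measure \<mu> A))" using eta_bounds(1) by (intro sum_nonneg) auto
      ultimately show ?thesis by linarith
    qed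
    have "(\<lambda>n. part_entropy \<mu> (joinn X P n) / real n) \<longlonglongrightarrow> 0"
    proof (rule tendsto_sandwich[OF _ _ tendsto_const lim_const_over_n])
      show "\<forall>\<^sub>F n in sequentially. 0 \<le> part_entropy \<mu> (joinn X P n) / real n"
        using bound by (intro always_eventually allI divide_nonneg_nonneg) auto
      show "\<forall>\<^sub>F n in sequentially. part_entropy \<mu> (joinn X P n) / real n \<le> real (card O') / real n"
        using bound by (intro always_eventually allI divide_right_mono) auto
    qed
    then show ?thesis unfolding ent_part_def by (rule limI)
  qed
  \<comment> \<open>The trivial partition shows that the supremum is taken over a nonempty
    set.\<close>
  have "is_partition \<mu> {X}" using X_nonempty D(3) sets.top[of \<mu>] by (auto simp: is_partition_def)
  then have "ent_part X \<mu> ` {P. is_partition \<mu> P} = {0}" using zero by force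
  then show ?thesis by (simp add: ks_entropy_def)
qed

end

section \<open>Spaces in which \<open>G\<close> is read along one periodic orbit\<close>

locale periodic_core = spec_shift +
  fixes c :: seq and d :: nat
  assumes c_X: "c \<in> X" and d_pos: "1 \<le> d" and c_per: "\<And>i. c (i + d) = c i"
    and G_core: "\<And>v. v \<in> G \<Longrightarrow> \<exists>i. v = pre (length v) ((shift ^^ i) c)"
begin

lemma c_mod: "c (i mod d) = c i"
proof -
  have "c (i + k * d) = c i" for i k
    by (induction k) (auto simp: c_per add.assoc[symmetric] add.commute[of d])
  from this[of "i mod d" "i div d"] show ?thesis by (simp add: add.commute)
qed

lemma shift_c_mod: "(shift ^^ i) c = (shift ^^ (i mod d)) c"
proof
  fix j show "(shift ^^ i) c j = (shift ^^ (i mod d)) c j"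
    unfolding shift_pow using c_mod[of "j + i"] c_mod[of "j + i mod d"] by (simp add: mod_simps)
qed

lemma sum_period: "(\<Sum>k<d. h ((shift ^^ (k + i)) c)) = (\<Sum>k<d. h ((shift ^^ k) c) :: real)"
proof (induction i)
  case (Suc i)
  let ?h = "\<lambda>k. h ((shift ^^ (k + i)) c)"
  have "(\<Sum>k<d. h ((shift ^^ (k + Suc i)) c)) = (\<Sum>k<d. ?h (Suc k))" by simp
  also have "\<dots> = (\<Sum>k<Suc d. ?h k) - ?h 0" by (subst sum.lessThan_Suc_shift) simp
  also have "\<dots> = (\<Sum>k<d. ?h k) + ?h d - ?h 0" by simp
  also have "?h d = ?h 0" using shift_c_mod[of "d + i"] shift_c_mod[of i] by simp
  finally show ?case using Suc by simp
qed simp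

definition avg :: real where "avg = birk f d c / d"

lemma birk_orbit_period: "birk f d ((shift ^^ i) c) = d * avg"
proof -
  have "birk f d ((shift ^^ i) c) = (\<Sum>k<d. f ((shift ^^ (k + i)) c))"
    by (simp add: birk_def funpow_add)
  also have "\<dots> = birk f d c" unfolding sum_period by (simp add: birk_def)
  finally show ?thesis using d_pos by (simp add: avg_def)
qed

lemma abs_avg: "\<bar>avg\<bar> \<le> fB"
  using birk_bound[OF c_X, of d] d_pos by (simp add: avg_def field_simps abs_le_iff)

lemma birk_orbit: "\<bar>birk f n ((shift ^^ i) c) - n * avg\<bar> \<le> 2 * fB * d"
proof -
  have q: "birk f (q * d + r) ((shift ^^ i) c) = q * (d * avg) + birk f r ((shift ^^ (q * d + i)) c)" for q r i
  proof (induction q arbitrary: i)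
    case (Suc q)
    have "birk f (Suc q * d + r) ((shift ^^ i) c) = birk f d ((shift ^^ i) c) + birk f (q * d + r) ((shift ^^ d) ((shift ^^ i) c))"
      using birk_add[of d "q * d + r"] by (simp add: add.assoc)
    also have "(shift ^^ d) ((shift ^^ i) c) = (shift ^^ (d + i)) c" by (simp add: funpow_add)
    finally show ?case unfolding birk_orbit_period Suc by (simp add: algebra_simps)
  qed simp
  let ?r = "n mod d" and ?y = "(shift ^^ (n div d * d + i)) c"
  have n: "real n = real (n div d) * d + ?r" by (metis div_mult_mod_eq of_nat_add of_nat_mult)
  have "birk f n ((shift ^^ i) c) - n * avg = birk f ?r ?y - ?r * avg"
    using q[of "n div d" ?r i] unfolding n by (simp add: algebra_simps)
  moreover have "\<bar>birk f ?r ?y\<bar> \<le> fB * d"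
  proof -
    have "real ?r \<le> real d" using d_pos by (simp add: less_imp_le)
    then have "fB * real ?r \<le> fB * real d" using fB(1) by (intro mult_left_mono) auto
    then show ?thesis using birk_bound[OF shift_in[OF c_X], of ?r "n div d * d + i"] by linarith
  qed
  moreover have "\<bar>?r * avg\<bar> \<le> d * fB"
    unfolding abs_mult using abs_avg fB(1) d_pos less_imp_le[OF mod_less_divisor[of d n]] by (intro mult_mono) auto
  moreover have "2 * fB * d = fB * d + d * fB" by simp
  ultimately show ?thesis by linarith
qed

text \<open>Each word of length n is within g(n) edits of a piece of the orbit, so its weight is at
  most n \<open>avg\<close> plus a small multiple of n. It remains to use that some large lengths
  have few words.\<close>

lemma P_top_le_avg:
  assumes "\<not> pos_entropy"
  shows "P_top X f \<le> avg"
proof (rule field_le_epsilon)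
  fix e :: real assume e: "0 < e"
  \<comment> \<open>Five shares of \<eta>: two for replacing \<open>f\<close> by window sums twice,
    two for edits and bounded terms, one for the number of words.\<close>
  define \<eta> where "\<eta> = e / 5"
  have \<eta>: "0 < \<eta>" using e by (simp add: \<eta>_def)
  obtain l \<psi> where \<psi>: "\<And>w. \<bar>\<psi> w\<bar> \<le> fB" "\<And>x. x \<in> X \<Longrightarrow> \<bar>f x - \<psi> (pre l x)\<bar> \<le> \<eta>"
    using local_approx[OF \<eta>] by blast
  have fB0: "0 \<le> fB" using fB(1) by simp
  let ?F = "wsum l \<psi>"
  have bF: "\<bar>birk f n x - ?F (pre n x)\<bar> \<le> n * \<eta> + fB * l" if "x \<in> X" for n x
    by (rule birk_wsum) (use \<psi>(2) fB(2) fB0 shift_in[OF that] \<eta> in auto)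
  define K where "K = 4 * (fB * l) + 2 * fB + fB + \<eta>"
  define C where "C = 2 * (fB * l) + 2 * fB * d"
  have s: "sbirk w \<le> real n * avg + 2 * real n * \<eta> + real (g n) * K + C" if w: "w \<in> lang_n X n" "1 \<le> n" for w n
  proof (rule sbirk_le[OF w(1)])
    fix x assume x: "x \<in> X" "pre n x = w"
    have wl: "w \<in> lang X" "length w = n" using pre_in_lang[OF x(1) w(2)] x(2) by auto
    obtain i where i: "appr w = pre (length (appr w)) ((shift ^^ i) c)" using G_core[OF appr(1)[OF wl(1)]] by blast
    let ?k = "length (appr w)"
    have k: "\<bar>real n - ?k\<bar> \<le> g n" using appr_length[OF wl(1)] wl(2) by simp
    have 1: "birk f n x \<le> ?F w + n * \<eta> + fB * l" using bF[OF x(1), of n] x(2) by (simp add: abs_le_iff)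
    have 2: "?F w \<le> ?F (appr w) + g n * (4 * (fB * l) + 2 * fB)"
      using appr_almost_additive[OF almost_additive_wsum[of \<psi> fB l, OF \<psi>(1)] wl(1)] wl(2) by (simp add: abs_le_iff)
    have 3: "?F (appr w) \<le> birk f ?k ((shift ^^ i) c) + ?k * \<eta> + fB * l"
      using bF[OF shift_in[OF c_X, of i], of ?k] i by (simp add: abs_le_iff)
    have 4: "birk f ?k ((shift ^^ i) c) \<le> ?k * avg + 2 * fB * d"
      using birk_orbit[of ?k i] by (simp add: abs_le_iff)
    have 5: "?k * avg \<le> n * avg + g n * fB"
    proof -
      have "(?k - real n) * avg \<le> \<bar>?k - real n\<bar> * \<bar>avg\<bar>" by (metis abs_ge_self abs_mult)
      also have "\<dots> \<le> g n * fB" using k abs_avg by (intro mult_mono) auto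
      finally show ?thesis by (simp add: algebra_simps)
    qed
    have 6: "?k * \<eta> \<le> (n + real (g n)) * \<eta>" using k \<eta> by (intro mult_right_mono) auto
    show "birk f n x \<le> real n * avg + 2 * real n * \<eta> + real (g n) * K + C"
      using 1 2 3 4 5 6 unfolding K_def C_def by (simp add: algebra_simps)
  qed
  have Kp: "0 < K" using fB(1) \<eta> by (auto simp: K_def intro!: add_nonneg_pos mult_nonneg_nonneg add_nonneg_nonneg)
  have "\<forall>\<^sub>F n in sequentially. real (g n) \<le> \<eta> / K * n" by (rule g_small) (use \<eta> Kp in simp)
  moreover have "\<forall>\<^sub>F n in sequentially. C \<le> \<eta> * n"
  proof -
    obtain N :: nat where "C / \<eta> \<le> N" using real_arch_simple by blast
    then have "C \<le> \<eta> * n" if "n \<ge> N" for n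
      using that \<eta> by (simp add: field_simps) (metis le_trans mult_le_cancel_left_pos of_nat_le_iff order_trans)
    then show ?thesis by (auto simp: eventually_sequentially)
  qed
  ultimately have ev: "\<forall>\<^sub>F n in sequentially. g n * K + C \<le> 2 * real n * \<eta>"
    by eventually_elim (use Kp in \<open>simp add: field_simps\<close>)
  show "P_top X f \<le> avg + e"
  proof (rule ccontr)
    assume "\<not> ?thesis"
    then have "avg + e < P_top X f" by simp
    then have "\<forall>\<^sub>F n in sequentially. avg + e < ln (Zn n) / n" by (rule order_tendstoD(1)[OF P_top_lim])
    with ev have "\<forall>\<^sub>F n in sequentially. g n * K + C \<le> 2 * real n * \<eta> \<and> avg + e < ln (Zn n) / n \<and> 1 \<le> n"
      using eventually_ge_at_top[of 1] by eventually_elim auto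
    then obtain N0 where N0': "\<forall>n\<ge>N0. g n * K + C \<le> 2 * real n * \<eta> \<and> avg + e < ln (Zn n) / n \<and> 1 \<le> n"
      unfolding eventually_sequentially by (elim exE)
    note N0 = N0'[rule_format]
    \<comment> \<open>Only some large n has few words, but this suffices: the partition sums are
      already known to converge, so one n above N0 gives the contradiction.\<close>
    obtain n where n: "n \<ge> N0" "card (lang_n X n) < exp (\<eta> * n)"
      using assms \<eta> unfolding pos_entropy_def by (meson not_le)
    have "Zn n \<le> card (lang_n X n) * exp (n * avg + 4 * real n * \<eta>)"
      unfolding Zn_def
    proof (rule sum_bounded_above)
      fix w assume "w \<in> lang_n X n"
      then show "exp (sbirk w) \<le> exp (n * avg + 4 * real n * \<eta>)" using s[of w n] N0[OF n(1)] by simp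
    qed
    also have "\<dots> \<le> exp (\<eta> * n) * exp (n * avg + 4 * real n * \<eta>)" using n(2) by (intro mult_right_mono) auto
    also have "\<dots> = exp (n * (avg + e))" unfolding exp_add[symmetric] by (simp add: \<eta>_def algebra_simps)
    finally have "ln (Zn n) \<le> n * (avg + e)" using Zn_pos by (metis exp_ln exp_le_cancel_iff)
    then show False using N0[OF n(1)] by (auto simp: field_simps)
  qed
qed

definition orb :: "seq set" where "orb = (\<lambda>i. (shift ^^ i) c) ` {..<d}"

lemma orb_all: "(shift ^^ i) c \<in> orb"
  using shift_c_mod[of i] d_pos by (auto simp: orb_def)

text \<open>Windows that do not occur on the orbit never occur in \<open>G\<close>, so a word of the
  language contains at most a constant times \<open>g\<close> of them. Integrating the number of
  visits to \<open>bad l\<close> over n steps gives n \<mu>(bad l) \<le> K g(n + l), hence measure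
  0.\<close>

lemma orb_AE:
  assumes \<mu>: "\<mu> \<in> inv_measures X"
  shows "AE x in \<mu>. x \<in> orb"
proof -
  note D = inv_measureD[OF \<mu>]
  interpret prob_space \<mu> by (rule D(1))
  define bad where "bad l = {x \<in> X. pre l x \<notin> range (\<lambda>i. pre l ((shift ^^ i) c))}" for l
  have bad_sets: "bad l \<in> sets (restrict_space borel X)" for l
  proof -
    have "range (\<lambda>i. pre l ((shift ^^ i) c)) = (\<lambda>i. pre l ((shift ^^ i) c)) ` {..<d}"
      using shift_c_mod d_pos by (force intro!: image_eqI[of _ _ "_ mod d"])
    then have fin: "finite (range (\<lambda>i. pre l ((shift ^^ i) c)))" by simp
    have eq: "bad l = (\<Inter>u\<in>range (\<lambda>i. pre l ((shift ^^ i) c)). - {y. pre l y = u}) \<inter> X" by (auto simp: bad_def)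
    have "(\<Inter>u\<in>range (\<lambda>i. pre l ((shift ^^ i) c)). - {y :: seq. pre l y = u}) \<in> sets borel"
      using fin by (intro sets.finite_INT) (auto intro!: borel_open open_cylinder borel_comp)
    then show ?thesis unfolding eq by (simp add: sets_restrict_space image_iff) (metis Int_commute)
  qed
  have null: "measure \<mu> (bad l) = 0" for l
  proof -
    define \<phi> :: "nat list \<Rightarrow> real" where "\<phi> w = (if w \<in> range (\<lambda>i. pre l ((shift ^^ i) c)) then 0 else 1)" for w
    have aa: "almost_additive (1 * real l) 1 (wsum l \<phi>)" by (rule almost_additive_wsum) (simp add: \<phi>_def)
    have z: "wsum l \<phi> (pre k ((shift ^^ i) c)) = 0" for k i
    proof -
      have "(shift ^^ j) ((shift ^^ i) c) = (shift ^^ (j + i)) c" for j by (simp add: funpow_add)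
      then have "\<phi> (pre l ((shift ^^ j) ((shift ^^ i) c))) = 0" for j unfolding \<phi>_def by auto
      then show ?thesis by (simp add: wsum_pre cong: if_cong)
    qed
    define K where "K = 4 * (1 * real l) + 2 * 1"
    have b: "birk (indicat_real (bad l)) n x \<le> g (n + l) * K" if x: "x \<in> X" "1 \<le> n" for x n
    proof -
      let ?w = "pre (n + l) x"
      have wl: "?w \<in> lang X" using pre_in_lang x by simp
      have "birk (indicat_real (bad l)) n x = (\<Sum>i<n. \<phi> (pre l ((shift ^^ i) x)))"
        unfolding birk_def by (rule sum.cong) (use shift_in[OF x(1)] in \<open>auto simp: bad_def \<phi>_def\<close>)
      also have "\<dots> = (\<Sum>i<n. if i + l \<le> n + l then \<phi> (pre l ((shift ^^ i) x)) else 0)" by (rule sum.cong) auto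
      also have "\<dots> \<le> wsum l \<phi> ?w" unfolding wsum_pre by (rule sum_mono2) (auto simp: \<phi>_def)
      also have "\<dots> \<le> wsum l \<phi> (appr ?w) + g (n + l) * K"
        using appr_almost_additive[OF aa wl] by (simp add: K_def abs_le_iff)
      also have "wsum l \<phi> (appr ?w) = 0" using G_core[OF appr(1)[OF wl]] z by metis
      finally show ?thesis by simp
    qed
    have m: "indicat_real (bad l) \<in> borel_measurable (restrict_space borel X)" using bad_sets by simp
    have n: "n * measure \<mu> (bad l) \<le> g (n + l) * K" if "1 \<le> n" for n
    proof -
      have "n * measure \<mu> (bad l) = n * integral\<^sup>L \<mu> (indicat_real (bad l))"
        using bad_sets[of l] D(3) by (simp add: bad_def Int_absorb2)
      also have "\<dots> = integral\<^sup>L \<mu> (birk (indicat_real (bad l)) n)"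
        by (rule inv_integral_birk[OF \<mu> m, where B = 1, symmetric]) simp
      also have "\<dots> \<le> integral\<^sup>L \<mu> (\<lambda>_. g (n + l) * K)"
        by (rule integral_mono') (use b[OF _ that] D(3) in \<open>auto simp: K_def\<close>)
      also have "\<dots> = g (n + l) * K" using prob_space by simp
      finally show ?thesis .
    qed
    have "measure \<mu> (bad l) \<le> e" if e: "0 < e" for e :: real
    proof -
      have Kp: "0 < K" by (simp add: K_def)
      have "\<forall>\<^sub>F n in sequentially. real (g n) \<le> e / (2 * K) * n" by (rule g_small) (use e Kp in simp)
      then obtain N where N: "\<And>n. n \<ge> N \<Longrightarrow> real (g n) \<le> e / (2 * K) * n" unfolding eventually_sequentially by blast
      \<comment> \<open>Beyond N, so that the estimate for \<open>g\<close> applies, and beyond l,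
        so that n + l \<le> 2 n.\<close>
      let ?n = "N + l + 1"
      have "?n * measure \<mu> (bad l) \<le> g (?n + l) * K" by (rule n) simp
      also have "\<dots> \<le> e / (2 * K) * (?n + l) * K" using Kp N[of "?n + l"] by (intro mult_right_mono) auto
      also have "\<dots> = e / 2 * (?n + l)" using Kp by (simp add: field_simps)
      also have "\<dots> \<le> e / 2 * (2 * ?n)" using e by (intro mult_left_mono) auto
      finally have "?n * measure \<mu> (bad l) \<le> ?n * e" by (simp add: algebra_simps)
      then show ?thesis by (subst (asm) mult_le_cancel_left_pos) auto
    qed
    then have "measure \<mu> (bad l) \<le> 0" by (rule field_le_epsilon[of _ 0, simplified])
    then show ?thesis using measure_nonneg[of \<mu> "bad l"] by linarith
  qed
  have "bad l \<in> null_sets \<mu>" for l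
    using null[of l] bad_sets[of l] by (auto simp: null_sets_def D(2) emeasure_eq_measure)
  then have "(\<Union>l. bad l) \<in> null_sets \<mu>" by (rule null_sets_UN)
  then show ?thesis
  proof (rule AE_I')
    \<comment> \<open>The orbit has at most d points; a prefix of x that reaches past one difference
      with each of them belongs to no orbit point.\<close>
    have "x \<in> (\<Union>l. bad l)" if x: "x \<in> X" "x \<notin> orb" for x
    proof (rule ccontr)
      assume "x \<notin> (\<Union>l. bad l)"
      then have "\<forall>l. \<exists>i. pre l x = pre l ((shift ^^ i) c)" using x(1) by (auto simp: bad_def)
      then have "\<forall>l. \<exists>i<d. pre l x = pre l ((shift ^^ i) c)" using shift_c_mod d_pos by (metis mod_less_divisor Suc_le_eq One_nat_def)
      moreover have "\<forall>i. \<exists>k. x k \<noteq> (shift ^^ i) c k" using x(2) orb_all by (metis ext)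
      then obtain k where k: "\<And>i. x (k i) \<noteq> (shift ^^ i) c (k i)" by metis
      ultimately obtain i where i: "i < d" "pre (Suc (Max (k ` {..<d}))) x = pre (Suc (Max (k ` {..<d}))) ((shift ^^ i) c)" by blast
      have "k i \<le> Max (k ` {..<d})" using i(1) by (intro Max_ge) auto
      then show False using i(2) k[of i] by (auto simp: pre_eq_iff)
    qed
    then show "{x \<in> space \<mu>. x \<notin> orb} \<subseteq> (\<Union>l. bad l)" using D(3) by auto
  qed
qed

lemma pressure_mu_eq:
  assumes \<mu>: "\<mu> \<in> inv_measures X"
  shows "pressure_mu X f \<mu> = avg"
proof -
  note D = inv_measureD[OF \<mu>]
  interpret prob_space \<mu> by (rule D(1))
  have m: "f \<in> borel_measurable (restrict_space borel X)"
    by (rule borel_measurable_continuous_on_restrict[OF cont])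
  have "real d * integral\<^sup>L \<mu> f = integral\<^sup>L \<mu> (birk f d)"
    by (rule inv_integral_birk[OF \<mu> m fB(2), symmetric])
  also have "\<dots> = integral\<^sup>L \<mu> (\<lambda>_. d * avg)"
  proof (rule integral_cong_AE)
    have "(\<lambda>x. f ((shift ^^ i) x)) \<in> borel_measurable \<mu>" for i
      using inv_integral_shift[OF \<mu> m, of i] D(2) by (simp cong: measurable_cong_sets)
    then show "birk f d \<in> borel_measurable \<mu>" unfolding birk_def by (intro borel_measurable_sum)
    show "AE x in \<mu>. birk f d x = d * avg" using orb_AE[OF \<mu>]
      by eventually_elim (auto simp: orb_def birk_orbit_period)
  qed simp
  also have "\<dots> = d * avg" using prob_space by simp
  finally have "integral\<^sup>L \<mu> f = avg" using d_pos by simp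
  moreover have "ks_entropy X \<mu> = 0" by (rule ks_entropy_finite_support[OF \<mu> _ orb_AE[OF \<mu>]]) (simp add: orb_def)
  ultimately show ?thesis by (simp add: pressure_mu_def)
qed

text \<open>Provides an invariant measure, so the infimum in \<open>P_inf\<close> is taken over a
  nonempty set.\<close>

lemma orbit_measure_inv: "emp_measure X c d \<in> inv_measures X"
proof -
  have s: "sets (emp_measure X c d) = sets (restrict_space borel X)" by (simp add: emp_measure_def)
  have "measure (emp_measure X c d) (shift -` A \<inter> X) = measure (emp_measure X c d) A" if A: "A \<in> sets (emp_measure X c d)" for A
  proof -
    have A': "A \<in> sets (restrict_space borel X)" using A s by simp
    have "shift -` A \<inter> X \<in> sets (restrict_space borel X)"
      using measurable_sets[OF shift_measurable A'] by (simp add: space_restrict_space)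
    then have "measure (emp_measure X c d) (shift -` A \<inter> X) = (\<Sum>k<d. indicat_real (shift -` A \<inter> X) ((shift ^^ k) c)) / d"
      by (rule emp_measure_eq[OF c_X])
    also have "(\<Sum>k<d. indicat_real (shift -` A \<inter> X) ((shift ^^ k) c)) = (\<Sum>k<d. indicat_real A ((shift ^^ (k + 1)) c))"
      by (rule sum.cong) (use shift_in[OF c_X] in \<open>auto simp: indicator_def\<close>)
    also have "\<dots> = (\<Sum>k<d. indicat_real A ((shift ^^ k) c))" by (rule sum_period)
    also have "\<dots> / d = measure (emp_measure X c d) A" by (rule emp_measure_eq[OF c_X A', symmetric])
    finally show ?thesis .
  qed
  then show ?thesis using emp_prob[OF c_X d_pos] by (simp add: inv_measures_def)
qed

lemma P_inf_eq: "P_inf X f = avg"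
proof -
  have "pressure_mu X f ` inv_measures X = {avg}" using pressure_mu_eq orbit_measure_inv by force
  then show ?thesis by (simp add: P_inf_def)
qed

end

lemma (in spec_shift) pos_entropyI:
  assumes "P_inf X f < P_top X f"
  shows pos_entropy
proof (rule ccontr)
  assume neg: "\<not> pos_entropy"
  then obtain c d where cd: "1 \<le> d" "c \<in> X" "\<And>i. c (i + d) = c i" "\<And>v. v \<in> G \<Longrightarrow> \<exists>i. v = pre (length v) ((shift ^^ i) c)"
    using periodic_case by blast
  interpret periodic_core m X f G \<tau> g c d by unfold_locales (use cd in auto)
  show False using P_inf_eq P_top_le_avg[OF neg] assms by simp
qed

section \<open>Words with prescribed statistics\<close>

lemma wsum_nonneg: "(\<And>w. 0 \<le> \<psi> w) \<Longrightarrow> 0 \<le> wsum l \<psi> w"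
  by (induction w) auto

lemma wsum_drop:
  fixes w :: "nat list"
  assumes "\<And>w. 0 \<le> \<psi> w"
  shows "wsum l \<psi> (drop k w) \<le> wsum l \<psi> w"
proof (induction w arbitrary: k)
  case (Cons a w)
  have "wsum l \<psi> w \<le> wsum l \<psi> (a # w)" using assms[of "take l (a # w)"] by auto
  then show ?case using Cons[of "k - 1"] by (cases k) auto
qed simp

lemma wsum_windows_zero:
  assumes "\<And>i. i + l \<le> length z \<Longrightarrow> \<psi> (take l (drop i z)) = 0"
  shows "wsum l \<psi> z = 0"
  using assms
proof (induction z)
  case (Cons a z)
  have "wsum l \<psi> z = 0"
  proof (rule Cons(1))
    fix i assume "i + l \<le> length z"
    then show "\<psi> (take l (drop i z)) = 0" using Cons(2)[of "Suc i"] by simp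
  qed
  then show ?case using Cons(2)[of 0] by auto
qed simp

lemma wsum_short: "length z < l \<Longrightarrow> wsum l \<psi> z = 0"
  by (induction z) auto

lemma wsum_windows_one:
  assumes "1 \<le> l" "\<And>i. i + l \<le> length z \<Longrightarrow> \<psi> (take l (drop i z)) = 1"
  shows "real (length z) - real l \<le> wsum l \<psi> z"
  using assms(2)
proof (induction z)
  case (Cons a z)
  have "real (length z) - real l \<le> wsum l \<psi> z"
  proof (rule Cons(1))
    fix i assume "i + l \<le> length z"
    then show "\<psi> (take l (drop i z)) = 1" using Cons(2)[of "Suc i"] by simp
  qed
  then show ?case using Cons(2)[of 0] wsum_short[of "a # z" l \<psi>] by (cases "l \<le> length (a # z)") auto
next
  case Nil
  then show ?case using assms(1) by simp
qed

section \<open>Counting words with few exceptional windows\<close>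

definition few_bad :: "nat \<Rightarrow> nat \<Rightarrow> nat list set \<Rightarrow> nat \<Rightarrow> nat \<Rightarrow> nat list set" where
  "few_bad m n E N b = {w. set w \<subseteq> {1..m} \<and> length w = N \<and> wsum n (\<lambda>u. if u \<in> E then 0 else 1) w \<le> real b}"

lemma finite_few_bad: "finite (few_bad m n E N b)"
  by (rule finite_subset[OF _ finite_lists_length_eq[of "{1..m}" N]]) (auto simp: few_bad_def)

text \<open>Parse a word from the left, removing a window of \<open>E\<close> when there is one and a single letter otherwise.\<close>

lemma few_bad_step:
  assumes "n \<le> N" "1 \<le> n"
  shows "few_bad m n E N b \<subseteq> (\<lambda>(e, w). e @ w) ` (E \<times> few_bad m n E (N - n) b) \<union>
    (if b = 0 then {} else (\<Union>a\<in>{1..m}. (#) a ` few_bad m n E (N - 1) (b - 1)))"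
proof
  fix w assume "w \<in> few_bad m n E N b"
  let ?\<phi> = "\<lambda>u :: nat list. if u \<in> E then 0 else 1 :: real"
  have w: "set w \<subseteq> {1..m}" "length w = N" "wsum n ?\<phi> w \<le> b"
    using \<open>w \<in> few_bad m n E N b\<close> by (auto simp: few_bad_def)
  show "w \<in> (\<lambda>(e, w). e @ w) ` (E \<times> few_bad m n E (N - n) b) \<union>
    (if b = 0 then {} else (\<Union>a\<in>{1..m}. (#) a ` few_bad m n E (N - 1) (b - 1)))"
  proof (cases "take n w \<in> E")
    case True
    have "wsum n ?\<phi> (drop n w) \<le> wsum n ?\<phi> w" by (rule wsum_drop) simp
    then have "drop n w \<in> few_bad m n E (N - n) b"
      using w set_drop_subset[of n w] by (auto simp: few_bad_def)
    then have "w \<in> (\<lambda>(e, w). e @ w) ` (E \<times> few_bad m n E (N - n) b)"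
      using True by (intro image_eqI[of _ _ "(take n w, drop n w)"]) auto
    then show ?thesis by blast
  next
    case False
    obtain a v where av: "w = a # v" using w(2) assms by (cases w) auto
    have 1: "1 + wsum n ?\<phi> v \<le> b" using w False assms av by auto
    moreover have "0 \<le> wsum n ?\<phi> v" by (rule wsum_nonneg) simp
    ultimately have b: "1 \<le> b" by linarith
    have "v \<in> few_bad m n E (N - 1) (b - 1)"
      using w av 1 b by (auto simp: few_bad_def of_nat_diff)
    then show ?thesis using w(1) b av by auto
  qed
qed

text \<open>A removed window of \<open>E\<close> uses up n letters and has at most exp(n \<sigma>) /
  2 values; a removed single letter has m values and uses up one of the b exceptions, which is
  charged 2 m. The two halves add up to 1. The factor m^n pays for a remainder shorter than a
  window.\<close>

lemma card_few_bad:
  fixes \<sigma> :: real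
  assumes E: "finite E" "card E * exp (- (n * \<sigma>)) \<le> 1 / 2" and n: "1 \<le> n" and m: "1 \<le> m" and \<sigma>: "0 \<le> \<sigma>"
  shows "card (few_bad m n E N b) \<le> m ^ n * (2 * m) ^ b * exp (N * \<sigma>)"
proof (induction N arbitrary: b rule: less_induct)
  case (less N)
  show ?case
  proof (cases "N < n")
    case True
    have "card (few_bad m n E N b) \<le> card {w. set w \<subseteq> {1..m} \<and> length w = N}"
      by (rule card_mono[OF finite_lists_length_eq]) (auto simp: few_bad_def)
    also have "\<dots> = m ^ N" by (simp add: card_lists_length_eq)
    also have "\<dots> \<le> m ^ n" using True m by (intro power_increasing) auto
    finally have "real (card (few_bad m n E N b)) \<le> real m ^ n * 1 * 1" by (simp flip: of_nat_power)
    also have "\<dots> \<le> real m ^ n * (2 * real m) ^ b * exp (N * \<sigma>)"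
      using m \<sigma> by (intro mult_mono one_le_power) auto
    finally show ?thesis .
  next
    case False
    define T where "T = m ^ n * (2 * m) ^ b * exp (N * \<sigma>)"
    let ?A = "(\<lambda>(e, w). e @ w) ` (E \<times> few_bad m n E (N - n) b)"
    let ?B = "if b = 0 then {} else (\<Union>a\<in>{1..m}. (#) a ` few_bad m n E (N - 1) (b - 1))"
    have fin: "finite ?A" "finite ?B" using E by (auto simp: finite_few_bad)
    have "card ?A \<le> card (E \<times> few_bad m n E (N - n) b)"
      by (rule card_image_le) (use E finite_few_bad in auto)
    then have "real (card ?A) \<le> card E * real (card (few_bad m n E (N - n) b))"
      by (simp add: card_cartesian_product flip: of_nat_mult)
    also have "\<dots> \<le> card E * (m ^ n * (2 * m) ^ b * exp (real (N - n) * \<sigma>))"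
      using less[of "N - n" b] False n by (intro mult_left_mono) auto
    also have "exp (real (N - n) * \<sigma>) = exp (N * \<sigma>) * exp (- (n * \<sigma>))"
      using False by (simp add: of_nat_diff exp_diff exp_minus divide_inverse algebra_simps flip: exp_add)
    also have "card E * (m ^ n * (2 * m) ^ b * (exp (N * \<sigma>) * exp (- (n * \<sigma>)))) = (card E * exp (- (n * \<sigma>))) * T"
      by (simp add: T_def)
    also have "\<dots> \<le> 1 / 2 * T" using E(2) by (intro mult_right_mono) (auto simp: T_def)
    finally have A: "card ?A \<le> 1 / 2 * T" .
    have B: "card ?B \<le> 1 / 2 * T"
    proof (cases b)
      case 0
      then show ?thesis by (simp add: T_def)
    next
      case (Suc b')
      have "card ?B \<le> m * card (few_bad m n E (N - 1) b')"
        using card_cons_le[OF finite_few_bad[of m n E "N - 1" b'], of m] Suc by simp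
      then have "real (card ?B) \<le> m * real (card (few_bad m n E (N - 1) b'))" by (metis of_nat_le_iff of_nat_mult)
      also have "\<dots> \<le> m * (m ^ n * (2 * m) ^ b' * exp (real (N - 1) * \<sigma>))"
        using less[of "N - 1" b'] False n by (intro mult_left_mono) auto
      also have "\<dots> \<le> m * (m ^ n * (2 * m) ^ b' * exp (real N * \<sigma>))"
        using \<sigma> by (intro mult_left_mono) (auto intro!: mult_right_mono)
      also have "\<dots> = 1 / 2 * T" by (simp add: T_def Suc)
      finally show ?thesis .
    qed
    have "card (few_bad m n E N b) \<le> card (?A \<union> ?B)"
      by (rule card_mono) (use fin few_bad_step[of n N m E b] False n in auto)
    also have "\<dots> \<le> card ?A + card ?B" by (rule card_Un_le)
    finally have "real (card (few_bad m n E N b)) \<le> T" using A B by linarith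
    then show ?thesis by (simp add: T_def)
  qed
qed

lemma pigeonhole_weight:
  fixes p :: "'a \<Rightarrow> real"
  assumes "finite A" "finite T" "key ` A \<subseteq> T" "A \<noteq> {}"
  shows "\<exists>t\<in>T. sum p A \<le> card T * sum p {a \<in> A. key a = t}"
proof (rule ccontr)
  assume "\<not> ?thesis"
  then have *: "card T * sum p {a \<in> A. key a = t} < sum p A" if "t \<in> T" for t using that by (meson not_le)
  have T: "T \<noteq> {}" using assms by auto
  have "card T * sum p A = card T * (\<Sum>t\<in>T. sum p {a \<in> A. key a = t})"
    using sum.group[OF assms(1,2,3), of p] by simp
  also have "\<dots> = (\<Sum>t\<in>T. card T * sum p {a \<in> A. key a = t})" by (rule sum_distrib_left)
  also have "\<dots> < (\<Sum>t\<in>T. sum p A)" using * by (intro sum_strict_mono assms T)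
  finally show False by simp
qed

context spec_shift
begin

subsection \<open>Two different averages\<close>

text \<open>Every window of length |u| in a repetition of \<open>u\<close> fits into
  \<open>u @ w @ u\<close> for one gap w. The number of such windows grows only linearly with |u|,
  which is why a long \<open>u\<close> cannot account for a language of exponential growth.\<close>

definition rep_windows :: "nat list \<Rightarrow> nat list set" where
  "rep_windows u = (\<lambda>(w, i). take (length u) (drop i (u @ w @ u))) ` ({w. set w \<subseteq> {1..m} \<and> length w \<le> \<tau>} \<times> {..length u + \<tau>})"

lemma finite_gaps: "finite {w. set w \<subseteq> {1..m} \<and> length w \<le> \<tau>}"
  by (rule finite_lists_length_le) simp

lemma finite_rep_windows: "finite (rep_windows u)"
  unfolding rep_windows_def using finite_gaps by blast

lemma card_rep_windows: "card (rep_windows u) \<le> card {w. set w \<subseteq> {1..m} \<and> length w \<le> \<tau>} * (length u + \<tau> + 1)"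
proof -
  have "card (rep_windows u) \<le> card ({w. set w \<subseteq> {1..m} \<and> length w \<le> \<tau>} \<times> {..length u + \<tau>})"
    unfolding rep_windows_def by (rule card_image_le) (use finite_gaps in blast)
  then show ?thesis by (simp add: card_cartesian_product)
qed

text \<open>The first conjunct keeps the last copy of \<open>u\<close> in view: a window not
  contained in the earlier repetition starts after the beginning of that copy, so it lies in
  \<open>u @ w @ u\<close>.\<close>

lemma reps_windows:
  assumes u: "u \<in> G"
  shows "(\<exists>y. reps u k = y @ u) \<and> (\<forall>i. i + length u \<le> length (reps u k) \<longrightarrow> take (length u) (drop i (reps u k)) \<in> rep_windows u)"
proof (induction k)
  case 0
  have "u \<in> rep_windows u" unfolding rep_windows_def by (rule image_eqI[of _ _ "([], 0)"]) auto
  then show ?case by auto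
next
  case (Suc k)
  then obtain y where y: "reps u k = y @ u" by blast
  obtain w where w: "glue (reps u k) u = reps u k @ w @ u" "length w \<le> \<tau>" "w \<in> lang X"
    using glueE[OF reps_in[OF u] u] by metis
  have "take (length u) (drop i (reps u (Suc k))) \<in> rep_windows u" if i: "i + length u \<le> length (reps u (Suc k))" for i
  proof (cases "i + length u \<le> length (reps u k)")
    case True
    then have "take (length u) (drop i (reps u (Suc k))) = take (length u) (drop i (reps u k))" by (simp add: w)
    then show ?thesis using Suc True by simp
  next
    case False
    have r: "reps u (Suc k) = y @ (u @ w @ u)" using w(1) y by simp
    have "drop i (y @ (u @ w @ u)) = drop (i - length y) (u @ w @ u)" using False y by (subst drop_append) simp
    then have eq: "take (length u) (drop i (reps u (Suc k))) = take (length u) (drop (i - length y) (u @ w @ u))"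
      unfolding r by simp
    have "i \<le> length y + length u + length w" using i unfolding r by simp
    then show ?thesis unfolding eq rep_windows_def using w(2) lang_letters[OF w(3)]
      by (intro image_eqI[of _ _ "(w, i - length y)"]) auto
  qed
  then show ?case using w(1) by auto
qed

text \<open>Let \<phi> mark the windows that no repetition of a long \<open>u\<close> contains.
  Repetitions of \<open>u\<close> have average 0. If all words of the language had a small average,
  they would be counted by \<open>few_bad\<close> and grow too slowly for the entropy; a word of
  larger average exists, and editing it into \<open>G\<close> preserves this.\<close>

lemma two_averages:
  assumes pos: pos_entropy
  shows "\<exists>l \<phi> \<beta>. 1 \<le> l \<and> (\<forall>w. 0 \<le> \<phi> w \<and> \<phi> w \<le> (1 :: real)) \<and> 0 < \<beta> \<and> \<beta> \<le> (1 :: real) \<and>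
     (\<forall>n0. \<exists>A\<in>G. n0 \<le> length A \<and> wsum l \<phi> A = 0) \<and>
     (\<forall>n0. \<exists>B\<in>G. n0 \<le> length B \<and> \<beta> * length B \<le> wsum l \<phi> B)"
proof -
  obtain \<rho> N0 where \<rho>: "0 < \<rho>" and N0: "\<And>N. N \<ge> N0 \<Longrightarrow> exp (\<rho> * real N) \<le> real (card (lang_n X N))"
    using pos unfolding pos_entropy_def by blast
  define C where "C = card {w. set w \<subseteq> {1..m} \<and> length w \<le> \<tau>}"
  have "(\<lambda>n :: nat. real C * (n + \<tau> + 1) * exp (- (n * (\<rho> / 2)))) \<longlonglongrightarrow> 0"
    using \<rho> by real_asymp
  then have "\<forall>\<^sub>F n :: nat in sequentially. real C * (n + \<tau> + 1) * exp (- (n * (\<rho> / 2))) < 1 / 2"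
    by (rule order_tendstoD(2)) simp
  then obtain n1 :: nat where n1: "\<forall>n\<ge>n1. real C * (n + \<tau> + 1) * exp (- (n * (\<rho> / 2))) < 1 / 2"
    unfolding eventually_sequentially by (elim exE)
  obtain u where u: "u \<in> G" "n1 \<le> length u" using G_long by blast
  define n where "n = length u"
  define E where "E = rep_windows u"
  have n_pos: "1 \<le> n" using G_length[OF u(1)] by (simp add: n_def)
  have E: "card E * exp (- (n * (\<rho> / 2))) \<le> 1 / 2"
  proof -
    have "real (card E) \<le> real (C * (n + \<tau> + 1))"
      using card_rep_windows[of u] unfolding E_def C_def n_def by (rule of_nat_mono)
    then have "card E * exp (- (n * (\<rho> / 2))) \<le> real (C * (n + \<tau> + 1)) * exp (- (n * (\<rho> / 2)))"
      by (rule mult_right_mono) simp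
    also have "\<dots> \<le> 1 / 2" using n1[rule_format, of n] u(2) by (simp add: n_def algebra_simps)
    finally show ?thesis .
  qed
  define \<phi> :: "nat list \<Rightarrow> real" where "\<phi> = (\<lambda>u. if u \<in> E then 0 else 1)"
  \<comment> \<open>With 2 \<epsilon> N exceptions the factor (2 m)^b is at most exp(\<rho> N / 4).
    Together with \<rho>/2 for windows of \<open>E\<close> and \<rho>/4 for the constant m^n this
    exhausts the rate \<rho>.\<close>
  define \<epsilon> where "\<epsilon> = min (1 / 2) (\<rho> / (8 * ln (2 * real m)))"
  have lm: "0 < ln (2 * real m)" using m_pos by simp
  have \<epsilon>: "0 < \<epsilon>" "2 * \<epsilon> * ln (2 * real m) \<le> \<rho> / 4" "\<epsilon> \<le> 1"
    using \<rho> lm by (auto simp: \<epsilon>_def min_def field_simps)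
  have fE: "finite E" unfolding E_def by (rule finite_rep_windows)
  have many: "\<exists>w\<in>lang_n X N. 2 * \<epsilon> * N < wsum n \<phi> w" if N: "N \<ge> N0" "real m ^ n < exp (\<rho> / 4 * N)" for N
  proof (rule ccontr)
    assume "\<not> ?thesis"
    then have le: "wsum n \<phi> w \<le> 2 * \<epsilon> * N" if "w \<in> lang_n X N" for w using that by (meson not_le)
    define b where "b = nat \<lfloor>2 * \<epsilon> * N\<rfloor>"
    have b: "real b \<le> 2 * \<epsilon> * N" unfolding b_def using \<epsilon> by simp
    have "lang_n X N \<subseteq> few_bad m n E N b"
    proof
      fix w assume w: "w \<in> lang_n X N"
      have "\<exists>k :: nat. wsum n \<phi> w = k"
        unfolding \<phi>_def
      proof (induction w)
        case (Cons a w)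
        then obtain k :: nat where "wsum n (\<lambda>u. if u \<in> E then 0 else 1) w = real k" by blast
        then show ?case by (auto intro: exI[of _ "Suc k"] exI[of _ k])
      qed (auto intro: exI[of _ 0])
      then obtain k :: nat where k: "wsum n \<phi> w = k" by blast
      then have "k \<le> b" using le[OF w] unfolding b_def by (simp add: le_nat_floor)
      then show "w \<in> few_bad m n E N b" using lang_n_letters[OF w] k by (auto simp: few_bad_def \<phi>_def)
    qed
    then have "real (card (lang_n X N)) \<le> card (few_bad m n E N b)" by (simp add: card_mono finite_few_bad)
    also have "\<dots> \<le> real m ^ n * (2 * real m) ^ b * exp (N * (\<rho> / 2))"
      by (rule card_few_bad) (use fE E n_pos m_pos \<rho> in auto)
    also have "(2 * real m) ^ b = exp (b * ln (2 * real m))" using m_pos by (simp add: exp_of_nat_mult)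
    also have "real m ^ n * exp (b * ln (2 * real m)) * exp (N * (\<rho> / 2)) < exp (\<rho> / 4 * N) * exp (\<rho> / 4 * N) * exp (N * (\<rho> / 2))"
    proof -
      have "b * ln (2 * real m) \<le> (2 * \<epsilon> * N) * ln (2 * real m)" using b lm by (intro mult_right_mono) auto
      also have "\<dots> \<le> \<rho> / 4 * N" using \<epsilon>(2) mult_right_mono[OF \<epsilon>(2), of "real N"] by (simp add: mult_ac)
      finally have "exp (b * ln (2 * real m)) \<le> exp (\<rho> / 4 * N)" by simp
      then have "real m ^ n * exp (b * ln (2 * real m)) \<le> real m ^ n * exp (\<rho> / 4 * N)"
        by (intro mult_left_mono) auto
      also have "\<dots> < exp (\<rho> / 4 * N) * exp (\<rho> / 4 * N)" using N(2) by (intro mult_strict_right_mono) auto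
      finally show ?thesis by (intro mult_strict_right_mono) auto
    qed
    also have "\<dots> = exp (\<rho> * N)" by (simp add: algebra_simps flip: exp_add)
    finally show False using N0[OF N(1)] by linarith
  qed
  have aa: "almost_additive (1 * real n) 1 (wsum n \<phi>)" by (rule almost_additive_wsum) (simp add: \<phi>_def)
  define K where "K = 4 * (1 * real n) + 2 * 1"
  have high: "\<exists>B\<in>G. n0 \<le> length B \<and> \<epsilon> * length B \<le> wsum n \<phi> B" for n0
  proof -
    have "\<forall>\<^sub>F N in sequentially. real (g N) \<le> min (\<epsilon> / (K + 1)) (1 / 2) * N"
      by (rule g_small) (use \<epsilon> in \<open>auto simp: K_def\<close>)
    moreover have "\<forall>\<^sub>F N :: nat in sequentially. real m ^ n < exp (\<rho> / 4 * N)" using \<rho> by real_asymp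
    ultimately have "\<forall>\<^sub>F N in sequentially. real (g N) \<le> min (\<epsilon> / (K + 1)) (1 / 2) * N \<and> real m ^ n < exp (\<rho> / 4 * N) \<and> N \<ge> N0 + 2 * n0 + 1"
      using eventually_ge_at_top[of "N0 + 2 * n0 + 1"] by eventually_elim auto
    then obtain N where N: "real (g N) \<le> min (\<epsilon> / (K + 1)) (1 / 2) * N" "real m ^ n < exp (\<rho> / 4 * N)" "N \<ge> N0 + 2 * n0 + 1"
      using eventually_happens by force
    obtain w where w: "w \<in> lang_n X N" "2 * \<epsilon> * N < wsum n \<phi> w" using many[of N] N by auto
    then have wl: "w \<in> lang X" "length w = N" using N(3) lang_n_letters by (auto simp: lang_def intro!: exI[of _ N])
    have g1: "g N \<le> \<epsilon> / (K + 1) * N" "g N \<le> 1 / 2 * real N" using N(1) by (auto simp: min_mult_distrib_right)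
    \<comment> \<open>\<open>K\<close> pays for the change of the window sum by the edits, the 1 for
      the change of length.\<close>
    have g2: "g N * (K + 1) \<le> \<epsilon> * N" using g1(1) by (simp add: K_def field_simps)
    have len: "\<bar>real N - length (appr w)\<bar> \<le> g N" using appr_length[OF wl(1)] wl(2) by simp
    have "2 * \<epsilon> * N \<le> wsum n \<phi> (appr w) + g N * K"
      using appr_almost_additive[OF aa wl(1)] w(2) wl(2) by (simp add: K_def abs_le_iff)
    moreover have "\<epsilon> * length (appr w) \<le> \<epsilon> * N + g N"
    proof -
      have "\<epsilon> * length (appr w) \<le> \<epsilon> * (real N + g N)" using len \<epsilon> by (intro mult_left_mono) auto
      also have "\<dots> \<le> \<epsilon> * N + 1 * g N" using \<epsilon> mult_right_mono[of \<epsilon> 1 "real (g N)"] unfolding distrib_left by simp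
      finally show ?thesis by simp
    qed
    ultimately have "\<epsilon> * length (appr w) \<le> wsum n \<phi> (appr w)" using g2 by (simp add: algebra_simps)
    moreover have "n0 \<le> length (appr w)" using len g1(2) N(3) by linarith
    ultimately show ?thesis using appr(1)[OF wl(1)] by blast
  qed
  have low: "\<exists>A\<in>G. n0 \<le> length A \<and> wsum n \<phi> A = 0" for n0
  proof -
    have "wsum n \<phi> (reps u n0) = 0"
      by (rule wsum_windows_zero) (use reps_windows[OF u(1), of n0] in \<open>auto simp: \<phi>_def E_def n_def\<close>)
    moreover have "n0 \<le> Suc n0 * length u" using G_length[OF u(1)] by (cases "length u") auto
    then have "n0 \<le> length (reps u n0)" using length_reps[OF u(1), of n0] by linarith
    ultimately show ?thesis using reps_in[OF u(1)] by blast
  qed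
  show ?thesis
    by (rule exI[of _ n], rule exI[of _ \<phi>], rule exI[of _ \<epsilon>]) (use n_pos \<epsilon> high low in \<open>auto simp: \<phi>_def\<close>)
qed

subsection \<open>Mutually singular statistics\<close>

lemma glue_aa:
  fixes \<kappa> B :: real
  assumes F: "almost_additive \<kappa> B F" and "u \<in> G" "v \<in> G"
  shows "\<bar>F (glue u v) - F u - F v\<bar> \<le> 2 * \<kappa> + B * \<tau>"
proof -
  note D = almost_additiveD[OF F]
  obtain w where w: "glue u v = u @ w @ v" "length w \<le> \<tau>" using glueE[OF assms(2,3)] by metis
  have "\<bar>F w\<bar> \<le> B * \<tau>" using D(2)[of w] D(4) w(2) by (meson mult_left_mono of_nat_mono order_trans)
  then show ?thesis using D(1)[of u "w @ v"] D(1)[of w v] unfolding w(1) by (simp add: abs_le_iff)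
qed

text \<open>Starting from a long word of average 0, append copies of a word of average at least \<open>\<beta>\<close>;
  the average moves in small steps and has to pass \<open>t\<close>.\<close>

lemma intermediate_average:
  fixes \<beta> t \<delta> :: real
  assumes \<phi>: "\<And>w. 0 \<le> \<phi> w \<and> \<phi> w \<le> (1 :: real)" and \<beta>: "\<beta> \<le> 1" and t: "0 < t" "t < \<beta>" and \<delta>: "0 < \<delta>"
    and low: "\<And>n0. \<exists>A\<in>G. n0 \<le> length A \<and> wsum l \<phi> A = 0"
    and high: "\<And>n0. \<exists>B\<in>G. n0 \<le> length B \<and> \<beta> * length B \<le> wsum l \<phi> B"
  shows "\<exists>Q\<in>G. n1 \<le> length Q \<and> \<bar>wsum l \<phi> Q - t * length Q\<bar> \<le> \<delta> * length Q"
proof -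
  let ?F = "wsum l \<phi>"
  have aa: "almost_additive (1 * real l) 1 ?F" by (rule almost_additive_wsum) (use \<phi> in auto)
  obtain B where B: "B \<in> G" "nat \<lceil>(1 + 2 * real l + 2 * \<tau>) / (\<beta> - t)\<rceil> \<le> length B" "\<beta> * length B \<le> ?F B"
    using high by blast
  \<comment> \<open>\<open>B\<close> is so long that its surplus over slope t outweighs the gap:
    each copy raises the excess \<open>h\<close> by at least 1.\<close>
  have Bl: "1 + 2 * real l + 2 * \<tau> \<le> (\<beta> - t) * length B"
  proof -
    have "(1 + 2 * real l + 2 * \<tau>) / (\<beta> - t) \<le> length B" using B(2) by linarith
    then show ?thesis using t by (simp add: field_simps)
  qed
  \<comment> \<open>\<open>S\<close> bounds one increment of \<open>h\<close>. The starting word is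
    chosen so long that overshooting by \<open>S\<close> stays within the tolerance
    \<delta>.\<close>
  define S where "S = 2 * real l + 3 * (length B + \<tau>)"
  obtain A where A: "A \<in> G" "n1 + nat \<lceil>S / \<delta>\<rceil> \<le> length A" "?F A = 0" using low by blast
  have Al: "S \<le> \<delta> * length A"
  proof -
    have "S / \<delta> \<le> length A" using A(2) by linarith
    then show ?thesis using \<delta> by (simp add: field_simps)
  qed
  define Y where "Y i = ((\<lambda>y. glue y B) ^^ i) A" for i
  have Y: "Y i \<in> G" for i by (induction i) (auto simp: Y_def A B glue_in)
  have YS: "Y (Suc i) = glue (Y i) B" for i by (simp add: Y_def)
  have Ylen: "length A \<le> length (Y i)" for i
  proof (induction i)
    case (Suc i)
    then show ?case using length_glue(1)[OF Y B(1), of i] by (simp add: YS)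
  qed (simp add: Y_def)
  define h where "h i = ?F (Y i) - t * length (Y i)" for i
  have step: "1 \<le> h (Suc i) - h i" "h (Suc i) - h i \<le> S" for i
  proof -
    have F: "\<bar>?F (Y (Suc i)) - ?F (Y i) - ?F B\<bar> \<le> 2 * real l + \<tau>"
      using glue_aa[OF aa Y B(1), of i] by (simp add: YS)
    have L: "real (length (Y i)) + length B \<le> length (Y (Suc i))" "real (length (Y (Suc i))) \<le> length (Y i) + length B + real \<tau>"
      using length_glue[OF Y B(1), of i] unfolding YS by linarith+
    have t1: "t \<le> 1" using t \<beta> by simp
    have "t * (length (Y (Suc i)) - real (length (Y i))) \<le> t * (length B + real \<tau>)"
      using L t by (intro mult_left_mono) auto
    also have "\<dots> \<le> t * length B + \<tau>" using t t1 mult_right_mono[OF t1, of "real \<tau>"] by (simp add: algebra_simps)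
    finally have "h (Suc i) - h i \<ge> ?F B - 2 * real l - 2 * \<tau> - t * length B"
      using F unfolding h_def by (simp add: algebra_simps abs_le_iff)
    then show "1 \<le> h (Suc i) - h i" using B(3) Bl by (simp add: algebra_simps)
    have "0 \<le> t * (length (Y (Suc i)) - real (length (Y i)))" using L t by (intro mult_nonneg_nonneg) auto
    moreover have "?F B \<le> length B" using almost_additiveD(2)[OF aa, of B] by simp
    ultimately show "h (Suc i) - h i \<le> S" using F unfolding h_def S_def by (simp add: algebra_simps abs_le_iff)
  qed
  have h0: "h 0 \<le> 0" using A(3) t by (simp add: h_def Y_def)
  have hi: "h i \<ge> h 0 + i" for i
  proof (induction i)
    case (Suc i)
    then show ?case using step(1)[of i] by simp
  qed simp
  obtain n :: nat where "- h 0 < n" using reals_Archimedean2 by blast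
  then have ex: "\<exists>i. 0 < h i" using hi[of n] by (intro exI[of _ n]) linarith
  define j where "j = (LEAST i. 0 < h i)"
  have j: "0 < h j" unfolding j_def using ex by (rule LeastI_ex)
  obtain i where i: "j = Suc i" using j h0 by (cases j) auto
  have "h i \<le> 0" using not_less_Least[of i "\<lambda>i. 0 < h i"] i unfolding j_def[symmetric] by simp
  then have "h j \<le> S" using step(2)[of i] i by simp
  also have "S \<le> \<delta> * length (Y j)" using Al Ylen[of j] \<delta> by (meson mult_left_mono of_nat_mono order_trans less_imp_le)
  finally have "\<bar>?F (Y j) - t * length (Y j)\<bar> \<le> \<delta> * length (Y j)" using j by (simp add: h_def)
  moreover have "n1 \<le> length (Y j)" using Ylen[of j] A(2) by simp
  ultimately show ?thesis using Y by blast
qed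

text \<open>A further copy of \<open>Q\<close> with its gap adds at most 2\<kappa> + \<tau> +
  \<delta>|Q| \<le> 2\<delta>|Q|. The bound for suffixes carries the induction and pays once for an
  incomplete first copy; an arbitrary window pays once more for an incomplete last copy.\<close>

lemma reps_suffix_windows:
  fixes h :: "nat list \<Rightarrow> real" and \<kappa> \<delta> :: real
  assumes h: "almost_additive \<kappa> 1 h" and Q: "Q \<in> G" and \<delta>: "0 < \<delta>" "\<bar>h Q\<bar> \<le> \<delta> * length Q"
    and big: "2 * \<kappa> + \<tau> \<le> \<delta> * length Q"
  shows "(\<forall>a v. reps Q N = a @ v \<longrightarrow> \<bar>h v\<bar> \<le> 2 * \<delta> * length v + (length Q + \<tau>)) \<and>
    (\<forall>a v b. reps Q N = a @ v @ b \<longrightarrow> \<bar>h v\<bar> \<le> 2 * \<delta> * length v + (2 * length Q + 2 * \<tau> + \<kappa>))"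
proof -
  note D = almost_additiveD[OF h]
  have len: "\<bar>h v\<bar> \<le> length v" for v using D(2)[of v] by simp
  have pos: "0 \<le> 2 * \<delta> * length v" for v :: "nat list" using \<delta> by simp
  show ?thesis
  proof (induction N)
    case 0
    have lv: "length v \<le> length Q" if "Q = a @ v @ b" for a v b using arg_cong[OF that, of length] by simp
    have 1: "\<bar>h v\<bar> \<le> 2 * \<delta> * length v + (length Q + \<tau>)" if "Q = a @ v" for a v
      using len[of v] pos[of v] lv[of a v "[]"] that by (simp del: length_append)
    have 2: "\<bar>h v\<bar> \<le> 2 * \<delta> * length v + (2 * length Q + 2 * \<tau> + \<kappa>)" if "Q = a @ v @ b" for a v b
    proof -
      have "real (length v) \<le> 2 * real (length Q) + 2 * real \<tau> + \<kappa>" using lv[OF that] D(3) by simp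
      then show ?thesis using len[of v] pos[of v] by simp
    qed
    show ?case using 1 2 by (simp only: reps.simps) blast
  next
    case (Suc N)
    let ?Y = "reps Q N"
    obtain w where w: "reps Q (Suc N) = ?Y @ w @ Q" "length w \<le> \<tau>"
      using glueE[OF reps_in[OF Q] Q, of N] by (metis reps.simps(2))
    have wQ: "\<bar>h (w @ Q)\<bar> \<le> \<kappa> + \<tau> + \<delta> * length Q"
      using D(1)[of w Q] len[of w] w(2) \<delta>(2) by (simp add: abs_le_iff)
    have suf: "\<bar>h v\<bar> \<le> 2 * \<delta> * length v + (length Q + \<tau>)" if v: "?Y @ w @ Q = a @ v" for a v
    proof (cases "length a \<le> length ?Y")
      case True
      then obtain v' where v': "?Y = a @ v'" "v = v' @ w @ Q"
        using v by (auto simp: append_eq_append_conv2 dest!: sym[of "a @ _"])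
      have "\<bar>h v'\<bar> \<le> 2 * \<delta> * length v' + (length Q + \<tau>)" using Suc v'(1) by blast
      moreover have "2 * \<delta> * length v' + 2 * \<delta> * length Q \<le> 2 * \<delta> * length v"
        using \<delta> unfolding v'(2) by (simp add: algebra_simps)
      ultimately show ?thesis using D(1)[of v' "w @ Q"] wQ big unfolding v'(2) by (simp add: abs_le_iff)
    next
      case False
      then have "length v \<le> length w + length Q" using arg_cong[OF v, of length] by simp
      then show ?thesis using len[of v] pos[of v] w(2) by linarith
    qed
    have win: "\<bar>h v\<bar> \<le> 2 * \<delta> * length v + (2 * length Q + 2 * \<tau> + \<kappa>)" if v: "?Y @ w @ Q = a @ v @ b" for a v b
    proof -
      consider "length a \<ge> length ?Y" | "length (a @ v) \<le> length ?Y" | "length a < length ?Y" "length ?Y < length (a @ v)" by linarith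
      then show ?thesis
      proof cases
        case 1
        then have "length v \<le> length w + length Q" using arg_cong[OF v, of length] by simp
        then show ?thesis using len[of v] pos[of v] w(2) D(3) by linarith
      next
        case 2
        have "take (length (a @ v)) (?Y @ w @ Q) = a @ v" unfolding v by simp
        then have "take (length (a @ v)) ?Y = a @ v" using 2 by simp
        then have "?Y = a @ v @ drop (length (a @ v)) ?Y" by (metis append_take_drop_id append.assoc)
        then show ?thesis using Suc by blast
      next
        case 3
        define v1 where "v1 = take (length ?Y - length a) v"
        define v2 where "v2 = drop (length ?Y - length a) v"
        have v12: "v = v1 @ v2" by (simp add: v1_def v2_def)
        have "take (length ?Y) (?Y @ w @ Q) = a @ v1" unfolding v v1_def using 3 by simp
        then have "?Y = a @ v1" by simp
        then have "\<bar>h v1\<bar> \<le> 2 * \<delta> * length v1 + (length Q + \<tau>)" using Suc by blast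
        moreover have "length v2 \<le> \<tau> + length Q" using arg_cong[OF v, of length] 3 w(2) by (simp add: v2_def)
        moreover have "2 * \<delta> * length v1 \<le> 2 * \<delta> * length v" unfolding v12 using \<delta> by (intro mult_left_mono) auto
        ultimately show ?thesis using D(1)[of v1 v2] len[of v2] unfolding v12[symmetric] by (simp add: abs_le_iff)
      qed
    qed
    show ?case unfolding w(1) using suf win by blast
  qed
qed

text \<open>For k + 1 levels spaced by s there are words \<open>Q j\<close> of average close to t j.
  In a repetition of \<open>Q j\<close> every window of the common length L has average within 3
  \<delta> of t j, since L dwarfs the boundary errors. \<open>D j\<close> collects the windows with
  that average.\<close>

lemma singular_types:
  fixes k :: nat
  assumes pos: pos_entropy
  shows "\<exists>L D. 1 \<le> L \<and> (\<forall>i\<le>k. \<forall>j\<le>k. i \<noteq> j \<longrightarrow> D i \<inter> D j = {}) \<and>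
    (\<forall>j\<le>k. \<forall>\<theta>>0 :: real. \<forall>n0. \<exists>P\<in>G. n0 \<le> length P \<and> (1 - \<theta>) * length P \<le> wsum L (indicat_real (D j)) P)"
proof -
  obtain l \<phi> \<beta> where l: "1 \<le> l" and \<phi>: "\<And>w. 0 \<le> \<phi> w \<and> \<phi> w \<le> (1 :: real)" and \<beta>: "0 < \<beta>" "\<beta> \<le> (1 :: real)"
    and low: "\<And>n0. \<exists>A\<in>G. n0 \<le> length A \<and> wsum l \<phi> A = 0"
    and high: "\<And>n0. \<exists>B\<in>G. n0 \<le> length B \<and> \<beta> * length B \<le> wsum l \<phi> B"
    using two_averages[OF pos] by blast
  let ?F = "wsum l \<phi>"
  have aa: "almost_additive (1 * real l) 1 ?F" by (rule almost_additive_wsum) (use \<phi> in auto)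
  have F0: "0 \<le> ?F w" for w by (rule wsum_nonneg) (use \<phi> in auto)
  define s where "s = \<beta> / (k + 2)"
  have s: "0 < s" using \<beta> by (simp add: s_def)
  define t where "t j = s * (real j + 1)" for j :: nat
  have t: "0 < t j" "t j < \<beta>" if "j \<le> k" for j
  proof -
    show "0 < t j" using s by (simp add: t_def)
    have "t j < s * (k + 2)" unfolding t_def using that s by (intro mult_strict_left_mono) auto
    then show "t j < \<beta>" by (simp add: s_def)
  qed
  \<comment> \<open>Two sets \<open>D i\<close> and \<open>D j\<close> could meet only if s \<le> 6
    \<delta>.\<close>
  define \<delta> where "\<delta> = s / 8"
  have \<delta>: "0 < \<delta>" using s by (simp add: \<delta>_def)
  have "\<exists>Q. Q \<in> G \<and> nat \<lceil>(2 * real l + \<tau>) / \<delta>\<rceil> \<le> length Q \<and> \<bar>?F Q - t j * length Q\<bar> \<le> \<delta> * length Q" if "j \<le> k" for j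
    using intermediate_average[OF \<phi> \<beta>(2) t[OF that] \<delta> low high] by blast
  then obtain Q where Q: "\<And>j. j \<le> k \<Longrightarrow> Q j \<in> G" "\<And>j. j \<le> k \<Longrightarrow> nat \<lceil>(2 * real l + \<tau>) / \<delta>\<rceil> \<le> length (Q j)"
    "\<And>j. j \<le> k \<Longrightarrow> \<bar>?F (Q j) - t j * length (Q j)\<bar> \<le> \<delta> * length (Q j)" by metis
  have Ql: "2 * real l + \<tau> \<le> \<delta> * length (Q j)" if "j \<le> k" for j
  proof -
    have "(2 * real l + \<tau>) / \<delta> \<le> length (Q j)" using Q(2)[OF that] by linarith
    then show ?thesis using \<delta> by (simp add: field_simps)
  qed
  define M where "M = (\<Sum>j\<le>k. 2 * real (length (Q j)) + 2 * \<tau> + l)"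
  define L where "L = nat \<lceil>M / \<delta>\<rceil> + 1"
  have M: "2 * real (length (Q j)) + 2 * \<tau> + l \<le> \<delta> * L" if "j \<le> k" for j
  proof -
    have "2 * real (length (Q j)) + 2 * \<tau> + l \<le> M" unfolding M_def by (rule member_le_sum) (use that in auto)
    moreover have "M / \<delta> \<le> L" unfolding L_def by linarith
    then have "M \<le> \<delta> * L" using \<delta> by (simp add: field_simps)
    ultimately show ?thesis by linarith
  qed
  define D where "D j = {v. length v = L \<and> \<bar>?F v - t j * L\<bar> \<le> 3 * \<delta> * L}" for j
  have L: "1 \<le> L" by (simp add: L_def)
  have disj: "D i \<inter> D j = {}" if ij: "i < j" for i j
  proof (rule ccontr)
    assume "D i \<inter> D j \<noteq> {}"
    then obtain v where v: "\<bar>?F v - t i * L\<bar> \<le> 3 * \<delta> * L" "\<bar>?F v - t j * L\<bar> \<le> 3 * \<delta> * L" by (auto simp: D_def)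
    then have "t j * L - t i * L \<le> 6 * \<delta> * L" by (simp add: abs_le_iff)
    moreover have "t j * L - t i * L = s * (real j - real i) * L" by (simp add: t_def algebra_simps)
    moreover have "s * 1 * L \<le> s * (real j - real i) * L" using ij s by (intro mult_right_mono mult_left_mono) auto
    ultimately have "s * L \<le> 6 * \<delta> * L" by simp
    then have "s \<le> 6 * \<delta>" using L by (subst (asm) mult_le_cancel_right_pos) auto
    then show False using s by (simp add: \<delta>_def)
  qed
  have types: "\<exists>P\<in>G. n0 \<le> length P \<and> (1 - \<theta>) * length P \<le> wsum L (indicat_real (D j)) P"
    if j: "j \<le> k" and \<theta>: "0 < \<theta>" for j n0 and \<theta> :: real
  proof -
    \<comment> \<open>So many copies that the at most L positions lost at the end of the word are a
      proportion \<theta> of it.\<close>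
    define N where "N = n0 + nat \<lceil>real L / \<theta>\<rceil>"
    define P where "P = reps (Q j) N"
    let ?h = "\<lambda>w. ?F w - t j * length w"
    have h: "almost_additive (real l) 1 ?h"
      unfolding almost_additive_def
    proof (intro conjI allI)
      fix u v
      show "\<bar>?h (u @ v) - ?h u - ?h v\<bar> \<le> real l"
        using almost_additiveD(1)[OF aa, of u v] by (simp add: algebra_simps)
      have "?F u \<le> length u" using almost_additiveD(2)[OF aa, of u] by simp
      moreover have "0 \<le> t j * length u" using t[OF j] by simp
      moreover have "t j * length u \<le> 1 * real (length u)" by (rule mult_right_mono) (use t[OF j] \<beta> in auto)
      ultimately show "\<bar>?h u\<bar> \<le> 1 * real (length u)" using F0[of u] by (simp add: abs_le_iff)
    qed simp_all
    have win: "\<bar>?h v\<bar> \<le> 2 * \<delta> * length v + (2 * length (Q j) + 2 * \<tau> + real l)" if "P = a @ v @ b" for a v b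
      using reps_suffix_windows[OF h Q(1)[OF j] \<delta> Q(3)[OF j] Ql[OF j], of N, THEN conjunct2, rule_format, OF that[unfolded P_def]]
      by simp
    have "take L (drop i P) \<in> D j" if i: "i + L \<le> length P" for i
    proof -
      let ?v = "take L (drop i P)"
      have "P = take i P @ ?v @ drop (i + L) P"
        by (metis append_take_drop_id drop_drop add.commute)
      from win[OF this] have "\<bar>?h ?v\<bar> \<le> 2 * \<delta> * length ?v + (2 * length (Q j) + 2 * \<tau> + real l)" .
      moreover have lv: "length ?v = L" using i by simp
      ultimately have "\<bar>?F ?v - t j * L\<bar> \<le> 2 * \<delta> * L + \<delta> * L" using M[OF j] by simp
      then show ?thesis using lv by (simp add: D_def)
    qed
    then have "real (length P) - L \<le> wsum L (indicat_real (D j)) P"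
      by (intro wsum_windows_one L) simp
    moreover have PN: "N \<le> length P"
    proof -
      have "N \<le> Suc N * length (Q j)" using G_length[OF Q(1)[OF j]] by (cases "length (Q j)") auto
      then show ?thesis using length_reps[OF Q(1)[OF j], of N] unfolding P_def by linarith
    qed
    moreover have "L \<le> \<theta> * length P"
    proof -
      have "real L / \<theta> \<le> N" unfolding N_def by linarith
      then have "L \<le> \<theta> * N" using \<theta> by (simp add: field_simps)
      also have "\<dots> \<le> \<theta> * length P" using PN \<theta> by (intro mult_left_mono) auto
      finally show ?thesis .
    qed
    ultimately have "(1 - \<theta>) * length P \<le> wsum L (indicat_real (D j)) P" "n0 \<le> length P" by (auto simp: algebra_simps N_def)
    moreover have "P \<in> G" unfolding P_def by (rule reps_in[OF Q(1)[OF j]])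
    ultimately show ?thesis by blast
  qed
  have disj': "D i \<inter> D j = {}" if "i \<noteq> j" for i j
    using disj[of i j] disj[of j i] that by (cases i j rule: linorder_cases) auto
  show ?thesis using L disj' types by (intro exI[of _ L] exI[of _ D]) blast
qed

end

lemma aligned_mono:
  assumes "aligned k v w" "k \<le> k'"
  shows "aligned k' v w"
  using assms(2,1) by (induction rule: dec_induct) (auto intro: aligned_Suc)

context spec_shift
begin

section \<open>A family in \<open>G\<close> of nearly full pressure\<close>

lemma appr_fiber:
  assumes "N \<ge> 1"
  shows "{w \<in> lang_n X N. appr w = y} \<subseteq> ball_words m y (g N)"
proof
  fix w assume w: "w \<in> {w \<in> lang_n X N. appr w = y}"
  then have wl: "w \<in> lang X" "length w = N" using lang_n_letters assms by (auto simp: lang_def)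
  have "(edit1 ^^ edit_dist w y) y w" by (rule edits_sym[OF edit1_edit_dist])
  then have "aligned (g N) y w" using aligned_mono[OF aligned_edits] appr(2)[OF wl(1)] w wl(2) by auto
  then show "w \<in> ball_words m y (g N)" using lang_letters[OF wl(1)] by (simp add: ball_words_def)
qed

text \<open>The edit ball bound with t so small that r \<le> exp \<gamma>. The large charge ln(1/t)
  multiplies only \<open>g N\<close>, which is sublinear.\<close>

lemma card_appr_fiber:
  fixes \<gamma> :: real
  assumes \<gamma>: "0 < \<gamma>"
  shows "\<exists>C :: real. 0 \<le> C \<and> (\<forall>N\<ge>1. \<forall>y. card {w \<in> lang_n X N. appr w = y} \<le> 2 * exp (C * g N + \<gamma> * length y))"
proof -
  define t where "t = min (1 / (4 * real m)) (\<gamma> / (8 * real m))"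
  \<comment> \<open>With x = m t \<le> 1/4 one has r (1 - x) = 1 + 7 x - 8 x^2 \<ge> 1 + 5 x, which
    exceeds the required 1 + x + t because t \<le> x.\<close>
  define r where "r = 1 + 8 * real m * t"
  have m1: "1 \<le> real m" using m_pos by simp
  have t: "0 < t" "m * t \<le> 1 / 4" "8 * m * t \<le> \<gamma>" "t \<le> 1"
  proof -
    show "0 < t" using m1 \<gamma> by (simp add: t_def)
    have "m * t \<le> m * (1 / (4 * real m))" unfolding t_def by (intro mult_left_mono) auto
    then show "m * t \<le> 1 / 4" using m1 by simp
    have "8 * m * t \<le> 8 * m * (\<gamma> / (8 * real m))" unfolding t_def by (intro mult_left_mono) auto
    then show "8 * m * t \<le> \<gamma>" using m1 by simp
    have "1 * t \<le> m * t" using m1 \<open>0 < t\<close> by (intro mult_right_mono) auto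
    then show "t \<le> 1" using \<open>m * t \<le> 1 / 4\<close> by simp
  qed
  have r1: "1 \<le> r" using t m1 by (simp add: r_def)
  have r2: "r * (1 - m * t) \<ge> 1 + m * t + t"
  proof -
    have a: "(m * t) * (m * t) \<le> (1 / 4) * (m * t)" using t m1 by (intro mult_right_mono) auto
    have b: "1 * t \<le> m * t" using m1 t by (intro mult_right_mono) auto
    have "r * (1 - m * t) = 1 + 7 * (m * t) - 8 * ((m * t) * (m * t))" unfolding r_def by (simp add: algebra_simps)
    then show ?thesis using a b t by linarith
  qed
  have C0: "0 \<le> ln (1 / t)" using t by simp
  have *: "card {w \<in> lang_n X N. appr w = y} \<le> 2 * exp (ln (1 / t) * g N + \<gamma> * length y)" if "1 \<le> N" for N y
  proof -
    have "card {w \<in> lang_n X N. appr w = y} \<le> card (ball_words m y (g N))"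
      by (rule card_mono[OF finite_ball_words appr_fiber[OF that]])
    then have "real (card {w \<in> lang_n X N. appr w = y}) \<le> card (ball_words m y (g N))" by simp
    also have "\<dots> \<le> 2 * (1 / t) ^ g N * r ^ length y"
      by (rule card_ball_words) (use t r1 r2 in auto)
    also have "(1 / t) ^ g N = exp (ln (1 / t) * g N)" using t by (simp add: exp_of_nat2_mult)
    also have "r ^ length y \<le> exp (\<gamma> * length y)"
    proof -
      have "r \<le> exp (8 * real m * t)" unfolding r_def by (simp add: exp_ge_add_one_self)
      also have "\<dots> \<le> exp \<gamma>" using t by simp
      finally have "r ^ length y \<le> exp \<gamma> ^ length y" using r1 by (intro power_mono) auto
      then show ?thesis by (simp add: exp_of_nat2_mult)
    qed
    then have "2 * exp (ln (1 / t) * g N) * r ^ length y \<le> 2 * exp (ln (1 / t) * g N) * exp (\<gamma> * length y)"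
      by (rule mult_left_mono) simp
    finally show ?thesis by (simp add: exp_add)
  qed
  show ?thesis by (intro exI[of _ "ln (1 / t)"] conjI allI impI C0 *)
qed

text \<open>Sort the words of a long length by the length, the rounded weight and the rounded statistics of their
  approximations in \<open>G\<close>. The fibres of the approximation and the number of classes grow subexponentially,
  so one class keeps almost all of the pressure.\<close>

lemma main_family:
  fixes F :: "nat list \<Rightarrow> real" and \<Psi> :: "nat \<Rightarrow> nat list \<Rightarrow> real" and \<gamma> P \<eta> \<kappa> B :: real
  assumes F: "almost_additive \<kappa> B F" and \<gamma>: "0 < \<gamma>" and \<eta>: "0 < \<eta>"
    and P: "\<forall>\<^sub>F N in sequentially. exp (N * (P - \<gamma>)) \<le> (\<Sum>w\<in>lang_n X N. exp (F w))"
    and \<Psi>: "\<And>i w. i < K \<Longrightarrow> 0 \<le> \<Psi> i w \<and> \<Psi> i w \<le> length w"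
  shows "\<exists>n W lam b. n0 \<le> n \<and> finite W \<and> W \<noteq> {} \<and> W \<subseteq> G \<and>
     (\<forall>w\<in>W. length w = n \<and> lam \<le> F w \<and> (\<forall>i<K. \<bar>\<Psi> i w - b i * n\<bar> \<le> \<eta> * n)) \<and>
     (P - 6 * \<gamma>) * n \<le> ln (card W) + lam"
proof -
  note FD = almost_additiveD[OF F]
  obtain C :: real where C: "0 \<le> C" "\<And>N y. 1 \<le> N \<Longrightarrow> card {w \<in> lang_n X N. appr w = y} \<le> 2 * exp (C * g N + \<gamma> / 2 * length y)"
    using card_appr_fiber[of "\<gamma> / 2"] \<gamma> by auto
  define E where "E = 4 * \<kappa> + 2 * B"
  have E: "0 \<le> E" using FD(3,4) by (simp add: E_def)
  \<comment> \<open>Weights are rounded to multiples of \<gamma> N and statistics to multiples of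
    (\<eta>/2) N, so their ranges \<open>I\<close> and \<open>J\<close> do not depend on N. Only the
    number of possible lengths, 2 N + 1, grows.\<close>
  define I where "I = {- \<lceil>2 * B / \<gamma>\<rceil> - 1 .. \<lceil>2 * B / \<gamma>\<rceil>}"
  define J where "J = {0 .. \<lceil>4 / \<eta>\<rceil>}"
  define c0 where "c0 = card I * card ({..<K} \<rightarrow>\<^sub>E J)"
  have finIJ: "finite I" "finite ({..<K} \<rightarrow>\<^sub>E J)" by (auto simp: I_def J_def intro!: finite_PiE)
  \<comment> \<open>The entries keep the lengths n and N within a factor 2, bound the cost of edits
    and fibres by (\<gamma>/2) N, and bound the cost of passing from N to n by 2 \<gamma> N.\<close>
  define e1 where "e1 = min (1 / 2) (min (\<gamma> / (2 * (C + E + 1))) (2 * \<gamma> / (\<bar>P\<bar> + 6 * \<gamma>)))"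
  have e1: "0 < e1" using \<gamma> C(1) E by (auto simp: e1_def intro!: divide_pos_pos)
  have e1_le: "e1 \<le> 1 / 2" "e1 \<le> \<gamma> / (2 * (C + E + 1))" "e1 \<le> 2 * \<gamma> / (\<bar>P\<bar> + 6 * \<gamma>)"
    unfolding e1_def by linarith+
  have "\<forall>\<^sub>F N :: nat in sequentially. ln (real (2 * N + 1) * (c0 + 1)) + ln 2 \<le> \<gamma> / 2 * N"
  proof -
    have "(0 :: real) < real c0 + 1" by simp
    then show ?thesis using \<gamma> by real_asymp
  qed
  with P g_small[OF e1] have "\<forall>\<^sub>F N in sequentially. exp (N * (P - \<gamma>)) \<le> (\<Sum>w\<in>lang_n X N. exp (F w)) \<and>
     ln (real (2 * N + 1) * (c0 + 1)) + ln 2 \<le> \<gamma> / 2 * N \<and> real (g N) \<le> e1 * N \<and> 2 * n0 + 1 \<le> N"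
    using eventually_ge_at_top[of "2 * n0 + 1"] by eventually_elim auto
  from eventually_happens'[OF sequentially_bot this] obtain N where N: "exp (N * (P - \<gamma>)) \<le> (\<Sum>w\<in>lang_n X N. exp (F w))"
     "ln (real (2 * N + 1) * (c0 + 1)) + ln 2 \<le> \<gamma> / 2 * N" "real (g N) \<le> e1 * N" "2 * n0 + 1 \<le> N"
    by (elim exE conjE)
  have N1: "1 \<le> N" using N(4) by simp
  have g1: "g N \<le> 1 / 2 * real N" "g N * (C + E) \<le> \<gamma> / 2 * N" "g N * (\<bar>P\<bar> + 6 * \<gamma>) \<le> 2 * \<gamma> * N"
  proof -
    have "e1 * N \<le> 1 / 2 * N" by (rule mult_right_mono[OF e1_le(1)]) simp
    then show "g N \<le> 1 / 2 * real N" using N(3) by simp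
    have "e1 * N \<le> \<gamma> / (2 * (C + E + 1)) * N" by (rule mult_right_mono[OF e1_le(2)]) simp
    then have "g N \<le> \<gamma> / (2 * (C + E + 1)) * N" using N(3) by simp
    then have "g N * (C + E + 1) \<le> \<gamma> / 2 * N" using C(1) E by (simp add: field_simps)
    then show "g N * (C + E) \<le> \<gamma> / 2 * N" by (simp add: distrib_left)
    have "e1 * N \<le> 2 * \<gamma> / (\<bar>P\<bar> + 6 * \<gamma>) * N" by (rule mult_right_mono[OF e1_le(3)]) simp
    then have "g N \<le> 2 * \<gamma> / (\<bar>P\<bar> + 6 * \<gamma>) * N" using N(3) by simp
    then show "g N * (\<bar>P\<bar> + 6 * \<gamma>) \<le> 2 * \<gamma> * N" using \<gamma> by (simp add: pos_le_divide_eq add_nonneg_pos)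
  qed
  let ?A = "lang_n X N"
  have wl: "w \<in> lang X" "length w = N" if "w \<in> ?A" for w using that lang_n_letters N1 by (auto simp: lang_def)
  have vlen: "\<bar>real N - length (appr w)\<bar> \<le> g N" if "w \<in> ?A" for w using appr_length wl[OF that] by metis
  define key where "key w = (length (appr w), \<lfloor>F (appr w) / (\<gamma> * N)\<rfloor>, restrict (\<lambda>i. \<lfloor>\<Psi> i (appr w) / (\<eta> / 2 * N)\<rfloor>) {..<K})" for w
  let ?T = "{..2 * N} \<times> I \<times> ({..<K} \<rightarrow>\<^sub>E J)"
  have keyT: "key ` ?A \<subseteq> ?T"
  proof
    fix \<kappa>' assume "\<kappa>' \<in> key ` ?A"
    then obtain w where w: "w \<in> ?A" "\<kappa>' = key w" by auto
    let ?v = "appr w"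
    have l2: "real (length ?v) \<le> 2 * N" using vlen[OF w(1)] g1(1) by linarith
    have gN: "0 < \<gamma> * N" "0 < \<eta> / 2 * N" using \<gamma> \<eta> N1 by auto
    have "\<bar>F ?v\<bar> \<le> B * (2 * N)" using FD(2)[of ?v] l2 FD(4) by (meson mult_left_mono order_trans)
    also have "\<dots> = 2 * B / \<gamma> * (\<gamma> * N)" using \<gamma> by simp
    finally have ab: "\<bar>F ?v / (\<gamma> * N)\<bar> \<le> 2 * B / \<gamma>" using gN by (simp add: abs_divide pos_divide_le_eq)
    have "- \<lceil>2 * B / \<gamma>\<rceil> - 1 \<le> \<lfloor>F ?v / (\<gamma> * N)\<rfloor>" "\<lfloor>F ?v / (\<gamma> * N)\<rfloor> \<le> \<lceil>2 * B / \<gamma>\<rceil>"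
      using abs_le_D1[OF ab] abs_le_D2[OF ab] by linarith+
    moreover have "0 \<le> \<lfloor>\<Psi> i ?v / (\<eta> / 2 * N)\<rfloor> \<and> \<lfloor>\<Psi> i ?v / (\<eta> / 2 * N)\<rfloor> \<le> \<lceil>4 / \<eta>\<rceil>" if i: "i < K" for i
    proof -
      have "\<Psi> i ?v \<le> 2 * N" using \<Psi>[OF i, of ?v] l2 by linarith
      also have "\<dots> = 4 / \<eta> * (\<eta> / 2 * N)" using \<eta> by simp
      finally have "\<Psi> i ?v / (\<eta> / 2 * N) \<le> 4 / \<eta>" using gN(2) pos_divide_le_eq by blast
      moreover have "0 \<le> \<Psi> i ?v / (\<eta> / 2 * N)" using \<Psi>[OF i, of ?v] gN(2) by simp
      ultimately show ?thesis by (simp add: floor_le_iff) linarith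
    qed
    moreover have "length ?v \<le> 2 * N" using l2 by linarith
    ultimately show "\<kappa>' \<in> ?T" unfolding w(2) key_def I_def J_def by auto
  qed
  have finT: "finite ?T" using finIJ by auto
  obtain \<kappa>0 where \<kappa>0: "(\<Sum>w\<in>?A. exp (F w)) \<le> card ?T * (\<Sum>w | w \<in> ?A \<and> key w = \<kappa>0. exp (F w))"
    using pigeonhole_weight[OF finite_lang_n finT keyT lang_n_nonempty, of "\<lambda>w. exp (F w)"] by blast
  define A' where "A' = {w \<in> ?A. key w = \<kappa>0}"
  have finA': "finite A'" by (simp add: A'_def)
  obtain n q s where \<kappa>0_eq: "\<kappa>0 = (n, q, s)" by (cases \<kappa>0)
  define W where "W = appr ` A'"
  define lam where "lam = q * (\<gamma> * N)"
  have gN: "0 < \<gamma> * N" "0 < \<eta> / 2 * N" using \<gamma> \<eta> N1 by auto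
  have A'ne: "A' \<noteq> {}"
  proof
    assume "A' = {}"
    then have "(\<Sum>w\<in>?A. exp (F w)) \<le> 0" using \<kappa>0 unfolding A'_def[symmetric] by simp
    then have "exp (N * (P - \<gamma>)) \<le> 0" using N(1) by linarith
    then show False by simp
  qed
  have A': "length (appr w) = n" "lam \<le> F (appr w)" "F (appr w) \<le> lam + \<gamma> * N"
    "i < K \<Longrightarrow> \<bar>\<Psi> i (appr w) - s i * (\<eta> / 2 * N)\<bar> \<le> \<eta> / 2 * N" if "w \<in> A'" for w i
  proof -
    have k: "length (appr w) = n" "\<lfloor>F (appr w) / (\<gamma> * N)\<rfloor> = q" "i < K \<Longrightarrow> \<lfloor>\<Psi> i (appr w) / (\<eta> / 2 * N)\<rfloor> = s i"
      using that unfolding A'_def key_def \<kappa>0_eq by auto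
    show "length (appr w) = n" by (rule k(1))
    have "q \<le> F (appr w) / (\<gamma> * N)" "F (appr w) / (\<gamma> * N) \<le> q + 1" using k(2) by linarith+
    then show "lam \<le> F (appr w)" "F (appr w) \<le> lam + \<gamma> * N"
      unfolding lam_def using gN(1) by (simp_all add: pos_le_divide_eq pos_divide_le_eq distrib_right)
    show "\<bar>\<Psi> i (appr w) - s i * (\<eta> / 2 * N)\<bar> \<le> \<eta> / 2 * N" if "i < K"
    proof -
      have "s i \<le> \<Psi> i (appr w) / (\<eta> / 2 * N)" "\<Psi> i (appr w) / (\<eta> / 2 * N) \<le> s i + 1" using k(3)[OF that] by linarith+
      then have "s i * (\<eta> / 2 * N) \<le> \<Psi> i (appr w)" "\<Psi> i (appr w) \<le> (s i + 1) * (\<eta> / 2 * N)"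
        using gN(2) pos_le_divide_eq pos_divide_le_eq by blast+
      then show ?thesis using gN(2) by (simp add: abs_le_iff distrib_right)
    qed
  qed
  obtain w0 where w0: "w0 \<in> A'" using A'ne by blast
  have nN: "\<bar>real N - n\<bar> \<le> g N" using vlen[of w0] A'(1)[OF w0] w0 by (simp add: A'_def)
  have n2: "real N \<le> 2 * n" using nN g1(1) by linarith
  have W: "finite W" "W \<noteq> {}" "W \<subseteq> G" using finA' A'ne wl appr(1) by (auto simp: W_def A'_def)
  have cW: "0 < card W" using W by (simp add: card_gt_0_iff)
  have "real (card A') \<le> card W * (2 * exp (C * g N + \<gamma> / 2 * n))"
  proof -
    have "card A' = (\<Sum>y\<in>W. card {w \<in> A'. appr w = y})"
      using sum.group[OF finA' W(1), of appr "\<lambda>_. 1 :: nat"] by (simp add: W_def)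
    also have "real \<dots> \<le> (\<Sum>y\<in>W. 2 * exp (C * g N + \<gamma> / 2 * n))"
      unfolding of_nat_sum
    proof (rule sum_mono)
      fix y assume "y \<in> W"
      then have "length y = n" using A'(1) by (auto simp: W_def)
      moreover have "card {w \<in> A'. appr w = y} \<le> card {w \<in> ?A. appr w = y}"
        by (rule card_mono) (auto simp: A'_def)
      ultimately show "real (card {w \<in> A'. appr w = y}) \<le> 2 * exp (C * g N + \<gamma> / 2 * n)"
        using C(2)[OF N1, of y] by simp
    qed
    finally show ?thesis by simp
  qed
  also have "\<dots> \<le> card W * (2 * exp (C * g N + \<gamma> * N))"
    using nN g1(1) \<gamma> by (intro mult_left_mono) (auto simp: field_simps)
  finally have cA': "real (card A') \<le> card W * (2 * exp (C * g N + \<gamma> * N))" .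
  have "exp (N * (P - \<gamma>)) \<le> card ?T * (\<Sum>w\<in>A'. exp (F w))" using N(1) \<kappa>0 unfolding A'_def by linarith
  also have "(\<Sum>w\<in>A'. exp (F w)) \<le> card A' * exp (lam + \<gamma> * N + g N * E)"
  proof (rule sum_bounded_above)
    fix w assume w: "w \<in> A'"
    then have "\<bar>F w - F (appr w)\<bar> \<le> g N * E"
      using appr_almost_additive[OF F, of w] wl[of w] by (simp add: A'_def E_def)
    then show "exp (F w) \<le> exp (lam + \<gamma> * N + g N * E)" using A'(3)[OF w] by (simp add: abs_le_iff)
  qed
  also have "\<dots> \<le> card W * (2 * exp (C * g N + \<gamma> * N)) * exp (lam + \<gamma> * N + g N * E)"
    using cA' by (intro mult_right_mono) auto
  finally have main: "exp (N * (P - \<gamma>)) \<le> card ?T * (card W * (2 * exp (C * g N + \<gamma> * N)) * exp (lam + \<gamma> * N + g N * E))"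
    by (simp add: mult_left_mono)
  have cT: "real (card ?T) \<le> real (2 * N + 1) * (c0 + 1)"
  proof -
    have "card ?T = (2 * N + 1) * c0" by (simp add: card_cartesian_product c0_def)
    then have "real (card ?T) = real (2 * N + 1) * real c0" by (metis of_nat_mult)
    also have "\<dots> \<le> real (2 * N + 1) * real (c0 + 1)" by (rule mult_left_mono) auto
    finally show ?thesis .
  qed
  have "card ?T * (card W * (2 * exp (C * g N + \<gamma> * N)) * exp (lam + \<gamma> * N + g N * E))
     \<le> real (2 * N + 1) * (c0 + 1) * (card W * (2 * exp (C * g N + \<gamma> * N)) * exp (lam + \<gamma> * N + g N * E))"
    by (rule mult_right_mono[OF cT]) simp
  with main have "exp (N * (P - \<gamma>)) \<le> real (2 * N + 1) * (c0 + 1) * (card W * (2 * exp (C * g N + \<gamma> * N)) * exp (lam + \<gamma> * N + g N * E))"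
    by linarith
  also have "\<dots> = exp (ln (real (2 * N + 1) * (c0 + 1)) + (ln (card W) + (ln 2 + (C * g N + \<gamma> * N)) + (lam + \<gamma> * N + g N * E)))"
  proof -
    have "exp (ln (real (2 * N + 1) * (c0 + 1))) = real (2 * N + 1) * (c0 + 1)" by (rule exp_ln) simp
    moreover have "exp (ln (real (card W))) = card W" using cW by simp
    moreover have "exp (ln 2) = (2 :: real)" by simp
    ultimately show ?thesis by (simp only: exp_add mult.assoc)
  qed
  finally have "N * (P - \<gamma>) \<le> ln (real (2 * N + 1) * (c0 + 1)) + (ln (card W) + (ln 2 + (C * g N + \<gamma> * N)) + (lam + \<gamma> * N + g N * E))"
    by simp
  \<comment> \<open>The loss beyond the hypothesis on \<open>P\<close>: \<gamma>/2 for the number of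
    classes, \<gamma>/2 for terms with \<open>g\<close>, \<gamma> for the fibres and \<gamma> for
    rounding the weight.\<close>
  then have m1: "N * (P - 4 * \<gamma>) \<le> ln (card W) + lam"
    using N(2) g1(2) by (simp add: algebra_simps)
  have "(P - 6 * \<gamma>) * n \<le> N * (P - 4 * \<gamma>)"
  proof -
    have "(P - 6 * \<gamma>) * (real n - N) \<le> \<bar>P - 6 * \<gamma>\<bar> * \<bar>real n - N\<bar>" by (metis abs_ge_self abs_mult)
    also have "\<dots> \<le> (\<bar>P\<bar> + 6 * \<gamma>) * g N" using nN \<gamma> by (intro mult_mono) auto
    also have "\<dots> \<le> 2 * \<gamma> * N" using g1(3) by (simp add: mult.commute)
    finally show ?thesis by (simp add: algebra_simps)
  qed
  then have fin: "(P - 6 * \<gamma>) * n \<le> ln (card W) + lam" using m1 by linarith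
  have n0: "n0 \<le> n" using n2 N(4) by linarith
  have n_pos: "0 < real n" using n2 N1 by linarith
  define b where "b i = s i * (\<eta> / 2 * N) / n" for i
  have "\<forall>w\<in>W. length w = n \<and> lam \<le> F w \<and> (\<forall>i<K. \<bar>\<Psi> i w - b i * n\<bar> \<le> \<eta> * n)"
  proof (intro ballI conjI allI impI)
    fix w assume "w \<in> W"
    then obtain w' where w': "w' \<in> A'" "w = appr w'" by (auto simp: W_def)
    show "length w = n" "lam \<le> F w" using A'(1,2)[OF w'(1)] w'(2) by auto
    fix i assume "i < K"
    then have "\<bar>\<Psi> i w - s i * (\<eta> / 2 * N)\<bar> \<le> \<eta> / 2 * N" using A'(4)[OF w'(1)] w'(2) by simp
    also have "\<dots> \<le> \<eta> * n" using n2 \<eta> mult_left_mono[OF n2, of \<eta>] by simp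
    finally show "\<bar>\<Psi> i w - b i * n\<bar> \<le> \<eta> * n" using n_pos by (simp add: b_def)
  qed
  then show ?thesis using n0 W fin by blast
qed

end

section \<open>Mass distribution on glued sequences\<close>

lemma emeasure_UN_le_nn_integral:
  fixes U :: "'a :: countable set"
  assumes V: "\<And>u. u \<in> U \<Longrightarrow> V u \<in> sets M"
  shows "emeasure M (\<Union>u\<in>U. V u) \<le> (\<integral>\<^sup>+u. emeasure M (V u) \<partial>count_space U)"
proof -
  define W where "W n = (if n \<in> to_nat ` U then V (from_nat n) else {})" for n
  have W: "W n \<in> sets M" for n using V by (auto simp: W_def)
  have "(\<Union>u\<in>U. V u) = (\<Union>n. W n)" by (auto simp: W_def split: if_splits)
  then have "emeasure M (\<Union>u\<in>U. V u) \<le> (\<Sum>n. emeasure M (W n))"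
    using W by (auto intro!: emeasure_subadditive_countably)
  also have "\<dots> = (\<integral>\<^sup>+n. emeasure M (W n) \<partial>count_space UNIV)" by (rule nn_integral_count_space_nat[symmetric])
  also have "\<dots> = (\<integral>\<^sup>+n. emeasure M (V (from_nat n)) * indicator (to_nat ` U) n \<partial>count_space UNIV)"
    by (rule nn_integral_cong) (auto simp: W_def)
  also have "\<dots> = (\<integral>\<^sup>+n. emeasure M (V (from_nat n)) \<partial>count_space (to_nat ` U))"
    by (rule nn_integral_count_space_indicator[symmetric]) simp
  also have "\<dots> = (\<integral>\<^sup>+u. emeasure M (V (from_nat (to_nat u))) \<partial>count_space U)"
    by (rule nn_integral_bij_count_space[symmetric]) (simp add: bij_betw_def)
  finally show ?thesis by simp
qed

text \<open>Slot i offers the free choices at place i. All words of a slot have the same length, so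
  lengths without gaps do not depend on the choices.\<close>

locale slot_seq = spec_shift +
  fixes Sl :: "nat \<Rightarrow> nat list set" and nl :: "nat \<Rightarrow> nat"
  assumes Sl_finite: "\<And>i. finite (Sl i)" and Sl_nonempty: "\<And>i. Sl i \<noteq> {}" and Sl_G: "\<And>i. Sl i \<subseteq> G"
    and Sl_length: "\<And>i w. w \<in> Sl i \<Longrightarrow> length w = nl i"
begin

lemma nl_pos: "1 \<le> nl i"
proof -
  obtain w where w: "w \<in> Sl i" using Sl_nonempty by blast
  then show ?thesis using Sl_length[OF w] G_length[of w] Sl_G[of i] by auto
qed

text \<open>The length of the first r slots without gaps. Actual lengths depend on the choices
  through the gaps and exceed this by at most \<tau> for each gap.\<close>

definition nom :: "nat \<Rightarrow> nat" where "nom r = (\<Sum>i<r. nl i)"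

lemma nom_Suc: "nom (Suc r) = nom r + nl r"
  by (simp add: nom_def)

lemma nom_ge: "r \<le> nom r"
proof (induction r)
  case (Suc r)
  then show ?case using nl_pos[of r] by (simp add: nom_Suc)
qed simp

lemma nom_mono: "a \<le> b \<Longrightarrow> nom a \<le> nom b"
  unfolding nom_def by (rule sum_mono2) auto

fun glued :: "(nat \<Rightarrow> nat list) \<Rightarrow> nat \<Rightarrow> nat list" where
  "glued c 0 = c 0"
| "glued c (Suc i) = glue (glued c i) (c (Suc i))"

lemma glued_cong: "(\<And>j. j \<le> i \<Longrightarrow> c j = d j) \<Longrightarrow> glued c i = glued d i"
  by (induction i) auto

lemma glued_in: "(\<And>j. j \<le> i \<Longrightarrow> c j \<in> Sl j) \<Longrightarrow> glued c i \<in> G"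
proof (induction i)
  case (Suc i)
  then show ?case using Sl_G by (auto intro!: glue_in)
qed (use Sl_G in auto)

lemma glued_length:
  "(\<And>j. j \<le> i \<Longrightarrow> c j \<in> Sl j) \<Longrightarrow> nom (Suc i) \<le> length (glued c i) \<and> length (glued c i) \<le> nom (Suc i) + i * \<tau>"
proof (induction i)
  case 0
  then show ?case using Sl_length[of "c 0" 0] by (simp add: nom_def)
next
  case (Suc i)
  have "glued c i \<in> G" "c (Suc i) \<in> G" "length (c (Suc i)) = nl (Suc i)"
    using glued_in[of i c] Suc(2) Sl_G[of "Suc i"] Sl_length[of "c (Suc i)" "Suc i"] by auto
  then show ?case using Suc length_glue[of "glued c i" "c (Suc i)"] by (simp add: nom_Suc[of "Suc i"])
qed

lemma glued_aa:
  fixes \<kappa> B :: real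
  assumes F: "almost_additive \<kappa> B F"
  shows "(\<And>j. j \<le> i \<Longrightarrow> c j \<in> Sl j) \<Longrightarrow> \<bar>F (glued c i) - (\<Sum>j<Suc i. F (c j))\<bar> \<le> i * (2 * \<kappa> + B * \<tau>)"
proof (induction i)
  case (Suc i)
  have "glued c i \<in> G" "c (Suc i) \<in> G" using glued_in[of i c] Suc(2) Sl_G[of "Suc i"] by auto
  from glue_aa[OF F this] have "\<bar>F (glued c (Suc i)) - F (glued c i) - F (c (Suc i))\<bar> \<le> 2 * \<kappa> + B * \<tau>" by simp
  moreover have "\<bar>F (glued c i) - (\<Sum>j<Suc i. F (c j))\<bar> \<le> i * (2 * \<kappa> + B * \<tau>)" using Suc by simp
  ultimately show ?case by (simp add: abs_le_iff distrib_right)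
qed simp

text \<open>The j-th letter may be read from \<open>glued c j\<close>, which has at least j + 1
  letters; later gluing only extends it.\<close>

definition lim_seq :: "(nat \<Rightarrow> nat list) \<Rightarrow> seq" where "lim_seq c j = glued c j ! j"

lemma glued_prefix:
  assumes "\<And>j. c j \<in> Sl j" "i \<le> k"
  shows "take (length (glued c i)) (glued c k) = glued c i \<and> length (glued c i) \<le> length (glued c k)"
  using assms(2)
proof (induction rule: dec_induct)
  case (step k)
  have k: "glued c k \<in> G" "c (Suc k) \<in> G" using glued_in[of k c] assms(1) Sl_G by auto
  have "length (glued c k) \<le> length (glued c (Suc k))" using length_glue(1)[OF k] by simp
  moreover have "take (length (glued c k)) (glued c (Suc k)) = glued c k" using glue_prefix[OF k] by simp
  ultimately show ?case using step by (metis le_trans min.absorb1 take_take)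
qed simp

lemma lim_seq_prefix:
  assumes "\<And>j. c j \<in> Sl j"
  shows "pre (length (glued c i)) (lim_seq c) = glued c i"
proof (rule nth_equalityI)
  fix j assume "j < length (pre (length (glued c i)) (lim_seq c))"
  then have j: "j < length (glued c i)" by simp
  have len: "j < length (glued c j)" using glued_length[of j c] assms nom_ge[of "Suc j"] by fastforce
  have "glued c j ! j = glued c i ! j"
  proof (cases "i \<le> j")
    case True
    then show ?thesis using glued_prefix[OF assms True] j by (metis nth_take)
  next
    case False
    then have "j \<le> i" by simp
    then show ?thesis using glued_prefix[OF assms, of j i] len by (metis nth_take)
  qed
  then show "pre (length (glued c i)) (lim_seq c) ! j = glued c i ! j" using j by (simp add: lim_seq_def)
qed simp

lemma lim_seq_in:
  assumes "\<And>j. c j \<in> Sl j"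
  shows "lim_seq c \<in> X"
proof (rule limit_in)
  fix n
  have "n \<le> length (glued c n)" using glued_length[of n c] assms nom_ge[of "Suc n"] by fastforce
  moreover obtain y where "y \<in> X" "pre (length (glued c n)) y = glued c n"
    using G_pre[OF glued_in[of n c]] assms by blast
  ultimately show "\<exists>k\<ge>n. \<exists>y\<in>X. pre k (lim_seq c) = pre k y" using lim_seq_prefix[OF assms] by metis
qed

text \<open>The multivalued inverse of gluing. Its size compares the mass of a cylinder of
  \<open>X\<close> with masses of cylinders of choices.\<close>

definition parses :: "nat \<Rightarrow> nat list \<Rightarrow> nat list list set" where
  "parses k u = {ds. length ds = Suc k \<and> (\<forall>i\<le>k. ds ! i \<in> Sl i) \<and> take (length (glued ((!) ds) k)) u = glued ((!) ds) k}"

text \<open>Given the word, a parse is determined by the lengths of its gaps.\<close>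

lemma card_parses: "finite (parses k u) \<and> card (parses k u) \<le> (\<tau> + 1) ^ k"
proof (induction k)
  case 0
  have "parses 0 u \<subseteq> {[take (nl 0) u]}"
  proof
    fix ds assume "ds \<in> parses 0 u"
    then have d: "length ds = 1" "ds ! 0 \<in> Sl 0" "take (length (ds ! 0)) u = ds ! 0" by (auto simp: parses_def)
    have "ds ! 0 = take (nl 0) u" using d(3) Sl_length[OF d(2)] by simp
    moreover obtain a where "ds = [a]" using d(1) by (auto simp: length_Suc_conv)
    ultimately show "ds \<in> {[take (nl 0) u]}" by simp
  qed
  then show ?case using card_mono[of "{[take (nl 0) u]}"] finite_subset by fastforce
next
  case (Suc k)
  \<comment> \<open>The next chosen word starts after a gap of some length a \<le> \<tau> and has a
    known length, so \<open>u\<close> and a determine it.\<close>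
  define ext where "ext = (\<lambda>(ds, a). ds @ [take (nl (Suc k)) (drop (length (glued ((!) ds) k) + a) u)])"
  have "parses (Suc k) u \<subseteq> ext ` (parses k u \<times> {..\<tau>})"
  proof
    fix es assume "es \<in> parses (Suc k) u"
    then have es: "length es = Suc (Suc k)" "\<forall>i\<le>Suc k. es ! i \<in> Sl i"
      "take (length (glued ((!) es) (Suc k))) u = glued ((!) es) (Suc k)" by (auto simp: parses_def)
    define ds where "ds = take (Suc k) es"
    have ds: "length ds = Suc k" "es = ds @ [es ! Suc k]" "\<And>i. i \<le> k \<Longrightarrow> ds ! i = es ! i"
      using es(1) by (auto simp: ds_def take_Suc_conv_app_nth[symmetric])
    have gk: "glued ((!) ds) k = glued ((!) es) k" by (rule glued_cong) (use ds in auto)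
    have G: "glued ((!) es) k \<in> G" "es ! Suc k \<in> G" using glued_in[of k "(!) es"] es(2) Sl_G by auto
    obtain w where w: "glued ((!) es) (Suc k) = glued ((!) es) k @ w @ es ! Suc k" "length w \<le> \<tau>"
      using glueE[OF G] by (metis glued.simps(2))
    define r where "r = drop (length (glued ((!) es) (Suc k))) u"
    have u: "u = glued ((!) es) k @ w @ es ! Suc k @ r"
      using es(3) unfolding r_def w(1) by (metis append_take_drop_id append.assoc)
    have "length (es ! Suc k) = nl (Suc k)" using es(2) Sl_length by auto
    then have "es ! Suc k = take (nl (Suc k)) (drop (length (glued ((!) ds) k) + length w) u)"
      unfolding gk by (subst u) simp
    then have "es = ext (ds, length w)" using ds(2) by (simp add: ext_def)
    moreover have "ds \<in> parses k u"
      unfolding parses_def gk using ds es(2) by (auto simp: gk) (subst u, simp)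
    ultimately show "es \<in> ext ` (parses k u \<times> {..\<tau>})" using w(2) by blast
  qed
  moreover have "finite (ext ` (parses k u \<times> {..\<tau>}))" using Suc by auto
  moreover have "card (ext ` (parses k u \<times> {..\<tau>})) \<le> card (parses k u \<times> {..\<tau>})"
    by (rule card_image_le) (use Suc in auto)
  moreover have "card (parses k u \<times> {..\<tau>}) \<le> (\<tau> + 1) ^ Suc k"
  proof -
    have "card (parses k u \<times> {..\<tau>}) = card (parses k u) * (\<tau> + 1)" by (simp add: card_cartesian_product)
    also have "\<dots> \<le> (\<tau> + 1) ^ k * (\<tau> + 1)" by (rule mult_right_mono) (use Suc in auto)
    finally show ?thesis by (simp add: mult.commute)
  qed
  ultimately show ?case by (meson card_mono finite_subset le_trans)
qed

text \<open>The weights are masses for the uniform product measure on all choices, whose total mass is 1.\<close>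

lemma product_cover:
  fixes U :: "nat list set"
  assumes cover: "\<And>c. (\<And>j. c j \<in> Sl j) \<Longrightarrow> \<exists>u\<in>U. \<exists>ds\<in>D u. \<forall>i<length ds. c i = ds ! i"
    and D: "\<And>u ds. u \<in> U \<Longrightarrow> ds \<in> D u \<Longrightarrow> length ds = r u \<and> (\<forall>i<r u. ds ! i \<in> Sl i)" "\<And>u. u \<in> U \<Longrightarrow> finite (D u)"
  shows "1 \<le> (\<integral>\<^sup>+u. ennreal (card (D u) * (\<Prod>i<r u. 1 / card (Sl i))) \<partial>count_space U)"
proof -
  define M where "M = (\<lambda>i. uniform_count_measure (Sl i))"
  have M: "prob_space (M i)" "space (M i) = Sl i" "sets (M i) = Pow (Sl i)" for i
    unfolding M_def using Sl_finite Sl_nonempty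
    by (auto intro!: prob_space_uniform_count_measure simp: space_uniform_count_measure sets_uniform_count_measure)
  interpret product_prob_space M UNIV
    by (rule product_prob_spaceI) (rule M(1))
  let ?P = "PiM UNIV M"
  define cylc where "cylc ds = {c \<in> space ?P. \<forall>i<length ds. c i = ds ! i}" for ds :: "nat list list"
  have space: "c \<in> space ?P \<longleftrightarrow> (\<forall>j. c j \<in> Sl j)" for c by (auto simp: space_PiM PiE_iff M(2))
  have cyl_eq: "cylc ds = prod_emb UNIV M {..<length ds} (\<Pi>\<^sub>E i\<in>{..<length ds}. {ds ! i})" for ds
    unfolding cylc_def prod_emb_def space_PiM by (auto simp: PiE_iff M(2) extensional_def)
  have em: "cylc ds \<in> sets ?P \<and> emeasure ?P (cylc ds) = ennreal (\<Prod>i<length ds. 1 / card (Sl i))"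
    if ds: "\<forall>i<length ds. ds ! i \<in> Sl i" for ds
  proof -
    have X: "{ds ! i} \<in> sets (M i)" if "i \<in> {..<length ds}" for i using ds that by (auto simp: M(3))
    have s: "cylc ds \<in> sets ?P" unfolding cyl_eq by (rule sets_PiM_I) (use X in auto)
    have "emeasure ?P (cylc ds) = (\<Prod>i\<in>{..<length ds}. emeasure (M i) {ds ! i})"
      unfolding cyl_eq by (rule emeasure_PiM_emb) (use X in auto)
    also have "\<dots> = (\<Prod>i\<in>{..<length ds}. ennreal (1 / card (Sl i)))"
    proof (rule prod.cong)
      fix i assume "i \<in> {..<length ds}"
      then have "{ds ! i} \<subseteq> Sl i" using ds by auto
      then show "emeasure (M i) {ds ! i} = ennreal (1 / card (Sl i))"
        unfolding M_def using Sl_finite by (simp add: emeasure_uniform_count_measure ennreal_of_nat_eq_real_of_nat divide_ennreal)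
    qed simp
    also have "\<dots> = ennreal (\<Prod>i<length ds. 1 / card (Sl i))" by (rule prod_ennreal) simp
    finally show ?thesis using s by simp
  qed
  define V where "V u = (\<Union>ds\<in>D u. cylc ds)" for u
  have V: "V u \<in> sets ?P" "emeasure ?P (V u) \<le> ennreal (card (D u) * (\<Prod>i<r u. 1 / card (Sl i)))" if u: "u \<in> U" for u
  proof -
    have ds: "cylc ds \<in> sets ?P" "emeasure ?P (cylc ds) = ennreal (\<Prod>i<r u. 1 / card (Sl i))" if "ds \<in> D u" for ds
      using em[of ds] D(1)[OF u that] by auto
    show "V u \<in> sets ?P" unfolding V_def using D(2)[OF u] ds(1) by auto
    have "emeasure ?P (V u) \<le> (\<Sum>ds\<in>D u. emeasure ?P (cylc ds))"
      unfolding V_def by (rule emeasure_subadditive_finite) (use D(2)[OF u] ds(1) in auto)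
    also have "\<dots> = of_nat (card (D u)) * ennreal (\<Prod>i<r u. 1 / card (Sl i))" using ds(2) by simp
    also have "\<dots> = ennreal (card (D u) * (\<Prod>i<r u. 1 / card (Sl i)))"
      by (simp add: ennreal_mult' ennreal_of_nat_eq_real_of_nat)
    finally show "emeasure ?P (V u) \<le> ennreal (card (D u) * (\<Prod>i<r u. 1 / card (Sl i)))" .
  qed
  have "space ?P \<subseteq> (\<Union>u\<in>U. V u)"
  proof
    fix c assume c: "c \<in> space ?P"
    then obtain u ds where "u \<in> U" "ds \<in> D u" "\<forall>i<length ds. c i = ds ! i" using cover[of c] space by metis
    then show "c \<in> (\<Union>u\<in>U. V u)" using c by (auto simp: V_def cylc_def)
  qed
  moreover have meas: "(\<Union>u\<in>U. V u) \<in> sets ?P" using V(1) by (intro sets.countable_UN'') auto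
  ultimately have "emeasure ?P (space ?P) \<le> emeasure ?P (\<Union>u\<in>U. V u)" by (intro emeasure_mono)
  also have "\<dots> \<le> (\<integral>\<^sup>+u. emeasure ?P (V u) \<partial>count_space U)"
    by (rule emeasure_UN_le_nn_integral) (rule V(1))
  also have "\<dots> \<le> (\<integral>\<^sup>+u. ennreal (card (D u) * (\<Prod>i<r u. 1 / card (Sl i))) \<partial>count_space U)"
    by (rule nn_integral_mono) (use V(2) in auto)
  finally show ?thesis using emeasure_space_1 by simp
qed

text \<open>The mass distribution principle. The mass of a cylinder is at most the number of its
  parses times the product of the 1 / |Sl i|, and \<open>energy\<close> compares this product with
  exp(-s' length + weight) at every slot boundary. Summing over a cover and using total mass 1
  bounds the sum from below by 1 / Cst.\<close>

lemma mass_positive: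
  fixes s s' \<gamma> :: real and lam :: "nat \<Rightarrow> real"
  assumes \<gamma>: "0 < \<gamma>" and \<psi>: "\<And>w. \<bar>\<psi> w\<bar> \<le> fB" "\<And>x. x \<in> X \<Longrightarrow> \<bar>f x - \<psi> (pre l x)\<bar> \<le> \<gamma>"
    and lam: "\<And>i w. w \<in> Sl i \<Longrightarrow> lam i \<le> wsum l \<psi> w"
    and energy: "\<And>r. 0 \<le> (\<Sum>i<r. ln (card (Sl i)) + lam i - s' * nl i)"
    and s': "s + 4 * \<gamma> \<le> s'"
    and nmin: "\<And>i. ln (real \<tau> + 1) + 2 * (fB * l) + fB * \<tau> + (\<bar>s\<bar> + \<gamma> + fB) * \<tau> \<le> \<gamma> * nl i"
    and slow: "\<And>e :: real. 0 < e \<Longrightarrow> \<exists>r0. \<forall>r\<ge>r0. nl r \<le> e * nom r"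
  shows "\<exists>N. 0 < PP_M X f (lim_seq ` {c. \<forall>j. c j \<in> Sl j}) s N"
proof -
  let ?F = "wsum l \<psi>"
  define S where "S = \<bar>s\<bar> + \<gamma> + fB"
  have S: "0 < S" using \<gamma> fB(1) by (simp add: S_def)
  have fB0: "0 \<le> fB" using fB(1) by simp
  have aa: "almost_additive (fB * l) fB ?F" by (rule almost_additive_wsum) (rule \<psi>(1))
  obtain r0 where r0: "\<And>r. r \<ge> r0 \<Longrightarrow> nl r \<le> \<gamma> / S * nom r" using slow[of "\<gamma> / S"] \<gamma> S by auto
  \<comment> \<open>An upper bound, for all choices, on the length of r slots with gaps. Hence any
    word of length n contains the slots up to \<open>kk n\<close> completely, and little more than
    one further slot.\<close>
  define h where "h r = nom r + r * \<tau>" for r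
  have h_mono: "h a \<le> h b" if "a \<le> b" for a b using that nom_mono by (simp add: h_def add_mono)
  have h_ge: "r \<le> h r" for r using nom_ge[of r] by (simp add: h_def)
  define N where "N = h (Suc r0)"
  define kk where "kk n = (LEAST k. n < h (Suc (Suc k)))" for n
  have kk: "r0 \<le> kk n" "h (Suc (kk n)) \<le> n" "n < h (Suc (Suc (kk n)))" if n: "N \<le> n" for n
  proof -
    have ex: "n < h (Suc (Suc n))" using h_ge[of "Suc (Suc n)"] by simp
    show lt: "n < h (Suc (Suc (kk n)))" unfolding kk_def by (rule LeastI[of _ n]) (rule ex)
    show "r0 \<le> kk n"
    proof (rule ccontr)
      assume "\<not> r0 \<le> kk n"
      then have "h (Suc (Suc (kk n))) \<le> h (Suc r0)" by (intro h_mono) simp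
      then show False using lt n by (simp add: N_def)
    qed
    show "h (Suc (kk n)) \<le> n"
    proof (cases "kk n")
      case 0
      then show ?thesis using h_mono[of "Suc 0" "Suc r0"] n by (simp add: N_def)
    next
      case (Suc k)
      then have "\<not> n < h (Suc (Suc k))" using not_less_Least[of k "\<lambda>k. n < h (Suc (Suc k))"] unfolding kk_def by simp
      then show ?thesis using Suc by simp
    qed
  qed
  define Cst where "Cst = exp (S * \<tau> + 2 * (fB * l))"
  let ?Z = "lim_seq ` {c. \<forall>j. c j \<in> Sl j}"
  have bound: "card (parses (kk (length u)) u) * (\<Prod>i<Suc (kk (length u)). 1 / card (Sl i)) \<le> Cst * exp (- s * length u + sbirk u)"
    if u: "u \<in> lang X" "N \<le> length u" for u
  proof (cases "parses (kk (length u)) u = {}")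
    case True
    then show ?thesis by (simp add: Cst_def)
  next
    case False
    define n where "n = length u"
    define k where "k = kk n"
    note K = kk[OF u(2), folded n_def, folded k_def]
    obtain ds where ds: "ds \<in> parses k u" using False unfolding k_def n_def by blast
    define gw where "gw = glued ((!) ds) k"
    have dsl: "\<And>i. i \<le> k \<Longrightarrow> ds ! i \<in> Sl i" and gw: "take (length gw) u = gw" using ds by (auto simp: parses_def gw_def)
    obtain x where x: "x \<in> X" "pre n x = u" using u(1) by (auto simp: lang_iff n_def)
    have 1: "?F u - n * \<gamma> - fB * l \<le> sbirk u"
    proof -
      have "\<bar>birk f n x - ?F (pre n x)\<bar> \<le> n * \<gamma> + fB * l"
        by (rule birk_wsum) (use \<psi>(2) fB(2) fB0 shift_in[OF x(1)] \<gamma> in auto)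
      moreover have "birk f n x \<le> sbirk u" using sbirk_ge[OF x(1), of n] x(2) by simp
      ultimately show ?thesis using x(2) by (simp add: abs_le_iff)
    qed
    define rest where "rest = drop (length gw) u"
    have u_eq: "u = gw @ rest" using gw unfolding rest_def by (metis append_take_drop_id)
    have glen: "nom (Suc k) \<le> length gw" using glued_length[of k "(!) ds"] dsl by (simp add: gw_def)
    define \<Lambda> where "\<Lambda> = real (nom (Suc k))"
    have nL: "\<Lambda> \<le> n" using glen u_eq unfolding n_def \<Lambda>_def by (metis le_add1 le_trans length_append of_nat_mono)
    have 2: "?F gw - fB * l - fB * (n - \<Lambda>) \<le> ?F u"
    proof -
      have "length rest \<le> n - \<Lambda>" using u_eq glen unfolding n_def \<Lambda>_def by (metis add_diff_cancel_left' diff_le_mono2 length_append of_nat_diff of_nat_mono le_add1 le_trans)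
      then have "fB * length rest \<le> fB * (n - \<Lambda>)" using fB0 by (rule mult_left_mono)
      then show ?thesis using almost_additiveD(1)[OF aa, of gw rest] almost_additiveD(2)[OF aa, of rest]
        unfolding u_eq[symmetric] by (simp add: abs_le_iff)
    qed
    have 3: "(\<Sum>j<Suc k. lam j) - Suc k * (2 * (fB * l) + fB * \<tau>) \<le> ?F gw"
    proof -
      have "\<bar>?F gw - (\<Sum>j<Suc k. ?F (ds ! j))\<bar> \<le> k * (2 * (fB * l) + fB * \<tau>)"
        unfolding gw_def by (rule glued_aa[OF aa]) (rule dsl)
      moreover have "(\<Sum>j<Suc k. lam j) \<le> (\<Sum>j<Suc k. ?F (ds ! j))" by (intro sum_mono lam dsl) simp
      moreover have "k * (2 * (fB * l) + fB * \<tau>) \<le> Suc k * (2 * (fB * l) + fB * \<tau>)" using fB0 by (intro mult_right_mono) auto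
      ultimately show ?thesis by linarith
    qed
    define Lc where "Lc = (\<Sum>j<Suc k. ln (card (Sl j)))"
    have 4: "s' * \<Lambda> \<le> Lc + (\<Sum>j<Suc k. lam j)"
    proof -
      have "(\<Sum>i<Suc k. ln (card (Sl i)) + lam i - s' * nl i) = Lc + (\<Sum>j<Suc k. lam j) - s' * \<Lambda>"
        unfolding \<Lambda>_def nom_def Lc_def of_nat_sum by (simp only: sum_subtractf sum.distrib sum_distrib_left)
      then show ?thesis using energy[of "Suc k"] by linarith
    qed
    \<comment> \<open>The letters that the nominal length does not count: gaps and everything after
      the last complete slot.\<close>
    define e where "e = n - \<Lambda>"
    have e: "0 \<le> e" "e \<le> nl (Suc k) + Suc k * \<tau> + \<tau>"
    proof -
      show "0 \<le> e" using nL by (simp add: e_def)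
      have "n < nom (Suc k) + nl (Suc k) + (Suc k * \<tau> + \<tau>)" using K(3) by (simp add: h_def nom_Suc[of "Suc k"])
      then have "real n \<le> real (nom (Suc k) + nl (Suc k) + (Suc k * \<tau> + \<tau>))" by (intro of_nat_mono less_imp_le)
      then show "e \<le> nl (Suc k) + Suc k * \<tau> + \<tau>" unfolding e_def \<Lambda>_def by (simp add: algebra_simps)
    qed
    have 5: "S * nl (Suc k) \<le> \<gamma> * \<Lambda>"
    proof -
      have "nl (Suc k) \<le> \<gamma> / S * nom (Suc k)" by (rule r0) (use K(1) in simp)
      then show ?thesis using S unfolding \<Lambda>_def by (simp add: field_simps)
    qed
    have 6: "Suc k * (ln (real \<tau> + 1) + 2 * (fB * l) + fB * \<tau> + S * \<tau>) \<le> \<gamma> * \<Lambda>"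
    proof -
      have "(\<Sum>i<Suc k. ln (real \<tau> + 1) + 2 * (fB * l) + fB * \<tau> + S * \<tau>) \<le> (\<Sum>i<Suc k. \<gamma> * nl i)"
        by (rule sum_mono) (use nmin in \<open>simp add: S_def\<close>)
      then show ?thesis unfolding \<Lambda>_def nom_def of_nat_sum sum_distrib_left by simp
    qed
    have 7: "(s + \<gamma> + fB) * e \<le> S * (nl (Suc k) + Suc k * \<tau> + \<tau>)"
    proof -
      have "(s + \<gamma> + fB) * e \<le> S * e" using e(1) by (intro mult_right_mono) (auto simp: S_def)
      also have "\<dots> \<le> S * (nl (Suc k) + Suc k * \<tau> + \<tau>)" using e(2) S by (intro mult_left_mono) auto
      finally show ?thesis .
    qed
    have 8: "(s + 4 * \<gamma>) * \<Lambda> \<le> s' * \<Lambda>" using s' by (intro mult_right_mono) (auto simp: \<Lambda>_def)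
    have g\<Lambda>: "0 \<le> \<gamma> * \<Lambda>" using \<gamma> by (simp add: \<Lambda>_def)
    have n_eq: "real n = \<Lambda> + e" by (simp add: e_def)
    \<comment> \<open>Of the margin 4 \<gamma> \<Lambda>, one share pays for replacing
      \<open>f\<close> by window sums, one for the unfinished slot (\<open>5\<close>) and one for
      gaps and parses (\<open>6\<close>); the last is slack.\<close>
    have main: "Suc k * ln (real \<tau> + 1) - Lc \<le> S * \<tau> + 2 * (fB * l) + (- s * n + sbirk u)"
    proof -
      have "sbirk u \<ge> (\<Sum>j<Suc k. lam j) - Suc k * (2 * (fB * l) + fB * \<tau>) - fB * l - fB * e - n * \<gamma> - fB * l"
        using 1 2 3 unfolding e_def by linarith
      moreover have "s * n + n * \<gamma> + fB * e = (s + 4 * \<gamma>) * \<Lambda> - 3 * (\<gamma> * \<Lambda>) + (s + \<gamma> + fB) * e"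
        unfolding n_eq by (simp add: algebra_simps)
      moreover have "S * (nl (Suc k) + Suc k * \<tau> + \<tau>) = S * nl (Suc k) + Suc k * (S * \<tau>) + S * \<tau>"
        by (simp add: algebra_simps)
      moreover have "Suc k * (ln (real \<tau> + 1) + 2 * (fB * l) + fB * \<tau> + S * \<tau>) =
        Suc k * ln (real \<tau> + 1) + Suc k * (2 * (fB * l) + fB * \<tau>) + Suc k * (S * \<tau>)" by (simp add: algebra_simps)
      moreover have "- s * n = - (s * n)" by simp
      ultimately show ?thesis using 4 5 6 7 8 g\<Lambda> by linarith
    qed
    have cS: "0 < card (Sl i)" for i using Sl_finite Sl_nonempty by (simp add: card_gt_0_iff)
    have "real (card (parses k u)) \<le> exp (Suc k * ln (real \<tau> + 1))"
    proof -
      have "card (parses k u) \<le> (\<tau> + 1) ^ k" using card_parses by blast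
      also have "\<dots> \<le> (\<tau> + 1) ^ Suc k" by (rule power_increasing) auto
      finally have "real (card (parses k u)) \<le> real ((\<tau> + 1) ^ Suc k)" by (rule of_nat_mono)
      also have "\<dots> = (real \<tau> + 1) ^ Suc k" by (simp only: of_nat_power of_nat_add of_nat_1)
      also have "\<dots> = exp (ln (real \<tau> + 1)) ^ Suc k" by (simp only: exp_ln)
      also have "\<dots> = exp (Suc k * ln (real \<tau> + 1))" by (rule exp_of_nat_mult[symmetric])
      finally show ?thesis .
    qed
    moreover have "(\<Prod>i<Suc k. 1 / card (Sl i)) = exp (- Lc)"
    proof -
      have "exp (- Lc) = (\<Prod>i<Suc k. exp (- ln (card (Sl i))))"
        unfolding Lc_def sum_negf[symmetric] by (rule exp_sum) simp
      also have "\<dots> = (\<Prod>i<Suc k. 1 / card (Sl i))" using cS by (intro prod.cong) (auto simp: exp_minus divide_inverse)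
      finally show ?thesis by simp
    qed
    ultimately have "card (parses k u) * (\<Prod>i<Suc k. 1 / card (Sl i)) \<le> exp (Suc k * ln (real \<tau> + 1)) * exp (- Lc)"
      by (simp add: mult_right_mono)
    also have "\<dots> = exp (Suc k * ln (real \<tau> + 1) - Lc)" by (simp only: exp_add[symmetric] diff_conv_add_uminus)
    also have "\<dots> \<le> exp (S * \<tau> + 2 * (fB * l) + (- s * n + sbirk u))" using main by (simp only: exp_le_cancel_iff)
    also have "\<dots> = Cst * exp (- s * n + sbirk u)" by (simp only: Cst_def exp_add)
    finally show ?thesis by (simp only: n_def k_def)
  qed
  have Cst: "0 < Cst" by (simp add: Cst_def)
  have "ennreal (1 / Cst) \<le> PP_M X f ?Z s N"
    unfolding PP_M_alt
  proof (rule INF_greatest)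
    fix U assume "U \<in> {U. U \<subseteq> lang X \<and> (\<forall>u\<in>U. N \<le> length u) \<and> ?Z \<subseteq> (\<Union>u\<in>U. cyl X u)}"
    then have U: "U \<subseteq> lang X" "\<And>u. u \<in> U \<Longrightarrow> N \<le> length u" "?Z \<subseteq> (\<Union>u\<in>U. cyl X u)" by auto
    have "1 \<le> (\<integral>\<^sup>+u. ennreal (card (parses (kk (length u)) u) * (\<Prod>i<Suc (kk (length u)). 1 / card (Sl i))) \<partial>count_space U)"
    proof (rule product_cover)
      fix c :: "nat \<Rightarrow> nat list" assume c: "\<And>j. c j \<in> Sl j"
      then obtain u where u: "u \<in> U" "pre (length u) (lim_seq c) = u" using U(3) by (auto simp: cyl_eq)
      define k where "k = kk (length u)"
      define ds where "ds = map c [0..<Suc k]"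
      have dn: "ds ! i = c i" if "i \<le> k" for i unfolding ds_def using that by (subst nth_map) (auto simp del: upt_Suc)
      have gk: "glued ((!) ds) k = glued c k" by (rule glued_cong) (rule dn)
      have "length (glued c k) \<le> nom (Suc k) + k * \<tau>" using glued_length[of k c] c by blast
      also have "\<dots> \<le> h (Suc k)" by (simp add: h_def)
      also have "\<dots> \<le> length u" unfolding k_def by (rule kk(2)[OF U(2)[OF u(1)]])
      finally have len: "length (glued c k) \<le> length u" .
      have "take (length (glued c k)) u = take (length (glued c k)) (pre (length u) (lim_seq c))" using u(2) by simp
      also have "\<dots> = glued c k" using len lim_seq_prefix[OF c, of k] by (simp add: min_def)
      finally have "take (length (glued ((!) ds) k)) u = glued ((!) ds) k" unfolding gk .
      moreover have "length ds = Suc k" by (simp add: ds_def)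
      moreover have "\<forall>i\<le>k. ds ! i \<in> Sl i" using dn c by simp
      ultimately have "ds \<in> parses k u" unfolding parses_def by simp
      moreover have "\<forall>i<length ds. c i = ds ! i" using dn by (simp add: ds_def del: upt_Suc)
      ultimately show "\<exists>u\<in>U. \<exists>ds\<in>parses (kk (length u)) u. \<forall>i<length ds. c i = ds ! i"
        using u(1) unfolding k_def by blast
    qed (use card_parses in \<open>auto simp: parses_def\<close>)
    also have "\<dots> \<le> (\<integral>\<^sup>+u. ennreal Cst * ennreal (exp (- s * length u + sbirk u)) \<partial>count_space U)"
    proof (rule nn_integral_mono)
      fix u assume "u \<in> space (count_space U)"
      then have u: "u \<in> lang X" "N \<le> length u" using U by auto
      have "ennreal (card (parses (kk (length u)) u) * (\<Prod>i<Suc (kk (length u)). 1 / card (Sl i))) \<le> ennreal (Cst * exp (- s * length u + sbirk u))"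
        by (rule ennreal_leI[OF bound[OF u]])
      also have "\<dots> = ennreal Cst * ennreal (exp (- s * length u + sbirk u))" using Cst by (simp add: ennreal_mult')
      finally show "ennreal (card (parses (kk (length u)) u) * (\<Prod>i<Suc (kk (length u)). 1 / card (Sl i))) \<le> ennreal Cst * ennreal (exp (- s * length u + sbirk u))" .
    qed
    also have "\<dots> = ennreal Cst * (\<integral>\<^sup>+u. ennreal (exp (- s * length u + sbirk u)) \<partial>count_space U)"
      by (rule nn_integral_cmult) simp
    finally have "ennreal (1 / Cst) * 1 \<le> ennreal (1 / Cst) * (ennreal Cst * (\<integral>\<^sup>+u. ennreal (exp (- s * length u + sbirk u)) \<partial>count_space U))"
      by (rule mult_left_mono) simp
    also have "\<dots> = (\<integral>\<^sup>+u. ennreal (exp (- s * length u + sbirk u)) \<partial>count_space U)"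
      using Cst by (simp add: mult.assoc[symmetric] ennreal_mult[symmetric])
    finally show "ennreal (1 / Cst) \<le> (\<integral>\<^sup>+u. ennreal (exp (- s * real (length u) + sbirk u)) \<partial>count_space U)" by simp
  qed
  moreover have "0 < ennreal (1 / Cst)" using Cst by simp
  ultimately show ?thesis by (meson less_le_trans)
qed

text \<open>Let M be the nominal length of the stage from a to b. What precedes it is at most M/q
  long. There are at most M/\<nu> slots in the stage, which bounds its gaps. As |v| \<le> 2,
  replacing n by M costs twice the neglected length, whence the constants 3.\<close>

lemma stage_statistics:
  fixes \<kappa> v \<epsilon> \<nu> q :: real
  assumes c: "\<And>j. c j \<in> Sl j" and \<Psi>: "almost_additive \<kappa> 1 \<Psi>" and ab: "a < b"
    and v: "\<bar>v\<bar> \<le> 2" and stat: "\<bar>(\<Sum>j=a..<b. \<Psi> (c j)) - v * (real (nom b) - nom a)\<bar> \<le> \<epsilon> * (real (nom b) - nom a)"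
    and \<nu>: "0 < \<nu>" "\<And>j. a \<le> j \<Longrightarrow> j < b \<Longrightarrow> \<nu> \<le> nl j" and q: "0 < q" "q * nom a \<le> real (nom b) - nom a"
    and \<epsilon>: "0 \<le> \<epsilon>"
    and n: "n = length (glued c (b - 1))"
  shows "b \<le> n" "\<bar>\<Psi> (pre n (lim_seq c)) - v * n\<bar> \<le> (\<epsilon> + (2 * \<kappa> + 3 * \<tau>) / \<nu> + (2 * \<kappa> + 3 * \<tau> + 3) / q) * n"
proof -
  note D = almost_additiveD[OF \<Psi>]
  define T where "T = real (nom a)"
  define M where "M = real (nom b) - nom a"
  define gw where "gw = glued c (b - 1)"
  have n: "n = length gw" using n by (simp add: gw_def)
  have b: "Suc (b - 1) = b" using ab by simp
  have gl: "nom b \<le> n" "n \<le> nom b + (b - 1) * \<tau>" using glued_length[of "b - 1" c] c b by (auto simp: n gw_def)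
  have Mn: "M \<le> n" using gl(1) by (simp add: M_def)
  have T: "T \<le> M / q" using q by (simp add: T_def M_def field_simps)
  have slots: "real b \<le> T + M / \<nu>"
  proof -
    have "(real b - a) * \<nu> = (\<Sum>j=a..<b. \<nu>)" using ab by (simp add: of_nat_diff)
    also have "\<dots> \<le> (\<Sum>j=a..<b. real (nl j))" by (rule sum_mono) (use \<nu>(2) in auto)
    also have "\<dots> = M"
    proof -
      have "nom b = nom a + (\<Sum>j=a..<b. nl j)"
        unfolding nom_def using ab by (metis lessThan_atLeast0 less_imp_le sum.atLeastLessThan_concat zero_le)
      then show ?thesis by (simp add: M_def)
    qed
    finally have "real b - a \<le> M / \<nu>" using \<nu>(1) by (simp add: pos_le_divide_eq)
    then show ?thesis using nom_ge[of a] unfolding T_def by linarith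
  qed
  have 1: "\<bar>\<Psi> gw - (\<Sum>j<b. \<Psi> (c j))\<bar> \<le> b * (2 * \<kappa> + \<tau>)"
  proof -
    have "\<bar>\<Psi> gw - (\<Sum>j<b. \<Psi> (c j))\<bar> \<le> real (b - 1) * (2 * \<kappa> + 1 * real \<tau>)"
      using glued_aa[OF \<Psi>, of "b - 1" c] c b by (simp add: gw_def)
    also have "\<dots> \<le> b * (2 * \<kappa> + 1 * real \<tau>)" using D(3) by (intro mult_right_mono) auto
    finally show ?thesis by simp
  qed
  have 2: "\<bar>\<Sum>j<a. \<Psi> (c j)\<bar> \<le> T"
  proof -
    have "\<bar>\<Sum>j<a. \<Psi> (c j)\<bar> \<le> (\<Sum>j<a. real (nl j))"
      by (rule order_trans[OF sum_abs sum_mono]) (use D(2) Sl_length[OF c] in \<open>metis mult_1\<close>)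
    then show ?thesis by (simp add: T_def nom_def)
  qed
  have 3: "(\<Sum>j<b. \<Psi> (c j)) = (\<Sum>j<a. \<Psi> (c j)) + (\<Sum>j=a..<b. \<Psi> (c j))"
    using ab by (metis lessThan_atLeast0 less_imp_le sum.atLeastLessThan_concat zero_le)
  have 4: "\<bar>v * n - v * M\<bar> \<le> 2 * (T + b * \<tau>)"
  proof -
    have "\<bar>v * n - v * M\<bar> = \<bar>v\<bar> * (n - M)" using Mn by (simp add: abs_mult flip: right_diff_distrib)
    also have "\<dots> \<le> 2 * (n - M)" using v Mn by (intro mult_right_mono) auto
    also have "\<dots> \<le> 2 * (T + b * \<tau>)"
    proof -
      have "real n \<le> real (nom b + (b - 1) * \<tau>)" using gl(2) by (rule of_nat_mono)
      also have "\<dots> \<le> nom b + real b * \<tau>" by (simp add: mult_right_mono)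
      finally show ?thesis unfolding M_def T_def by simp
    qed
    finally show ?thesis .
  qed
  have "\<bar>\<Psi> gw - v * n\<bar> \<le> \<epsilon> * M + 3 * T + b * (2 * \<kappa> + 3 * \<tau>)"
    using 1 2 3 4 stat unfolding M_def[symmetric] by (simp add: abs_le_iff algebra_simps)
  also have "\<dots> \<le> \<epsilon> * M + 3 * T + (T + M / \<nu>) * (2 * \<kappa> + 3 * \<tau>)"
    using slots D(3) by (intro add_left_mono mult_right_mono) auto
  also have "\<dots> = \<epsilon> * M + T * (2 * \<kappa> + 3 * \<tau> + 3) + M * ((2 * \<kappa> + 3 * \<tau>) / \<nu>)" by (simp add: algebra_simps add_divide_distrib)
  also have "\<dots> \<le> \<epsilon> * M + M / q * (2 * \<kappa> + 3 * \<tau> + 3) + M * ((2 * \<kappa> + 3 * \<tau>) / \<nu>)"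
    using T D(3) by (intro add_mono mult_right_mono order_refl) auto
  also have "\<dots> = (\<epsilon> + (2 * \<kappa> + 3 * \<tau>) / \<nu> + (2 * \<kappa> + 3 * \<tau> + 3) / q) * M" by (simp add: algebra_simps add_divide_distrib)
  also have "\<dots> \<le> (\<epsilon> + (2 * \<kappa> + 3 * \<tau>) / \<nu> + (2 * \<kappa> + 3 * \<tau> + 3) / q) * n"
    using Mn \<epsilon> D(3) \<nu>(1) q(1) by (intro mult_left_mono add_nonneg_nonneg divide_nonneg_nonneg) auto
  finally have "\<bar>\<Psi> gw - v * n\<bar> \<le> (\<epsilon> + (2 * \<kappa> + 3 * \<tau>) / \<nu> + (2 * \<kappa> + 3 * \<tau> + 3) / q) * n" .
  moreover have "pre n (lim_seq c) = gw" using lim_seq_prefix[OF c, of "b - 1"] by (simp add: n gw_def)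
  ultimately show "\<bar>\<Psi> (pre n (lim_seq c)) - v * n\<bar> \<le> (\<epsilon> + (2 * \<kappa> + 3 * \<tau>) / \<nu> + (2 * \<kappa> + 3 * \<tau> + 3) / q) * n" by simp
  show "b \<le> n" using gl(1) nom_ge[of b] by simp
qed

end

section \<open>Lower bounds for the pointwise emergence\<close>

context subshift
begin

lemma sdist_summable:
  assumes "x \<in> X" "y \<in> X"
  shows "summable (\<lambda>j. \<bar>real (x j) - real (y j)\<bar> / 2 ^ Suc j)" "\<bar>real (x j) - real (y j)\<bar> \<le> m"
proof -
  show b: "\<bar>real (x j) - real (y j)\<bar> \<le> m" for j
    using X_letters[OF assms(1), of j] X_letters[OF assms(2), of j] by (auto simp: abs_le_iff)
  have s: "summable (\<lambda>j. real m * (1 / 2) ^ Suc j)"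
    by (intro summable_mult sums_summable[OF power_half_series])
  show "summable (\<lambda>j. \<bar>real (x j) - real (y j)\<bar> / 2 ^ Suc j)"
    by (rule summable_comparison_test'[OF s, of 0]) (use b in \<open>auto simp: power_one_over divide_simps\<close>)
qed

lemma sdist_nonneg: "x \<in> X \<Longrightarrow> y \<in> X \<Longrightarrow> 0 \<le> sdist x y"
  unfolding sdist_def by (rule suminf_nonneg[OF sdist_summable(1)]) auto

lemma sdist_ge:
  assumes "x \<in> X" "y \<in> X" "pre L x \<noteq> pre L y"
  shows "1 / 2 ^ L \<le> sdist x y"
proof -
  obtain j where j: "j < L" "x j \<noteq> y j" using assms(3) by (auto simp: pre_eq_iff)
  have "1 / 2 ^ L \<le> (1 :: real) / 2 ^ Suc j" using j(1) by (intro divide_left_mono power_increasing) auto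
  also have "\<dots> \<le> \<bar>real (x j) - real (y j)\<bar> / 2 ^ Suc j" using j(2) by (intro divide_right_mono) auto
  also have "\<dots> = (\<Sum>j\<in>{j}. \<bar>real (x j) - real (y j)\<bar> / 2 ^ Suc j)" by simp
  also have "\<dots> \<le> sdist x y"
    unfolding sdist_def by (rule sum_le_suminf[OF sdist_summable(1)[OF assms(1,2)]]) auto
  finally show ?thesis .
qed

lemma sdist_le:
  assumes "x \<in> X" "y \<in> X" "pre r x = pre r y"
  shows "sdist x y \<le> m / 2 ^ r"
proof -
  let ?f = "\<lambda>j. \<bar>real (x j) - real (y j)\<bar> / 2 ^ Suc j"
  note s = sdist_summable[OF assms(1,2)]
  have "sdist x y = (\<Sum>j. ?f (j + r)) + (\<Sum>j<r. ?f j)"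
    unfolding sdist_def by (rule suminf_split_initial_segment[OF s(1)])
  also have "(\<Sum>j<r. ?f j) = 0" using assms(3) by (intro sum.neutral) (auto simp: pre_eq_iff)
  also have "(\<Sum>j. ?f (j + r)) \<le> (\<Sum>j. m / 2 ^ r * (1 / 2) ^ Suc j)"
  proof (rule suminf_le)
    show "?f (j + r) \<le> m / 2 ^ r * (1 / 2) ^ Suc j" for j
      using s(2)[of "j + r"] by (simp add: power_add power_one_over field_simps)
    show "summable (\<lambda>j. ?f (j + r))" using s(1) by (rule summable_ignore_initial_segment)
    show "summable (\<lambda>j. m / 2 ^ r * (1 / 2) ^ Suc j :: real)" by (intro summable_mult sums_summable[OF power_half_series])
  qed
  also have "\<dots> = m / 2 ^ r * 1" by (rule sums_unique[symmetric, OF sums_mult[OF power_half_series]])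
  finally show ?thesis by simp
qed

text \<open>Links the metric \<open>sdist\<close> to the product topology: points in a long common
  cylinder are \<open>sdist\<close>-close.\<close>

lemma lip1_measurable:
  assumes "lip1 X \<phi>"
  shows "\<phi> \<in> borel_measurable (restrict_space borel X)"
proof (rule borel_measurable_continuous_on_restrict)
  show "continuous_on X \<phi>"
    unfolding continuous_on_topological
  proof (intro ballI allI impI)
    fix x B assume x: "x \<in> X" and B: "open B" "\<phi> x \<in> B"
    obtain e where e: "0 < e" "ball (\<phi> x) e \<subseteq> B" using B by (meson open_contains_ball)
    have "(\<lambda>r. real m * (1 / 2) ^ r) \<longlonglongrightarrow> real m * 0" by (intro tendsto_mult tendsto_const LIMSEQ_realpow_zero) auto
    then have "\<forall>\<^sub>F r in sequentially. real m * (1 / 2) ^ r < e" using e(1) by (intro order_tendstoD(2)) auto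
    then obtain r where r: "real m * (1 / 2) ^ r < e" using eventually_happens'[OF sequentially_bot] by blast
    have "\<phi> y \<in> B" if y: "y \<in> X" "pre r y = pre r x" for y
    proof -
      have "\<bar>\<phi> x - \<phi> y\<bar> \<le> sdist x y" using assms x y(1) unfolding lip1_def by blast
      also have "\<dots> \<le> m / 2 ^ r" using sdist_le[OF x y(1)] y(2) by simp
      also have "\<dots> < e" using r by (simp add: power_one_over)
      finally have "\<phi> y \<in> ball (\<phi> x) e" by (simp add: dist_real_def)
      then show ?thesis using e(2) by blast
    qed
    then show "\<exists>A. open A \<and> x \<in> A \<and> (\<forall>y\<in>X. y \<in> A \<longrightarrow> \<phi> y \<in> B)"
      by (intro exI[of _ "{y. pre r y = pre r x}"]) (auto simp: open_cylinder)
  qed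
qed

lemma lip1_zero: "lip1 X (\<lambda>_. 0)"
  by (auto simp: lip1_def sdist_nonneg)

lemma emp_int_bound:
  assumes "x \<in> X" "lip1 X \<phi>"
  shows "\<bar>emp_int x n \<phi>\<bar> \<le> 1"
proof -
  have "\<bar>\<Sum>k<n. \<phi> ((shift ^^ k) x)\<bar> \<le> (\<Sum>k<n. 1)"
    using assms shift_in by (intro order_trans[OF sum_abs] sum_mono) (auto simp: lip1_def)
  then show ?thesis by (cases "n = 0") (auto simp: emp_int_def abs_divide field_simps)
qed

lemma integral_lip1_bound:
  assumes "\<mu> \<in> prob_measures X" "lip1 X \<phi>"
  shows "\<bar>integral\<^sup>L \<mu> \<phi>\<bar> \<le> 1"
proof -
  have s: "sets \<mu> = sets (restrict_space borel X)" "prob_space \<mu>" using assms by (auto simp: prob_measures_def)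
  interpret prob_space \<mu> by (rule s(2))
  have sp: "space \<mu> = X" using sets_eq_imp_space_eq[OF s(1)] by (simp add: space_restrict_space)
  have "\<bar>integral\<^sup>L \<mu> \<phi>\<bar> \<le> integral\<^sup>L \<mu> (\<lambda>x. \<bar>\<phi> x\<bar>)" by (rule integral_abs_bound)
  also have "\<dots> \<le> integral\<^sup>L \<mu> (\<lambda>x. 1)"
    by (rule integral_mono') (use assms(2) sp in \<open>auto simp: lip1_def\<close>)
  finally show ?thesis using prob_space by simp
qed

lemma wass_emp_ge:
  assumes "x \<in> X" "\<mu> \<in> prob_measures X" "lip1 X \<phi>"
  shows "\<bar>emp_int x n \<phi> - integral\<^sup>L \<mu> \<phi>\<bar> \<le> wass_emp X x n \<mu>"
  unfolding wass_emp_def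
proof (rule cSup_upper)
  show "bdd_above {\<bar>emp_int x n \<phi> - integral\<^sup>L \<mu> \<phi>\<bar> |\<phi>. lip1 X \<phi>}"
  proof (rule bdd_aboveI[of _ 2])
    fix t assume "t \<in> {\<bar>emp_int x n \<phi> - integral\<^sup>L \<mu> \<phi>\<bar> |\<phi>. lip1 X \<phi>}"
    then obtain \<phi> where "lip1 X \<phi>" "t = \<bar>emp_int x n \<phi> - integral\<^sup>L \<mu> \<phi>\<bar>" by blast
    then show "t \<le> 2" using emp_int_bound[OF assms(1), of \<phi> n] integral_lip1_bound[OF assms(2), of \<phi>] by linarith
  qed
qed (use assms(3) in blast)

lemma wass_emp_le:
  assumes "\<And>\<phi>. lip1 X \<phi> \<Longrightarrow> \<bar>emp_int x n \<phi> - integral\<^sup>L \<mu> \<phi>\<bar> \<le> c"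
  shows "wass_emp X x n \<mu> \<le> c"
  unfolding wass_emp_def by (rule cSup_least) (use assms lip1_zero in auto)

definition freq :: "nat \<Rightarrow> seq \<Rightarrow> nat \<Rightarrow> nat list \<Rightarrow> real" where
  "freq r x n v = (\<Sum>k<n. if pre r ((shift ^^ k) x) = v then 1 else 0) / n"

text \<open>Up to m / 2^r, uniformly over all test functions, an empirical measure is described by
  the finitely many frequencies of words of length r.\<close>

lemma emp_int_freq:
  assumes x: "x \<in> X" and \<phi>: "lip1 X \<phi>" and n: "1 \<le> n" and y: "\<And>v. v \<in> lang_n X r \<Longrightarrow> y v \<in> X \<and> pre r (y v) = v"
  shows "\<bar>emp_int x n \<phi> - (\<Sum>v\<in>lang_n X r. freq r x n v * \<phi> (y v))\<bar> \<le> m / 2 ^ r"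
proof -
  let ?z = "\<lambda>k. (shift ^^ k) x"
  have z: "?z k \<in> X" "pre r (?z k) \<in> lang_n X r" for k using shift_in[OF x] by (auto simp: lang_n_eq)
  have "(\<Sum>v\<in>lang_n X r. freq r x n v * \<phi> (y v)) = (\<Sum>v\<in>lang_n X r. \<Sum>k<n. if pre r (?z k) = v then \<phi> (y v) else 0) / n"
    unfolding freq_def sum_divide_distrib sum_distrib_right by (intro sum.cong refl) auto
  also have "\<dots> = (\<Sum>k<n. \<Sum>v\<in>lang_n X r. if pre r (?z k) = v then \<phi> (y v) else 0) / n"
    by (subst sum.swap) simp
  also have "\<dots> = (\<Sum>k<n. \<phi> (y (pre r (?z k)))) / n"
    using z(2) by (simp add: sum.delta)
  finally have "emp_int x n \<phi> - (\<Sum>v\<in>lang_n X r. freq r x n v * \<phi> (y v)) = (\<Sum>k<n. \<phi> (?z k) - \<phi> (y (pre r (?z k)))) / n"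
    by (simp add: emp_int_def sum_subtractf diff_divide_distrib)
  moreover have "\<bar>\<Sum>k<n. \<phi> (?z k) - \<phi> (y (pre r (?z k)))\<bar> \<le> (\<Sum>k<n. m / 2 ^ r)"
  proof (rule order_trans[OF sum_abs sum_mono])
    fix k
    have "\<bar>\<phi> (?z k) - \<phi> (y (pre r (?z k)))\<bar> \<le> sdist (?z k) (y (pre r (?z k)))"
      using \<phi> z y[OF z(2)] unfolding lip1_def by blast
    also have "\<dots> \<le> m / 2 ^ r" using y[OF z(2)[of k]] by (intro sdist_le z(1)) auto
    finally show "\<bar>\<phi> (?z k) - \<phi> (y (pre r (?z k)))\<bar> \<le> m / 2 ^ r" .
  qed
  then have "\<bar>\<Sum>k<n. \<phi> (?z k) - \<phi> (y (pre r (?z k)))\<bar> / n \<le> (\<Sum>k<n. m / 2 ^ r) / n"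
    by (rule divide_right_mono) simp
  ultimately have "\<bar>emp_int x n \<phi> - (\<Sum>v\<in>lang_n X r. freq r x n v * \<phi> (y v))\<bar> \<le> (\<Sum>k<n. m / 2 ^ r) / n"
    by (simp only: abs_divide abs_of_nat)
  then show ?thesis using n by simp
qed

text \<open>Finitely many empirical measures of a point are \<open>\<epsilon>\<close>-dense among all of them, so the
  least number in the definition of the emergence exists.\<close>

lemma emergence_exists:
  assumes x: "x \<in> X" and \<epsilon>: "0 < \<epsilon>"
  shows "\<exists>(N :: nat) \<mu>s. 1 \<le> N \<and> (\<forall>j<N. \<mu>s j \<in> prob_measures X) \<and>
     limsup (\<lambda>n. ereal (Min ((\<lambda>j. wass_emp X x n (\<mu>s j)) ` {..<N}))) \<le> ereal \<epsilon>"
proof -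
  have "(\<lambda>r. real m * (1 / 2) ^ r) \<longlonglongrightarrow> real m * 0" by (intro tendsto_mult tendsto_const LIMSEQ_realpow_zero) auto
  then have "\<forall>\<^sub>F r in sequentially. real m * (1 / 2) ^ r < \<epsilon> / 4" using \<epsilon> by (intro order_tendstoD(2)) auto
  then obtain r where r: "real m * (1 / 2) ^ r < \<epsilon> / 4" using eventually_happens'[OF sequentially_bot] by blast
  let ?V = "lang_n X r"
  have cV: "0 < card ?V" using lang_n_nonempty by (simp add: card_gt_0_iff)
  \<comment> \<open>Rounding all frequencies costs \<epsilon>/2 in total; each of the two
    replacements by frequencies costs less than \<epsilon>/4.\<close>
  define \<delta> where "\<delta> = \<epsilon> / (2 * real (card ?V))"
  have \<delta>: "0 < \<delta>" using \<epsilon> cV by (simp add: \<delta>_def)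
  have "\<forall>v\<in>?V. \<exists>y. y \<in> X \<and> pre r y = v" by (auto simp: lang_n_eq)
  then obtain y where y: "\<And>v. v \<in> ?V \<Longrightarrow> y v \<in> X \<and> pre r (y v) = v" by metis
  define key where "key n = restrict (\<lambda>v. \<lfloor>freq r x n v / \<delta>\<rfloor>) ?V" for n
  have freq01: "0 \<le> freq r x n v" "freq r x n v \<le> 1" for n v
  proof -
    show "0 \<le> freq r x n v" by (auto simp: freq_def intro!: divide_nonneg_nonneg sum_nonneg)
    have "(\<Sum>k<n. if pre r ((shift ^^ k) x) = v then 1 else 0) \<le> (\<Sum>k<n. 1 :: real)" by (rule sum_mono) auto
    then show "freq r x n v \<le> 1" by (cases "n = 0") (auto simp: freq_def field_simps)
  qed
  have "range key \<subseteq> ?V \<rightarrow>\<^sub>E {0..\<lfloor>1 / \<delta>\<rfloor>}"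
    using freq01 \<delta> by (auto simp: key_def intro!: floor_mono divide_right_mono)
  then have "finite (range key)" by (rule finite_subset) (auto intro!: finite_PiE)
  then have fin: "finite (key ` {1..})" by (rule finite_subset[rotated]) auto
  define N where "N = card (key ` {1..})"
  obtain e where e: "bij_betw e {..<N} (key ` {1..})"
    using ex_bij_betw_nat_finite[OF fin] unfolding N_def atLeast0LessThan by blast
  define rep where "rep j = (SOME n. 1 \<le> n \<and> key n = e j)" for j
  have rep: "1 \<le> rep j \<and> key (rep j) = e j" if "j < N" for j
  proof -
    have "e j \<in> key ` {1..}" using e that by (auto simp: bij_betw_def)
    then have "\<exists>n. 1 \<le> n \<and> key n = e j" by auto
    then show ?thesis unfolding rep_def by (rule someI_ex)
  qed
  have N: "1 \<le> N" using fin by (simp add: N_def Suc_le_eq card_gt_0_iff)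
  let ?\<mu> = "\<lambda>j. emp_measure X x (rep j)"
  have close: "\<exists>j<N. wass_emp X x n (?\<mu> j) \<le> \<epsilon>" if n: "1 \<le> n" for n
  proof -
    have "key n \<in> e ` {..<N}" using e n by (auto simp: bij_betw_def)
    then obtain j where j: "j < N" "key n = e j" by auto
    have "wass_emp X x n (?\<mu> j) \<le> \<epsilon>"
    proof (rule wass_emp_le)
      fix \<phi> assume \<phi>: "lip1 X \<phi>"
      let ?n' = "rep j"
      have n': "1 \<le> ?n'" "key ?n' = key n" using rep[OF j(1)] j(2) by auto
      have "\<bar>freq r x n v - freq r x ?n' v\<bar> \<le> \<delta>" if "v \<in> ?V" for v
      proof -
        have "\<lfloor>freq r x n v / \<delta>\<rfloor> = \<lfloor>freq r x ?n' v / \<delta>\<rfloor>" using fun_cong[OF n'(2), of v] that by (simp add: key_def)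
        then have "\<bar>freq r x n v / \<delta> - freq r x ?n' v / \<delta>\<bar> \<le> 1" by linarith
        then show ?thesis using \<delta> by (simp add: diff_divide_distrib[symmetric] abs_divide)
      qed
      moreover have "\<bar>\<phi> (y v)\<bar> \<le> 1" if "v \<in> ?V" for v using \<phi> y[OF that] by (simp add: lip1_def)
      ultimately have b: "\<bar>(freq r x n v - freq r x ?n' v) * \<phi> (y v)\<bar> \<le> \<delta> * 1" if "v \<in> ?V" for v
        unfolding abs_mult using that \<delta> by (intro mult_mono) auto
      have "\<bar>(\<Sum>v\<in>?V. freq r x n v * \<phi> (y v)) - (\<Sum>v\<in>?V. freq r x ?n' v * \<phi> (y v))\<bar> \<le> (\<Sum>v\<in>?V. \<delta> * 1)"
        unfolding sum_subtractf[symmetric] left_diff_distrib[symmetric] by (rule order_trans[OF sum_abs sum_mono]) (rule b)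
      also have "\<dots> = real (card ?V) * (\<epsilon> / (2 * real (card ?V)))" by (simp add: \<delta>_def)
      also have "\<dots> = \<epsilon> / 2"
      proof -
        have "c * (\<epsilon> / (2 * c)) = \<epsilon> / 2" if "0 < c" for c :: real using that by simp
        then show ?thesis using cV by (metis of_nat_0_less_iff)
      qed
      finally have 1: "\<bar>(\<Sum>v\<in>?V. freq r x n v * \<phi> (y v)) - (\<Sum>v\<in>?V. freq r x ?n' v * \<phi> (y v))\<bar> \<le> \<epsilon> / 2" .
      have "real m / 2 ^ r < \<epsilon> / 4" using r by (simp add: power_one_over)
      then have "\<bar>emp_int x n \<phi> - emp_int x ?n' \<phi>\<bar> \<le> \<epsilon>"
        using 1 emp_int_freq[OF x \<phi> n y] emp_int_freq[OF x \<phi> n'(1) y] by linarith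
      then show "\<bar>emp_int x n \<phi> - integral\<^sup>L (?\<mu> j) \<phi>\<bar> \<le> \<epsilon>"
        by (simp add: emp_integral[OF x lip1_measurable[OF \<phi>]])
    qed
    then show ?thesis using j(1) by blast
  qed
  have lim: "limsup (\<lambda>n. ereal (Min ((\<lambda>j. wass_emp X x n (?\<mu> j)) ` {..<N}))) \<le> ereal \<epsilon>"
  proof (rule Limsup_bounded)
    show "\<forall>\<^sub>F n in sequentially. ereal (Min ((\<lambda>j. wass_emp X x n (?\<mu> j)) ` {..<N})) \<le> ereal \<epsilon>"
      using eventually_ge_at_top[of 1]
    proof eventually_elim
      case (elim n)
      then obtain j where "j < N" "wass_emp X x n (?\<mu> j) \<le> \<epsilon>" using close by blast
      then have "Min ((\<lambda>j. wass_emp X x n (?\<mu> j)) ` {..<N}) \<le> \<epsilon>" by (subst Min_le_iff) auto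
      then show ?case by simp
    qed
  qed
  have "\<forall>j<N. ?\<mu> j \<in> prob_measures X" using emp_prob[OF x] rep by blast
  then show ?thesis using N lim by (intro exI[of _ N] exI[of _ ?\<mu>]) auto
qed

text \<open>Points with different prefixes of length L are at least 2^(-L) apart, so this scaling
  makes any function of the prefix with values in [0, 1] a test function.\<close>

lemma lip1_local:
  assumes "\<And>w. 0 \<le> \<psi> w \<and> \<psi> w \<le> (1 :: real)"
  shows "lip1 X (\<lambda>x. \<psi> (pre L x) / 2 ^ L)"
  unfolding lip1_def
proof (intro conjI ballI)
  fix x
  have "\<bar>\<psi> (pre L x)\<bar> \<le> 1" using assms[of "pre L x"] by simp
  also have "(1 :: real) \<le> 2 ^ L" by simp
  finally show "\<bar>\<psi> (pre L x) / 2 ^ L\<bar> \<le> 1" by (simp add: abs_divide)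
next
  fix x y assume xy: "x \<in> X" "y \<in> X"
  show "\<bar>\<psi> (pre L x) / 2 ^ L - \<psi> (pre L y) / 2 ^ L\<bar> \<le> sdist x y"
  proof (cases "pre L x = pre L y")
    case True
    then show ?thesis using sdist_nonneg[OF xy] by simp
  next
    case False
    have "\<bar>\<psi> (pre L x) - \<psi> (pre L y)\<bar> \<le> 1" using assms[of "pre L x"] assms[of "pre L y"] by (simp add: abs_le_iff)
    then have "\<bar>\<psi> (pre L x) / 2 ^ L - \<psi> (pre L y) / 2 ^ L\<bar> \<le> 1 / 2 ^ L"
      by (simp add: diff_divide_distrib[symmetric] abs_divide divide_right_mono)
    then show ?thesis using sdist_ge[OF xy False] by linarith
  qed
qed

lemma emp_int_local:
  assumes "\<And>w. 0 \<le> \<psi> w \<and> \<psi> w \<le> (1 :: real)" "1 \<le> n"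
  shows "\<bar>2 ^ L * emp_int x n (\<lambda>x. \<psi> (pre L x) / 2 ^ L) - wsum L \<psi> (pre n x) / n\<bar> \<le> L / n"
proof -
  have "\<bar>birk (\<lambda>x. \<psi> (pre L x)) n x - wsum L \<psi> (pre n x)\<bar> \<le> real n * 0 + 1 * real L"
    by (rule birk_wsum) (use assms in auto)
  moreover have "2 ^ L * emp_int x n (\<lambda>x. \<psi> (pre L x) / 2 ^ L) = birk (\<lambda>x. \<psi> (pre L x)) n x / n"
    by (simp add: emp_int_def birk_def sum_divide_distrib[symmetric])
  ultimately show ?thesis using assms(2) by (simp add: diff_divide_distrib[symmetric] abs_divide divide_right_mono)
qed

text \<open>At a late visit to target \<open>a\<close> some \<mu>_j is close to the empirical
  measure, and its integrals determine \<open>v a\<close> up to three errors of \<zeta>/8. As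
  targets are \<zeta>-separated, one \<mu>_j serves at most one target.\<close>

lemma emergence_ge:
  fixes \<zeta> \<epsilon> :: real and v :: "'a \<Rightarrow> nat \<Rightarrow> real"
  assumes x: "x \<in> X" and \<psi>: "\<And>i w. i < k \<Longrightarrow> 0 \<le> \<psi> i w \<and> \<psi> i w \<le> (1 :: real)" and \<zeta>: "0 < \<zeta>" and \<epsilon>: "0 < \<epsilon>" "\<epsilon> * 2 ^ L < \<zeta> / 8"
    and sep: "\<And>a b. a \<in> A \<Longrightarrow> b \<in> A \<Longrightarrow> a \<noteq> b \<Longrightarrow> \<exists>i<k. \<zeta> \<le> \<bar>v a i - v b i\<bar>"
    and visit: "\<And>a n0. a \<in> A \<Longrightarrow> \<exists>n\<ge>n0. \<forall>i<k. \<bar>wsum L (\<psi> i) (pre n x) - v a i * n\<bar> \<le> \<zeta> / 8 * n"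
  shows "card A \<le> emergence X x \<epsilon>"
proof -
  let ?Q = "\<lambda>N :: nat. 1 \<le> N \<and> (\<exists>\<mu>s. (\<forall>j<N. \<mu>s j \<in> prob_measures X) \<and>
      limsup (\<lambda>n. ereal (Min ((\<lambda>j. wass_emp X x n (\<mu>s j)) ` {..<N}))) \<le> ereal \<epsilon>)"
  define N where "N = emergence X x \<epsilon>"
  have "\<exists>N. ?Q N" using emergence_exists[OF x \<epsilon>(1)] by blast
  then have "?Q N" unfolding N_def emergence_def by (rule LeastI_ex)
  then obtain \<mu>s where N: "1 \<le> N" and \<mu>: "\<And>j. j < N \<Longrightarrow> \<mu>s j \<in> prob_measures X"
    and ls: "limsup (\<lambda>n. ereal (Min ((\<lambda>j. wass_emp X x n (\<mu>s j)) ` {..<N}))) \<le> ereal \<epsilon>" by blast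
  \<comment> \<open>Strictly above \<epsilon>, so that the bound on the upper limit becomes a bound
    at all late times.\<close>
  define \<epsilon>' where "\<epsilon>' = \<zeta> / (8 * 2 ^ L)"
  have "\<epsilon> < \<epsilon>'" using \<epsilon>(2) by (simp add: \<epsilon>'_def field_simps)
  then have "limsup (\<lambda>n. ereal (Min ((\<lambda>j. wass_emp X x n (\<mu>s j)) ` {..<N}))) < ereal \<epsilon>'"
    using ls by (meson ereal_less(2) less_ereal.simps(1) order_le_less_trans)
  then have "\<forall>\<^sub>F n in sequentially. ereal (Min ((\<lambda>j. wass_emp X x n (\<mu>s j)) ` {..<N})) < ereal \<epsilon>'"
    by (rule Limsup_lessD)
  then obtain n0 where n0: "\<forall>n\<ge>n0. ereal (Min ((\<lambda>j. wass_emp X x n (\<mu>s j)) ` {..<N})) < ereal \<epsilon>'"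
    unfolding eventually_sequentially by (elim exE)
  let ?\<phi> = "\<lambda>i x. \<psi> i (pre L x) / 2 ^ L"
  have "\<exists>j<N. \<forall>i<k. \<bar>2 ^ L * integral\<^sup>L (\<mu>s j) (?\<phi> i) - v a i\<bar> < \<zeta> / 2" if a: "a \<in> A" for a
  proof -
    define n1 where "n1 = n0 + 1 + nat \<lceil>8 * real L / \<zeta>\<rceil>"
    obtain n where n: "n \<ge> n1" "\<forall>i<k. \<bar>wsum L (\<psi> i) (pre n x) - v a i * n\<bar> \<le> \<zeta> / 8 * n" using visit[OF a] by blast
    have n': "1 \<le> n" "n0 \<le> n" using n(1) by (auto simp: n1_def)
    have "8 * real L / \<zeta> \<le> n" using n(1) unfolding n1_def by linarith
    then have Ln: "L / n \<le> \<zeta> / 8" using \<zeta> n'(1) by (simp add: field_simps)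
    have "Min ((\<lambda>j. wass_emp X x n (\<mu>s j)) ` {..<N}) < \<epsilon>'" using n0 n'(2) by simp
    then obtain j where j: "j < N" "wass_emp X x n (\<mu>s j) < \<epsilon>'"
      using N by (subst (asm) Min_less_iff) (auto simp: lessThan_empty_iff)
    have "\<bar>2 ^ L * integral\<^sup>L (\<mu>s j) (?\<phi> i) - v a i\<bar> < \<zeta> / 2" if i: "i < k" for i
    proof -
      have "\<bar>emp_int x n (?\<phi> i) - integral\<^sup>L (\<mu>s j) (?\<phi> i)\<bar> < \<epsilon>'"
        using wass_emp_ge[OF x \<mu>[OF j(1)] lip1_local[where \<psi> = "\<psi> i" and L = L, OF \<psi>[OF i]], of n] j(2) by linarith
      then have *: "2 ^ L * \<bar>emp_int x n (?\<phi> i) - integral\<^sup>L (\<mu>s j) (?\<phi> i)\<bar> < 2 ^ L * \<epsilon>'" by simp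
      then have 1: "\<bar>2 ^ L * emp_int x n (?\<phi> i) - 2 ^ L * integral\<^sup>L (\<mu>s j) (?\<phi> i)\<bar> < \<zeta> / 8"
      proof -
        have "\<bar>2 ^ L * e - 2 ^ L * d\<bar> = 2 ^ L * \<bar>e - d\<bar>" for e d :: real
          by (simp only: right_diff_distrib[symmetric] abs_mult power_abs abs_numeral)
        moreover have "2 ^ L * \<epsilon>' = \<zeta> / 8" by (simp add: \<epsilon>'_def)
        ultimately show ?thesis using * by metis
      qed
      have 2: "\<bar>2 ^ L * emp_int x n (?\<phi> i) - wsum L (\<psi> i) (pre n x) / n\<bar> \<le> \<zeta> / 8"
        using emp_int_local[of "\<psi> i" n L x, OF \<psi>[OF i] n'(1)] Ln by linarith
      have "\<bar>wsum L (\<psi> i) (pre n x) - v a i * n\<bar> / n \<le> \<zeta> / 8" using n(2) i n'(1) by (simp add: field_simps)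
      then have 3: "\<bar>wsum L (\<psi> i) (pre n x) / n - v a i\<bar> \<le> \<zeta> / 8"
      proof -
        have "wsum L (\<psi> i) (pre n x) / n - v a i = (wsum L (\<psi> i) (pre n x) - v a i * n) / n" using n'(1) by (simp add: field_simps)
        then show ?thesis using \<open>\<bar>wsum L (\<psi> i) (pre n x) - v a i * n\<bar> / n \<le> \<zeta> / 8\<close> by (simp only: abs_divide abs_of_nat)
      qed
      show ?thesis using 1 2 3 \<zeta> by linarith
    qed
    then show ?thesis using j(1) by blast
  qed
  then obtain J where J: "\<And>a. a \<in> A \<Longrightarrow> J a < N \<and> (\<forall>i<k. \<bar>2 ^ L * integral\<^sup>L (\<mu>s (J a)) (?\<phi> i) - v a i\<bar> < \<zeta> / 2)" by metis
  have "inj_on J A"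
  proof (rule inj_onI, rule ccontr)
    fix a b assume ab: "a \<in> A" "b \<in> A" "J a = J b" "a \<noteq> b"
    obtain i where i: "i < k" "\<zeta> \<le> \<bar>v a i - v b i\<bar>" using sep[OF ab(1,2,4)] by blast
    have "\<bar>2 ^ L * integral\<^sup>L (\<mu>s (J a)) (?\<phi> i) - v a i\<bar> < \<zeta> / 2" "\<bar>2 ^ L * integral\<^sup>L (\<mu>s (J a)) (?\<phi> i) - v b i\<bar> < \<zeta> / 2"
      using J[OF ab(1)] J[OF ab(2)] i(1) ab(3) by auto
    then show False using i(2) by linarith
  qed
  then have "card A \<le> card {..<N}" by (rule card_inj_on_le) (use J in auto)
  then show ?thesis by (simp add: N_def)
qed

text \<open>L and \<zeta> may depend on k but not on M. Taking M of order c/\<epsilon> gives at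
  least (c/\<epsilon>)^k separated targets, so the quotient of logarithms eventually exceeds k -
  1.\<close>

lemma high_emergenceI:
  assumes x: "x \<in> X"
    and targets: "\<And>k. 1 \<le> k \<Longrightarrow> \<exists>L \<psi> \<zeta>. 0 < (\<zeta> :: real) \<and> (\<forall>i<k. \<forall>w. 0 \<le> \<psi> i w \<and> \<psi> i w \<le> (1 :: real)) \<and>
      (\<forall>M\<ge>1. \<exists>v :: (nat \<Rightarrow> nat) \<Rightarrow> nat \<Rightarrow> real.
        (\<forall>a\<in>{..<k} \<rightarrow>\<^sub>E {..M}. \<forall>b\<in>{..<k} \<rightarrow>\<^sub>E {..M}. a \<noteq> b \<longrightarrow> (\<exists>i<k. \<zeta> / M \<le> \<bar>v a i - v b i\<bar>)) \<and>
        (\<forall>a\<in>{..<k} \<rightarrow>\<^sub>E {..M}. \<forall>n0. \<exists>n\<ge>n0. \<forall>i<k. \<bar>wsum L (\<psi> i) (pre n x) - v a i * n\<bar> \<le> \<zeta> / M / 8 * n))"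
  shows "x \<in> high_emergence X"
proof -
  have "\<forall>\<^sub>F \<epsilon> in at_right 0. Z \<le> ln (real (emergence X x \<epsilon>)) / (- ln \<epsilon>)" for Z :: real
  proof -
    define K where "K = nat \<lceil>\<bar>Z\<bar>\<rceil>"
    have K: "Z \<le> K" unfolding K_def by linarith
    define k where "k = K + 1"
    have "1 \<le> k" by (simp add: k_def)
    from targets[OF this] obtain L \<psi> and \<zeta> :: real where \<zeta>: "0 < \<zeta>" and \<psi>: "\<forall>i<k. \<forall>w. 0 \<le> \<psi> i w \<and> \<psi> i w \<le> (1 :: real)"
      and MM: "\<forall>M\<ge>1. \<exists>v :: (nat \<Rightarrow> nat) \<Rightarrow> nat \<Rightarrow> real.
        (\<forall>a\<in>{..<k} \<rightarrow>\<^sub>E {..M}. \<forall>b\<in>{..<k} \<rightarrow>\<^sub>E {..M}. a \<noteq> b \<longrightarrow> (\<exists>i<k. \<zeta> / M \<le> \<bar>v a i - v b i\<bar>)) \<and>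
        (\<forall>a\<in>{..<k} \<rightarrow>\<^sub>E {..M}. \<forall>n0. \<exists>n\<ge>n0. \<forall>i<k. \<bar>wsum L (\<psi> i) (pre n x) - v a i * n\<bar> \<le> \<zeta> / M / 8 * n)"
      by (elim exE conjE)
    \<comment> \<open>From \<epsilon> M \<le> c follows \<epsilon> 2^L \<le> \<zeta> / (16 M),
      strictly below the \<zeta> / (8 M) that \<open>emergence_ge\<close> asks for.\<close>
    define c where "c = \<zeta> / (16 * 2 ^ L)"
    have c: "0 < c" using \<zeta> by (simp add: c_def)
    \<comment> \<open>The entry c^k lets one factor 1/\<epsilon> absorb the constant c^k, which
      leaves the exponent K = k - 1.\<close>
    define e0 where "e0 = min (min c (1 / 2)) (c ^ k)"
    have e0: "0 < e0" using c by (simp add: e0_def)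
    have "Z \<le> ln (real (emergence X x \<epsilon>)) / (- ln \<epsilon>)" if \<epsilon>: "0 < \<epsilon>" "\<epsilon> < e0" for \<epsilon>
    proof -
      have \<epsilon>c: "\<epsilon> \<le> c" "\<epsilon> < 1" "\<epsilon> \<le> c ^ k" using \<epsilon> by (auto simp: e0_def)
      define M where "M = nat \<lfloor>c / \<epsilon>\<rfloor>"
      have "1 \<le> c / \<epsilon>" using \<epsilon>(1) \<epsilon>c(1) by simp
      then have M1: "1 \<le> M" unfolding M_def by (simp add: le_nat_floor)
      have M2: "M \<le> c / \<epsilon>" "c / \<epsilon> \<le> M + 1" using \<open>1 \<le> c / \<epsilon>\<close> unfolding M_def by linarith+
      obtain v :: "(nat \<Rightarrow> nat) \<Rightarrow> nat \<Rightarrow> real" where v: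
        "\<forall>a\<in>{..<k} \<rightarrow>\<^sub>E {..M}. \<forall>b\<in>{..<k} \<rightarrow>\<^sub>E {..M}. a \<noteq> b \<longrightarrow> (\<exists>i<k. \<zeta> / M \<le> \<bar>v a i - v b i\<bar>)"
        "\<forall>a\<in>{..<k} \<rightarrow>\<^sub>E {..M}. \<forall>n0. \<exists>n\<ge>n0. \<forall>i<k. \<bar>wsum L (\<psi> i) (pre n x) - v a i * n\<bar> \<le> \<zeta> / M / 8 * n"
        using MM[rule_format, OF M1] by (elim exE conjE)
      have "\<epsilon> * 2 ^ L < \<zeta> / M / 8"
      proof -
        have "\<epsilon> * M \<le> c" using M2(1) \<epsilon>(1) by (simp add: field_simps)
        then have "\<epsilon> * 2 ^ L * M \<le> \<zeta> / 16" by (simp add: c_def field_simps)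
        then have "\<epsilon> * 2 ^ L \<le> \<zeta> / 16 / M" using M1 by (simp add: pos_le_divide_eq)
        also have "\<dots> < \<zeta> / M / 8" using \<zeta> M1 by (simp add: field_simps)
        finally show ?thesis .
      qed
      then have "card ({..<k} \<rightarrow>\<^sub>E {..M}) \<le> emergence X x \<epsilon>"
        by (intro emergence_ge[OF x, where \<zeta> = "\<zeta> / M" and k = k and \<psi> = \<psi> and v = v and L = L])
           (use \<psi> \<zeta> M1 \<epsilon>(1) v in auto)
      moreover have "card ({..<k} \<rightarrow>\<^sub>E {..M}) = (M + 1) ^ k" by (simp add: card_PiE)
      ultimately have E: "real ((M + 1) ^ k) \<le> emergence X x \<epsilon>" by (metis of_nat_mono)
      have "(c / \<epsilon>) ^ k \<le> (real M + 1) ^ k" using M2(2) c \<epsilon>(1) by (intro power_mono) auto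
      also have "\<dots> = real ((M + 1) ^ k)" by (simp add: add.commute)
      finally have "(c / \<epsilon>) ^ k \<le> emergence X x \<epsilon>" using E by linarith
      then have "ln ((c / \<epsilon>) ^ k) \<le> ln (emergence X x \<epsilon>)" using c \<epsilon>(1) by (intro ln_mono) auto
      moreover have "ln ((c / \<epsilon>) ^ k) = k * (ln c - ln \<epsilon>)" using c \<epsilon>(1) by (simp add: ln_realpow ln_div)
      moreover have "ln \<epsilon> \<le> k * ln c" using ln_mono[OF \<epsilon>c(3) \<epsilon>(1)] c by (simp add: ln_realpow)
      ultimately have "real K * (- ln \<epsilon>) \<le> ln (emergence X x \<epsilon>)" by (simp add: k_def algebra_simps)
      moreover have l: "0 < - ln \<epsilon>" using \<epsilon>(1) \<epsilon>c(2) by simp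
      ultimately have "real K \<le> ln (emergence X x \<epsilon>) / (- ln \<epsilon>)" by (subst pos_le_divide_eq) auto
      then show ?thesis using K by linarith
    qed
    then show ?thesis unfolding eventually_at_right_field using e0 by (intro exI[of _ e0]) auto
  qed
  then show ?thesis using x by (auto simp: high_emergence_def filterlim_at_top)
qed

end

section \<open>Stages\<close>

text \<open>A slot is a set of words of one length, that length, and a lower bound for a weight of its words.\<close>

type_synonym slot = "nat list set \<times> nat \<times> real"

definition nlen :: "slot list \<Rightarrow> nat" where "nlen xs = sum_list (map (\<lambda>x. fst (snd x)) xs)"

definition slot_energy :: "real \<Rightarrow> slot \<Rightarrow> real" where
  "slot_energy s x = ln (card (fst x)) + snd (snd x) - s * real (fst (snd x))"

text \<open>All prefixes are required, not only the total, because a cylinder may end anywhere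
  inside a cycle and its mass is estimated there.\<close>

definition energy_ok :: "real \<Rightarrow> slot list \<Rightarrow> bool" where
  "energy_ok s xs \<longleftrightarrow> (\<forall>j. 0 \<le> sum_list (map (slot_energy s) (take j xs)))"

lemma nlen_simps [simp]: "nlen [] = 0" "nlen (xs @ ys) = nlen xs + nlen ys" "nlen (x # xs) = fst (snd x) + nlen xs"
  by (auto simp: nlen_def)

lemma nlen_replicate [simp]: "nlen (concat (replicate M xs)) = M * nlen xs"
  by (induction M) auto

lemma energy_ok_append:
  assumes "energy_ok s xs" "energy_ok s ys"
  shows "energy_ok s (xs @ ys)"
  unfolding energy_ok_def
proof
  fix j
  have "0 \<le> sum_list (map (slot_energy s) (take j xs))" "0 \<le> sum_list (map (slot_energy s) (take (j - length xs) ys))"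
    using assms unfolding energy_ok_def by blast+
  then show "0 \<le> sum_list (map (slot_energy s) (take j (xs @ ys)))" by simp
qed

lemma energy_ok_replicate: "energy_ok s xs \<Longrightarrow> energy_ok s (concat (replicate M xs))"
proof (induction M)
  case 0
  then show ?case by (simp add: energy_ok_def)
next
  case (Suc M)
  then show ?case using energy_ok_append[of s xs] by simp
qed

lemma nlen_take: "nlen (take j xs) \<le> nlen xs"
proof -
  have "nlen xs = nlen (take j xs) + nlen (drop j xs)" by (metis append_take_drop_id nlen_simps(2))
  then show ?thesis by simp
qed

text \<open>The order matters: the slots of \<open>xs\<close> build up a surplus before those of
  \<open>ys\<close> draw on it, so no prefix is in deficit.\<close>

lemma energy_okI:
  fixes c :: real
  assumes xs: "\<And>x. x \<in> set xs \<Longrightarrow> 0 \<le> slot_energy s x" and ys: "\<And>x. x \<in> set ys \<Longrightarrow> - c * real (fst (snd x)) \<le> slot_energy s x"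
    and c: "0 \<le> c" "c * nlen ys \<le> sum_list (map (slot_energy s) xs)"
  shows "energy_ok s (xs @ ys)"
  unfolding energy_ok_def
proof
  fix j
  have low: "- c * nlen zs \<le> sum_list (map (slot_energy s) zs)" if "set zs \<subseteq> set ys" for zs
    using that
  proof (induction zs)
    case (Cons z zs)
    have "- c * real (fst (snd z)) \<le> slot_energy s z" by (rule ys) (use Cons(2) in simp)
    moreover have "- c * nlen zs \<le> sum_list (map (slot_energy s) zs)" using Cons by simp
    ultimately show ?case by (simp add: algebra_simps)
  qed simp
  show "0 \<le> sum_list (map (slot_energy s) (take j (xs @ ys)))"
  proof (cases "j \<le> length xs")
    case True
    have "0 \<le> sum_list (map (slot_energy s) (take j xs))"
    proof (rule sum_list_nonneg)
      fix t assume "t \<in> set (map (slot_energy s) (take j xs))"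
      then obtain x where x: "x \<in> set (take j xs)" "t = slot_energy s x" by (metis imageE set_map)
      show "0 \<le> t" unfolding x(2) by (rule xs[OF in_set_takeD[OF x(1)]])
    qed
    then show ?thesis using True by simp
  next
    case False
    have "- c * nlen (take (j - length xs) ys) \<le> sum_list (map (slot_energy s) (take (j - length xs) ys))"
      by (rule low) (rule set_take_subset)
    moreover have "c * nlen (take (j - length xs) ys) \<le> c * nlen ys" using c(1) nlen_take by (intro mult_left_mono) auto
    ultimately show ?thesis using False c(2) by simp
  qed
qed

lemma nth_concat_replicate:
  "t < M \<Longrightarrow> i < length xs \<Longrightarrow> concat (replicate M xs) ! (t * length xs + i) = xs ! i"
proof (induction M arbitrary: t)
  case (Suc M)
  then show ?case by (cases t) (auto simp: nth_append)
qed simp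

text \<open>The number of copies is at least q + 1 times the length of all earlier stages, so stage
  q decides the statistics at its end. It is also at least q + 1 times the length of the next cycle,
  so a slot is always short compared with what precedes it.\<close>

fun stages :: "(nat \<Rightarrow> slot list) \<Rightarrow> nat \<Rightarrow> slot list" where
  "stages C 0 = []"
| "stages C (Suc q) = stages C q @ concat (replicate (Suc q * (nlen (stages C q) + nlen (C (Suc q)) + 1)) (C q))"

lemma stages_prefix: "p \<le> q \<Longrightarrow> \<exists>zs. stages C q = stages C p @ zs"
  by (induction rule: dec_induct) auto

lemma set_stages: "x \<in> set (stages C q) \<Longrightarrow> \<exists>p<q. x \<in> set (C p)"
proof (induction q)
  case (Suc q)
  then show ?case by (auto simp: less_Suc_eq simp del: replicate_Suc)
qed simp

text \<open>Stages extend each other and the first q of them contain at least q slots, so place i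
  can be read from the first i + 1 stages.\<close>

definition slot :: "(nat \<Rightarrow> slot list) \<Rightarrow> nat \<Rightarrow> slot" where
  "slot C i = stages C (Suc i) ! i"

definition cycle_stat :: "(nat list \<Rightarrow> real) \<Rightarrow> real \<Rightarrow> real \<Rightarrow> slot list \<Rightarrow> bool" where
  "cycle_stat \<Psi> v \<epsilon> xs \<longleftrightarrow> (\<forall>ds. (\<forall>i<length xs. ds i \<in> fst (xs ! i)) \<longrightarrow>
     \<bar>(\<Sum>i<length xs. \<Psi> (ds i)) - v * nlen xs\<bar> \<le> \<epsilon> * nlen xs)"

locale staged = spec_shift +
  fixes C :: "nat \<Rightarrow> slot list"
  assumes C_nonempty: "\<And>q. C q \<noteq> []"
    and C_slot: "\<And>q x. x \<in> set (C q) \<Longrightarrow> finite (fst x) \<and> fst x \<noteq> {} \<and> fst x \<subseteq> G \<and> (\<forall>w\<in>fst x. length w = fst (snd x))"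
begin

lemma length_stages: "q \<le> length (stages C q)"
proof (induction q)
  case (Suc q)
  have "1 \<le> length (C q)" using C_nonempty[of q] by (cases "C q") auto
  then have "1 \<le> length (concat (replicate (Suc q * (nlen (stages C q) + nlen (C (Suc q)) + 1)) (C q)))"
    by (simp add: length_concat sum_list_replicate)
  then show ?case using Suc by simp
qed simp

lemma slot_eq:
  assumes "i < length (stages C q)"
  shows "slot C i = stages C q ! i"
proof (cases "q \<le> Suc i")
  case True
  then obtain zs where "stages C (Suc i) = stages C q @ zs" using stages_prefix by blast
  then show ?thesis using assms by (simp add: slot_def nth_append del: stages.simps)
next
  case False
  then obtain zs where zs: "stages C q = stages C (Suc i) @ zs" using stages_prefix[of "Suc i" q C] by auto
  have "i < length (stages C (Suc i))" using length_stages[of "Suc i"] by simp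
  then show ?thesis unfolding slot_def zs by (simp add: nth_append del: stages.simps)
qed

lemma slot_in: "\<exists>q. slot C i \<in> set (C q)"
proof -
  have "i < length (stages C (Suc i))" using length_stages[of "Suc i"] by simp
  then have "slot C i \<in> set (stages C (Suc i))" unfolding slot_def by (rule nth_mem)
  then show ?thesis using set_stages by blast
qed

lemma sum_slots:
  fixes h :: "slot \<Rightarrow> 'b :: comm_monoid_add"
  assumes "r \<le> length (stages C q)"
  shows "(\<Sum>i<r. h (slot C i)) = sum_list (map h (take r (stages C q)))"
proof -
  have "map h (take r (stages C q)) = map (\<lambda>i. h (slot C i)) [0..<r]"
    by (rule nth_equalityI) (use assms in \<open>auto simp: slot_eq[of _ q]\<close>)
  then show ?thesis by (simp add: interv_sum_list_conv_sum_set_nat lessThan_atLeast0)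
qed

end

sublocale staged \<subseteq> slot_seq m X f G \<tau> g "\<lambda>i. fst (slot C i)" "\<lambda>i. fst (snd (slot C i))"
proof
  fix i
  obtain q where "slot C i \<in> set (C q)" using slot_in by blast
  from C_slot[OF this] show "finite (fst (slot C i))" "fst (slot C i) \<noteq> {}" "fst (slot C i) \<subseteq> G"
    "\<And>w. w \<in> fst (slot C i) \<Longrightarrow> length w = fst (snd (slot C i))" by auto
qed

context staged
begin

lemma nom_stages: "nom (length (stages C q)) = nlen (stages C q)"
  unfolding nom_def nlen_def by (subst sum_slots[of _ q]) auto

lemma nlen_C_pos: "1 \<le> nlen (C q)"
proof -
  obtain x xs where x: "C q = x # xs" using C_nonempty[of q] by (cases "C q") auto
  have "x \<in> set (C q)" using x by simp
  from C_slot[OF this] obtain w where "w \<in> G" "length w = fst (snd x)" by blast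
  then show ?thesis using G_length[of w] x by simp
qed

lemma staged_energy:
  fixes s :: real
  assumes "\<And>q. energy_ok s (C q)"
  shows "0 \<le> (\<Sum>i<r. ln (card (fst (slot C i))) + snd (snd (slot C i)) - s * real (fst (snd (slot C i))))"
proof -
  have "energy_ok s (stages C q)" for q
  proof (induction q)
    case 0
    then show ?case by (simp add: energy_ok_def)
  next
    case (Suc q)
    show ?case unfolding stages.simps by (intro energy_ok_append Suc energy_ok_replicate assms)
  qed
  then have "0 \<le> sum_list (map (slot_energy s) (take r (stages C r)))" unfolding energy_ok_def by blast
  also have "\<dots> = (\<Sum>i<r. slot_energy s (slot C i))" by (rule sum_slots[symmetric, OF length_stages])
  finally show ?thesis unfolding slot_energy_def .
qed

text \<open>If slot r belongs to cycle q, the repetition count of stage q - 1 makes the sequence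
  before stage q at least q times as long as the whole cycle.\<close>

lemma staged_slow:
  fixes e :: real
  assumes e: "0 < e"
  shows "\<exists>r0. \<forall>r\<ge>r0. real (fst (snd (slot C r))) \<le> e * nom r"
proof -
  obtain p :: nat where p: "1 / e < p" using reals_Archimedean2 by blast
  have "real (fst (snd (slot C r))) \<le> e * nom r" if r: "length (stages C (Suc p)) \<le> r" for r
  proof -
    define q where "q = (GREATEST q. length (stages C q) \<le> r)"
    have bd: "q' \<le> r" if "length (stages C q') \<le> r" for q' using that length_stages[of q'] by simp
    have q1: "length (stages C q) \<le> r" unfolding q_def by (rule GreatestI_nat[of _ "Suc p" r]) (use r bd in auto)
    have q2: "\<not> length (stages C (Suc q)) \<le> r"
    proof
      assume "length (stages C (Suc q)) \<le> r"
      then have "Suc q \<le> q" unfolding q_def by (rule Greatest_le_nat[of _ _ r]) (use bd in auto)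
      then show False by simp
    qed
    have pq: "Suc p \<le> q" unfolding q_def by (rule Greatest_le_nat[of _ _ r]) (use r bd in auto)
    then obtain q' where q': "q = Suc q'" by (cases q) auto
    have "slot C r = stages C (Suc q) ! r" using q2 by (intro slot_eq) simp
    also have "\<dots> = concat (replicate (Suc q * (nlen (stages C q) + nlen (C (Suc q)) + 1)) (C q)) ! (r - length (stages C q))"
      using q1 by (simp add: nth_append)
    also have "\<dots> \<in> set (concat (replicate (Suc q * (nlen (stages C q) + nlen (C (Suc q)) + 1)) (C q)))"
      by (rule nth_mem) (use q1 q2 in simp)
    finally have "slot C r \<in> set (C q)" by auto
    then obtain us vs where "C q = us @ slot C r # vs" by (auto simp: in_set_conv_decomp)
    then have 1: "fst (snd (slot C r)) \<le> nlen (C q)" by simp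
    have "p * nlen (C q) \<le> Suc q' * (nlen (stages C q') + nlen (C (Suc q')) + 1)"
      by (rule mult_le_mono) (use pq q' in auto)
    then have "p * nlen (C q) \<le> (Suc q' * (nlen (stages C q') + nlen (C (Suc q')) + 1)) * 1" by simp
    also have "\<dots> \<le> (Suc q' * (nlen (stages C q') + nlen (C (Suc q')) + 1)) * nlen (C q')"
      using nlen_C_pos[of q'] by (intro mult_left_mono) auto
    also have "\<dots> \<le> nlen (stages C q)" unfolding q' stages.simps nlen_simps nlen_replicate by (rule le_add2)
    also have "\<dots> = nom (length (stages C q))" by (rule nom_stages[symmetric])
    also have "\<dots> \<le> nom r" by (rule nom_mono[OF q1])
    finally have "p * fst (snd (slot C r)) \<le> nom r" using 1 by (meson le_trans mult_le_mono2)
    then have 2: "real p * real (fst (snd (slot C r))) \<le> nom r" by (metis of_nat_le_iff of_nat_mult)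
    have "1 * real (fst (snd (slot C r))) \<le> (e * p) * real (fst (snd (slot C r)))"
      using p e by (intro mult_right_mono) (auto simp: field_simps)
    also have "\<dots> \<le> e * nom r" using 2 e by (simp add: mult.assoc)
    finally show ?thesis by simp
  qed
  then show ?thesis by blast
qed

lemma staged_statistics:
  fixes \<kappa> v \<epsilon> \<nu> :: real
  assumes c: "\<And>j. c j \<in> fst (slot C j)" and \<Psi>: "almost_additive \<kappa> 1 \<Psi>" and v: "\<bar>v\<bar> \<le> 2"
    and stat: "cycle_stat \<Psi> v \<epsilon> (C q)" and \<nu>: "0 < \<nu>" "\<And>x. x \<in> set (C q) \<Longrightarrow> \<nu> \<le> real (fst (snd x))" and \<epsilon>: "0 \<le> \<epsilon>"
    and n: "n = length (glued c (length (stages C (Suc q)) - 1))"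
  shows "q \<le> n" "\<bar>\<Psi> (pre n (lim_seq c)) - v * n\<bar> \<le> (\<epsilon> + (2 * \<kappa> + 3 * \<tau>) / \<nu> + (2 * \<kappa> + 3 * \<tau> + 3) / Suc q) * n"
proof -
  define a where "a = length (stages C q)"
  define M where "M = Suc q * (nlen (stages C q) + nlen (C (Suc q)) + 1)"
  let ?l = "length (C q)"
  define b where "b = length (stages C (Suc q))"
  have b: "b = a + M * ?l" unfolding a_def M_def b_def by (simp add: length_concat sum_list_replicate)
  have M: "1 \<le> M" by (simp add: M_def)
  have l: "1 \<le> ?l" using C_nonempty[of q] by (cases "C q") auto
  have ab: "a < b" using M C_nonempty[of q] unfolding b by simp
  have sl: "slot C (a + (t * ?l + i)) = C q ! i" if "t < M" "i < ?l" for t i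
  proof -
    have "t * ?l + i < Suc t * ?l" using that by simp
    also have "\<dots> \<le> M * ?l" using that(1) by (intro mult_right_mono) auto
    finally have lt: "a + (t * ?l + i) < length (stages C (Suc q))" using b unfolding b_def by simp
    have "slot C (a + (t * ?l + i)) = stages C (Suc q) ! (a + (t * ?l + i))" by (rule slot_eq[OF lt])
    also have "\<dots> = concat (replicate M (C q)) ! (t * ?l + i)" unfolding a_def M_def stages.simps by (rule nth_append_length_plus)
    also have "\<dots> = C q ! i" by (rule nth_concat_replicate[OF that])
    finally show ?thesis .
  qed
  have nomb: "real (nom b) - nom a = M * nlen (C q)"
  proof -
    have "nom b = nlen (stages C (Suc q))" "nom a = nlen (stages C q)"
      unfolding a_def b_def by (rule nom_stages)+
    moreover have "nlen (stages C (Suc q)) = nlen (stages C q) + M * nlen (C q)"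
      unfolding stages.simps M_def by (simp only: nlen_simps nlen_replicate)
    ultimately show ?thesis by simp
  qed
  have sum_eq: "(\<Sum>j=a..<b. \<Psi> (c j)) = (\<Sum>t<M. \<Sum>i<?l. \<Psi> (c (a + (t * ?l + i))))"
  proof -
    have "(\<Sum>j=a..<b. \<Psi> (c j)) = (\<Sum>j<M * ?l. \<Psi> (c (a + j)))"
      unfolding b using sum.shift_bounds_nat_ivl[of "\<lambda>j. \<Psi> (c j)" 0 a "M * ?l"] by (simp add: add.commute lessThan_atLeast0)
    also have "\<dots> = (\<Sum>t<M. \<Sum>j=t * ?l..<t * ?l + ?l. \<Psi> (c (a + j)))" by (rule sum.nat_group[symmetric])
    also have "\<dots> = (\<Sum>t<M. \<Sum>i<?l. \<Psi> (c (a + (t * ?l + i))))"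
    proof (rule sum.cong[OF refl])
      fix t
      show "(\<Sum>j=t * ?l..<t * ?l + ?l. \<Psi> (c (a + j))) = (\<Sum>i<?l. \<Psi> (c (a + (t * ?l + i))))"
        using sum.shift_bounds_nat_ivl[of "\<lambda>j. \<Psi> (c (a + j))" 0 "t * ?l" ?l] by (simp add: add.commute lessThan_atLeast0)
    qed
    finally show ?thesis .
  qed
  have "\<bar>(\<Sum>j=a..<b. \<Psi> (c j)) - v * (real (nom b) - nom a)\<bar> = \<bar>\<Sum>t<M. (\<Sum>i<?l. \<Psi> (c (a + (t * ?l + i)))) - v * nlen (C q)\<bar>"
    unfolding sum_eq nomb by (simp add: sum_subtractf mult.left_commute)
  also have "\<dots> \<le> (\<Sum>t<M. \<epsilon> * nlen (C q))"
  proof (rule order_trans[OF sum_abs sum_mono])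
    fix t assume t: "t \<in> {..<M}"
    have *: "c (a + (t * ?l + i)) \<in> fst (C q ! i)" if "i < ?l" for i using sl[of t i] c[of "a + (t * ?l + i)"] t that by simp
    show "\<bar>(\<Sum>i<?l. \<Psi> (c (a + (t * ?l + i)))) - v * nlen (C q)\<bar> \<le> \<epsilon> * nlen (C q)"
      by (rule stat[unfolded cycle_stat_def, rule_format, of "\<lambda>i. c (a + (t * ?l + i))"]) (rule *)
  qed
  also have "\<dots> = \<epsilon> * (real (nom b) - nom a)" unfolding nomb by simp
  finally have st: "\<bar>(\<Sum>j=a..<b. \<Psi> (c j)) - v * (real (nom b) - nom a)\<bar> \<le> \<epsilon> * (real (nom b) - nom a)" .
  have nn: "n = length (glued c (b - 1))" using n by (simp only: b_def)
  have \<nu>2: "\<nu> \<le> real (fst (snd (slot C j)))" if "a \<le> j" "j < b" for j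
  proof -
    define t i where "t = (j - a) div ?l" and "i = (j - a) mod ?l"
    have "t < M" using that unfolding b t_def by (simp add: less_mult_imp_div_less mult.commute)
    moreover have "i < ?l" using C_nonempty[of q] by (simp add: i_def)
    moreover have "j = a + (t * ?l + i)" using that(1) by (simp add: t_def i_def)
    ultimately have "slot C j = C q ! i" using sl by simp
    then show ?thesis using \<nu>(2) \<open>i < ?l\<close> by simp
  qed
  have qq: "real (Suc q) * nom a \<le> real (nom b) - nom a"
  proof -
    have "Suc q * nom a \<le> M" unfolding a_def nom_stages M_def by (rule mult_le_mono2) simp
    then have "Suc q * nom a \<le> M * 1" by simp
    also have "\<dots> \<le> M * nlen (C q)" using nlen_C_pos[of q] by (intro mult_left_mono) auto
    finally have "real (Suc q * nom a) \<le> real (M * nlen (C q))" by (rule of_nat_mono)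
    then show ?thesis unfolding nomb by (simp only: of_nat_mult)
  qed
  have "b \<le> n" by (rule stage_statistics(1)[OF c \<Psi> ab v st \<nu>(1) \<nu>2 _ qq \<epsilon> nn]) auto
  then show "q \<le> n" using length_stages[of "Suc q"] unfolding b_def by linarith
  show "\<bar>\<Psi> (pre n (lim_seq c)) - v * n\<bar> \<le> (\<epsilon> + (2 * \<kappa> + 3 * \<tau>) / \<nu> + (2 * \<kappa> + 3 * \<tau> + 3) / Suc q) * n"
    by (rule stage_statistics(2)[OF c \<Psi> ab v st \<nu>(1) \<nu>2 _ qq \<epsilon> nn]) auto
qed

end

section \<open>Cycles with prescribed statistics\<close>

lemma cycle_stat_append:
  assumes xs: "cycle_stat \<Psi> v1 \<epsilon>1 xs" and ys: "cycle_stat \<Psi> v2 \<epsilon>2 ys"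
    and v: "v1 * nlen xs + v2 * nlen ys = v * real (nlen (xs @ ys))" and e: "\<epsilon>1 * nlen xs + \<epsilon>2 * nlen ys \<le> \<epsilon> * real (nlen (xs @ ys))"
  shows "cycle_stat \<Psi> v \<epsilon> (xs @ ys)"
  unfolding cycle_stat_def
proof (intro allI impI)
  fix ds assume ds: "\<forall>i<length (xs @ ys). ds i \<in> fst ((xs @ ys) ! i)"
  have "\<forall>i<length xs. ds i \<in> fst (xs ! i)"
  proof (intro allI impI)
    fix i assume "i < length xs"
    then show "ds i \<in> fst (xs ! i)" using ds[rule_format, of i] by (simp add: nth_append)
  qed
  then have 1: "\<bar>(\<Sum>i<length xs. \<Psi> (ds i)) - v1 * nlen xs\<bar> \<le> \<epsilon>1 * nlen xs" using xs unfolding cycle_stat_def by blast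
  have "\<forall>i<length ys. ds (length xs + i) \<in> fst (ys ! i)"
  proof (intro allI impI)
    fix i assume "i < length ys"
    then show "ds (length xs + i) \<in> fst (ys ! i)" using ds[rule_format, of "length xs + i"] by simp
  qed
  then have 2: "\<bar>(\<Sum>i<length ys. \<Psi> (ds (length xs + i))) - v2 * nlen ys\<bar> \<le> \<epsilon>2 * nlen ys"
    using ys[unfolded cycle_stat_def, rule_format, of "\<lambda>i. ds (length xs + i)"] by simp
  have "(\<Sum>i<length (xs @ ys). \<Psi> (ds i)) = (\<Sum>i<length xs. \<Psi> (ds i)) + (\<Sum>i<length ys. \<Psi> (ds (length xs + i)))"
    using sum.atLeastLessThan_concat[of 0 "length xs" "length xs + length ys" "\<lambda>i. \<Psi> (ds i)"]
      sum.shift_bounds_nat_ivl[of "\<lambda>i. \<Psi> (ds i)" 0 "length xs" "length ys"]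
    by (simp add: lessThan_atLeast0 add.commute)
  then show "\<bar>(\<Sum>i<length (xs @ ys). \<Psi> (ds i)) - v * nlen (xs @ ys)\<bar> \<le> \<epsilon> * nlen (xs @ ys)"
    using 1 2 v e by (simp only: abs_le_iff) linarith
qed

lemma cycle_stat_replicate:
  assumes "\<And>w. w \<in> S \<Longrightarrow> \<bar>\<Psi> w - v * n\<bar> \<le> \<epsilon> * n"
  shows "cycle_stat \<Psi> v \<epsilon> (replicate M (S, n, lam))"
  unfolding cycle_stat_def
proof (intro allI impI)
  fix ds assume ds: "\<forall>i<length (replicate M (S, n, lam)). ds i \<in> fst (replicate M (S, n, lam) ! i)"
  have nl: "nlen (replicate M (S, n, lam)) = M * n" by (induction M) auto
  have "\<bar>(\<Sum>i<M. \<Psi> (ds i)) - v * (M * n)\<bar> = \<bar>\<Sum>i<M. \<Psi> (ds i) - v * n\<bar>" by (simp add: sum_subtractf mult.left_commute)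
  also have "\<dots> \<le> (\<Sum>i<M. \<epsilon> * n)"
    by (rule order_trans[OF sum_abs sum_mono]) (use ds assms in auto)
  finally show "\<bar>(\<Sum>i<length (replicate M (S, n, lam)). \<Psi> (ds i)) - v * nlen (replicate M (S, n, lam))\<bar> \<le> \<epsilon> * nlen (replicate M (S, n, lam))"
    unfolding nl by (simp add: mult_ac)
qed

lemma wsum_add: "wsum L (\<lambda>w. \<phi> w + \<psi> w) w = wsum L \<phi> w + wsum L \<psi> w"
  by (induction w) auto

text \<open>The matrix of the statistics of the types is close to the identity, so the statistics
  of mixtures separate the mixing weights.\<close>

lemma separated_mixtures:
  fixes \<rho> :: "nat \<Rightarrow> nat \<Rightarrow> real" and a b :: "nat \<Rightarrow> real"
  assumes k: "1 \<le> k" and \<rho>: "\<And>i j. i < k \<Longrightarrow> j \<le> k \<Longrightarrow> 0 \<le> \<rho> i j \<and> (if i = j then 1 - 1 / (4 * real k) \<le> \<rho> i j else \<rho> i j \<le> 1 / (4 * real k))"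
    and ab: "\<exists>i<k. 1 \<le> \<bar>a i - b i\<bar>" and tot: "(\<Sum>j\<le>k. a j) = (\<Sum>j\<le>k. b j)"
  shows "\<exists>i<k. 1 / 4 \<le> \<bar>(\<Sum>j\<le>k. a j * \<rho> i j) - (\<Sum>j\<le>k. b j * \<rho> i j)\<bar>"
proof -
  define D where "D j = a j - b j" for j
  define \<theta> where "\<theta> = 1 / (4 * real k)"
  have \<theta>: "0 < \<theta>" "k * \<theta> = 1 / 4" using k by (auto simp: \<theta>_def)
  \<comment> \<open>The row of the largest difference: off-diagonal terms then add up to at most a
    quarter of |D i|, while the diagonal gives at least half.\<close>
  obtain i where i: "i < k" "\<And>j. j < k \<Longrightarrow> \<bar>D j\<bar> \<le> \<bar>D i\<bar>"
  proof -
    have "finite ((\<lambda>j. \<bar>D j\<bar>) ` {..<k})" "(\<lambda>j. \<bar>D j\<bar>) ` {..<k} \<noteq> {}" using k by (auto simp: lessThan_empty_iff)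
    then have "Max ((\<lambda>j. \<bar>D j\<bar>) ` {..<k}) \<in> (\<lambda>j. \<bar>D j\<bar>) ` {..<k}" by (rule Max_in)
    then obtain i where "i < k" "Max ((\<lambda>j. \<bar>D j\<bar>) ` {..<k}) = \<bar>D i\<bar>" by auto
    then show ?thesis using that[of i] by (metis Max_ge finite_imageI finite_lessThan imageI lessThan_iff)
  qed
  have Di: "1 \<le> \<bar>D i\<bar>" using ab i(2) unfolding D_def by (meson order_trans)
  \<comment> \<open>Equal totals eliminate type k. The entries become differences with column k,
    which is small in every row i < k.\<close>
  have Dk: "D k = - (\<Sum>j<k. D j)"
    using tot unfolding D_def by (simp add: sum_subtractf lessThan_Suc_atMost[symmetric])
  have "(\<Sum>j\<le>k. a j * \<rho> i j) - (\<Sum>j\<le>k. b j * \<rho> i j) = (\<Sum>j\<le>k. D j * \<rho> i j)"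
    by (simp add: D_def sum_subtractf left_diff_distrib)
  also have "\<dots> = (\<Sum>j<k. D j * \<rho> i j) + D k * \<rho> i k" by (simp add: lessThan_Suc_atMost[symmetric])
  also have "\<dots> = (\<Sum>j<k. D j * (\<rho> i j - \<rho> i k))" unfolding Dk by (simp add: sum_subtractf right_diff_distrib sum_distrib_right)
  also have "\<dots> = D i * (\<rho> i i - \<rho> i k) + (\<Sum>j\<in>{..<k} - {i}. D j * (\<rho> i j - \<rho> i k))"
    using i(1) by (simp add: sum.remove[of "{..<k}" i])
  finally have eq: "(\<Sum>j\<le>k. a j * \<rho> i j) - (\<Sum>j\<le>k. b j * \<rho> i j) = D i * (\<rho> i i - \<rho> i k) + (\<Sum>j\<in>{..<k} - {i}. D j * (\<rho> i j - \<rho> i k))" .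
  have \<rho>ik: "0 \<le> \<rho> i k" "\<rho> i k \<le> \<theta>" using \<rho>[OF i(1), of k] i(1) by (auto simp: \<theta>_def)
  have "\<bar>\<Sum>j\<in>{..<k} - {i}. D j * (\<rho> i j - \<rho> i k)\<bar> \<le> (\<Sum>j\<in>{..<k} - {i}. \<bar>D i\<bar> * \<theta>)"
  proof (rule order_trans[OF sum_abs sum_mono])
    fix j assume j: "j \<in> {..<k} - {i}"
    then have "0 \<le> \<rho> i j" "\<rho> i j \<le> \<theta>" using \<rho>[OF i(1), of j] by (auto simp: \<theta>_def)
    then have "\<bar>\<rho> i j - \<rho> i k\<bar> \<le> \<theta>" using \<rho>ik by linarith
    then show "\<bar>D j * (\<rho> i j - \<rho> i k)\<bar> \<le> \<bar>D i\<bar> * \<theta>" unfolding abs_mult using i(2) j by (intro mult_mono) auto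
  qed
  also have "\<dots> \<le> k * (\<bar>D i\<bar> * \<theta>)"
  proof -
    have "card ({..<k} - {i}) \<le> k" using card_mono[of "{..<k}" "{..<k} - {i}"] by simp
    then show ?thesis using \<theta>(1) by (simp add: mult_right_mono)
  qed
  also have "\<dots> = \<bar>D i\<bar> * (1 / 4)" using \<theta>(2) by (metis mult.left_commute)
  finally have 1: "\<bar>\<Sum>j\<in>{..<k} - {i}. D j * (\<rho> i j - \<rho> i k)\<bar> \<le> \<bar>D i\<bar> * (1 / 4)" .
  have "1 / 2 \<le> \<rho> i i - \<rho> i k"
  proof -
    have "1 - \<theta> \<le> \<rho> i i" using \<rho>[OF i(1), of i] i(1) by (auto simp: \<theta>_def)
    moreover have "\<theta> \<le> 1 / 4" using k by (auto simp: \<theta>_def field_simps)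
    ultimately show ?thesis using \<rho>ik by linarith
  qed
  then have "\<bar>D i\<bar> * (1 / 2) \<le> \<bar>D i * (\<rho> i i - \<rho> i k)\<bar>" unfolding abs_mult by (intro mult_left_mono) auto
  then have "1 / 4 \<le> \<bar>(\<Sum>j\<le>k. a j * \<rho> i j) - (\<Sum>j\<le>k. b j * \<rho> i j)\<bar>" unfolding eq using 1 Di by linarith
  then show ?thesis using i(1) by blast
qed

context spec_shift
begin

text \<open>A cycle spends d parts on the main family \<open>W\<close> and one part on the types in
  proportions \<open>wt a\<close>, so its average is (d b + mixture) / (d + 1). Since b and the
  total weight do not depend on \<open>a\<close>, two cycles differ only by their mixtures, and
  \<zeta> involves k and d but not M.\<close>

lemma cycles_exist:
  fixes F :: "nat list \<Rightarrow> real" and \<gamma> P \<kappa> B \<nu> :: real and M :: nat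
  assumes F: "almost_additive \<kappa> B F" and \<gamma>: "0 < \<gamma>"
    and P: "\<forall>\<^sub>F N in sequentially. exp (N * (P - \<gamma>)) \<le> (\<Sum>w\<in>lang_n X N. exp (F w))"
    and k: "1 \<le> k" and L: "1 \<le> L" and M: "1 \<le> M"
    and disj: "\<And>i j. i \<le> k \<Longrightarrow> j \<le> k \<Longrightarrow> i \<noteq> j \<Longrightarrow> D i \<inter> D j = {}"
    and types: "\<And>j (\<theta> :: real) n0. j \<le> k \<Longrightarrow> 0 < \<theta> \<Longrightarrow> \<exists>P\<in>G. n0 \<le> length P \<and> (1 - \<theta>) * length P \<le> wsum L (indicat_real (D j)) P"
    and d: "(B + \<bar>P - 8 * \<gamma>\<bar>) \<le> real d * \<gamma>" and \<zeta>: "\<zeta> = 1 / (4 * real k * (real d + 1))"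
  shows "\<exists>(v :: (nat \<Rightarrow> nat) \<Rightarrow> nat \<Rightarrow> real) C.
     (\<forall>a\<in>{..<k} \<rightarrow>\<^sub>E {..M}. \<forall>b\<in>{..<k} \<rightarrow>\<^sub>E {..M}. a \<noteq> b \<longrightarrow> (\<exists>i<k. \<zeta> / M \<le> \<bar>v a i - v b i\<bar>)) \<and>
     (\<forall>a\<in>{..<k} \<rightarrow>\<^sub>E {..M}. C a \<noteq> [] \<and> energy_ok (P - 8 * \<gamma>) (C a) \<and>
        (\<forall>x\<in>set (C a). finite (fst x) \<and> fst x \<noteq> {} \<and> fst x \<subseteq> G \<and> \<nu> \<le> real (fst (snd x)) \<and>
           (\<forall>w\<in>fst x. length w = fst (snd x) \<and> snd (snd x) \<le> F w)) \<and>
        (\<forall>i<k. \<bar>v a i\<bar> \<le> 2 \<and> cycle_stat (wsum L (indicat_real (D i))) (v a i) (\<zeta> / M / 32) (C a)))"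
proof -
  note FD = almost_additiveD[OF F]
  let ?\<Psi> = "\<lambda>i. wsum L (indicat_real (D i))"
  define n0 where "n0 = nat \<lceil>\<nu>\<rceil>"
  have n0: "\<nu> \<le> real n" if "n0 \<le> n" for n using that unfolding n0_def by linarith
  define \<theta> where "\<theta> = 1 / (4 * real k)"
  have \<theta>: "0 < \<theta>" using k by (simp add: \<theta>_def)
  have \<Psi>01: "0 \<le> ?\<Psi> i w \<and> ?\<Psi> i w \<le> length w" for i w
  proof -
    have "\<bar>?\<Psi> i w\<bar> \<le> 1 * real (length w)" by (rule wsum_bound) (simp add: indicator_def)
    moreover have "0 \<le> ?\<Psi> i w" by (rule wsum_nonneg) simp
    ultimately show ?thesis by simp
  qed
  define \<eta> where "\<eta> = \<zeta> / M / 32"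
  have \<zeta>0: "0 < \<zeta>" "\<zeta> \<le> 1"
  proof -
    have "1 * 1 \<le> (4 * real k) * (real d + 1)" using k by (intro mult_mono) auto
    then show "0 < \<zeta>" "\<zeta> \<le> 1" unfolding \<zeta> by (auto simp: divide_le_eq_1)
  qed
  have \<eta>: "0 < \<eta>" "\<eta> \<le> 1"
  proof -
    show "0 < \<eta>" using \<zeta>0 M by (simp add: \<eta>_def)
    have "\<zeta> / M \<le> 1 / 1" using \<zeta>0 M by (intro frac_le) auto
    then show "\<eta> \<le> 1" by (simp add: \<eta>_def)
  qed
  have "\<exists>Q. \<forall>j. j \<le> k \<longrightarrow> Q j \<in> G \<and> n0 \<le> length (Q j) \<and> (1 - \<theta>) * length (Q j) \<le> ?\<Psi> j (Q j)"
  proof (rule choice, rule allI)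
    fix j
    show "\<exists>q. j \<le> k \<longrightarrow> q \<in> G \<and> n0 \<le> length q \<and> (1 - \<theta>) * length q \<le> ?\<Psi> j q"
      using types[OF _ \<theta>, of j n0] by blast
  qed
  then obtain Q where Q: "\<And>j. j \<le> k \<Longrightarrow> Q j \<in> G" "\<And>j. j \<le> k \<Longrightarrow> n0 \<le> length (Q j)"
    "\<And>j. j \<le> k \<Longrightarrow> (1 - \<theta>) * length (Q j) \<le> ?\<Psi> j (Q j)" by blast
  define p where "p j = length (Q j)" for j
  have p: "1 \<le> p j" if "j \<le> k" for j using G_length[OF Q(1)[OF that]] by (simp add: p_def)
  have p0: "0 < real (length (Q j))" if "j \<le> k" for j using G_length[OF Q(1)[OF that]] by linarith
  \<comment> \<open>A common multiple of the lengths of the types: with multiplicities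
    \<open>q j\<close> each type fills exactly \<open>wt a j * pp * n\<close> letters, whatever its
    own length.\<close>
  define pp where "pp = (\<Prod>j\<le>k. p j)"
  have pp: "1 \<le> pp" unfolding pp_def using p by (intro prod_ge_1) auto
  define q where "q j = pp div p j" for j
  have qp: "q j * p j = pp" if "j \<le> k" for j
  proof -
    have "p j dvd pp" unfolding pp_def by (rule dvd_prodI) (use that in auto)
    then show ?thesis by (simp add: q_def)
  qed
  obtain n W lam b where W: "n0 \<le> n" "finite W" "W \<noteq> {}" "W \<subseteq> G"
     "\<And>w. w \<in> W \<Longrightarrow> length w = n \<and> lam \<le> F w \<and> (\<forall>i<k. \<bar>?\<Psi> i w - b i * n\<bar> \<le> \<eta> * n)"
     "(P - 6 * \<gamma>) * n \<le> ln (card W) + lam"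
    using main_family[OF F \<gamma> \<eta>(1) P, of k ?\<Psi> n0] \<Psi>01 by metis
  obtain w0 where w0: "w0 \<in> W" using W(3) by blast
  have n: "1 \<le> n" using W(5)[OF w0] G_length[of w0] W(4) w0 by auto
  have b2: "\<bar>b i\<bar> \<le> 2" if i: "i < k" for i
  proof -
    have "\<bar>?\<Psi> i w0 - b i * n\<bar> \<le> 1 * n" using W(5)[OF w0] i \<eta>(2) mult_right_mono[OF \<eta>(2), of "real n"] by fastforce
    moreover have "\<bar>?\<Psi> i w0\<bar> \<le> n" using \<Psi>01[of i w0] W(5)[OF w0] by simp
    ultimately have "\<bar>b i * n\<bar> \<le> 2 * n" by linarith
    then have "\<bar>b i\<bar> * n \<le> 2 * n" by (simp add: abs_mult)
    then show ?thesis using n by simp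
  qed
  define \<rho> where "\<rho> i j = ?\<Psi> i (Q j) / p j" for i j
  have \<rho>01: "0 \<le> \<rho> i j" "\<rho> i j \<le> 1" if "j \<le> k" for i j
    using \<Psi>01[of i "Q j"] p[OF that] by (auto simp: \<rho>_def p_def divide_le_eq_1)
  have \<rho>: "0 \<le> \<rho> i j \<and> (if i = j then 1 - 1 / (4 * real k) \<le> \<rho> i j else \<rho> i j \<le> 1 / (4 * real k))" if ij: "i < k" "j \<le> k" for i j
  proof (cases "i = j")
    case True
    have "1 - \<theta> \<le> \<rho> j j" unfolding \<rho>_def p_def pos_le_divide_eq[OF p0[OF ij(2)]] by (rule Q(3)[OF ij(2)])
    then show ?thesis using True \<rho>01[OF ij(2)] by (simp add: \<theta>_def)
  next
    case False
    have "?\<Psi> i (Q j) + ?\<Psi> j (Q j) = wsum L (\<lambda>w. indicat_real (D i) w + indicat_real (D j) w) (Q j)" by (rule wsum_add[symmetric])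
    also have "\<dots> \<le> 1 * real (length (Q j))"
    proof (rule order_trans[OF abs_ge_self wsum_bound])
      fix w
      show "\<bar>indicat_real (D i) w + indicat_real (D j) w\<bar> \<le> 1" using disj[of i j] ij False by (auto simp: indicator_def)
    qed
    finally have "?\<Psi> i (Q j) \<le> \<theta> * p j" using Q(3)[OF ij(2)] by (simp add: p_def algebra_simps)
    then have "\<rho> i j \<le> \<theta>" unfolding \<rho>_def p_def pos_divide_le_eq[OF p0[OF ij(2)]] .
    then show ?thesis using False \<rho>01[OF ij(2)] by (simp add: \<theta>_def)
  qed
  \<comment> \<open>The last type fills up to the total k M, which makes the total independent of
    \<open>a\<close>. The subtraction does not truncate, since each of the k grid entries is at most
    M.\<close>
  define wt where "wt a j = (if j < k then a j else k * M - (\<Sum>j<k. a j))" for a :: "nat \<Rightarrow> nat" and j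
  have wt_sum: "(\<Sum>j\<le>k. wt a j) = k * M" if a: "a \<in> {..<k} \<rightarrow>\<^sub>E {..M}" for a
  proof -
    have "(\<Sum>j<k. a j) \<le> (\<Sum>j<k. M)" by (rule sum_mono) (use a in auto)
    then have "(\<Sum>j<k. a j) \<le> k * M" by simp
    then show ?thesis by (simp add: lessThan_Suc_atMost[symmetric] wt_def)
  qed
  define xs where "xs = replicate (d * (k * M) * pp) (W, n, lam)"
  \<comment> \<open>A single word offers no choice, and \<open>- B * p j\<close> is the trivial
    lower bound of its weight.\<close>
  define part where "part a j = replicate (wt a j * q j * n) ({Q j}, p j, - B * p j)" for a j
  define ys where "ys a = concat (map (part a) [0..<Suc k])" for a
  define C where "C a = xs @ ys a" for a
  define v where "v a i = (real d * b i + (\<Sum>j\<le>k. wt a j * \<rho> i j) / real (k * M)) / (real d + 1)" for a i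
  have nlen_rep: "nlen (replicate r (S, t, lm)) = r * t" for r S t and lm :: real by (induction r) auto
  have nlen_xs: "nlen xs = d * (k * M) * pp * n" by (simp add: xs_def nlen_rep)
  have nlen_part: "nlen (part a j) = wt a j * (pp * n)" if "j \<le> k" for a j
    using qp[OF that] by (simp add: part_def nlen_rep mult_ac)
  have nlen_ys_gen: "nlen (concat (map (part a) [0..<r])) = (\<Sum>j<r. wt a j) * (pp * n)" if "r \<le> Suc k" for a r
    using that by (induction r) (auto simp: nlen_part algebra_simps)
  have nlen_ys: "nlen (ys a) = (k * M) * (pp * n)" if a: "a \<in> {..<k} \<rightarrow>\<^sub>E {..M}" for a
    unfolding ys_def using nlen_ys_gen[of "Suc k" a] wt_sum[OF a] by (simp only: lessThan_Suc_atMost order_refl)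
  have kM: "0 < k * M" using k M by simp
  have stat_xs: "cycle_stat (?\<Psi> i) (b i) \<eta> xs" if "i < k" for i
    unfolding xs_def by (rule cycle_stat_replicate) (use W(5) that in blast)
  \<comment> \<open>The types are appended one by one. The \<open>if\<close> gives average 0 to an
    initial part of total weight 0.\<close>
  have stat_ys: "cycle_stat (?\<Psi> i) (if nlen (concat (map (part a) [0..<r])) = 0 then 0 else (\<Sum>j<r. wt a j * \<rho> i j) / real (\<Sum>j<r. wt a j)) 0 (concat (map (part a) [0..<r]))"
    if r: "r \<le> Suc k" for a i r
    using r
  proof (induction r)
    case 0
    then show ?case by (simp add: cycle_stat_def)
  next
    case (Suc r)
    have r: "r \<le> k" using Suc(2) by simp
    have pn: "0 < pp * n" using pp n by simp
    have st: "cycle_stat (?\<Psi> i) (\<rho> i r) 0 (part a r)"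
      unfolding part_def by (rule cycle_stat_replicate) (use p[OF r] in \<open>simp add: \<rho>_def\<close>)
    have eq: "concat (map (part a) [0..<Suc r]) = concat (map (part a) [0..<r]) @ part a r" by simp
    have n1: "nlen (concat (map (part a) [0..<r])) = (\<Sum>j<r. wt a j) * (pp * n)" by (rule nlen_ys_gen) (use r in simp)
    have n2: "nlen (part a r) = wt a r * (pp * n)" by (rule nlen_part[OF r])
    have n3: "nlen (concat (map (part a) [0..<Suc r])) = (\<Sum>j<Suc r. wt a j) * (pp * n)" by (rule nlen_ys_gen) (use r in simp)
      let ?s = "\<Sum>j<r. wt a j" and ?t = "\<Sum>j<r. wt a j * \<rho> i j"
      have h: "(if s * c = 0 then 0 else t / real s) * real (s * c) = t * real c" if "s = 0 \<Longrightarrow> t = 0" "0 < c" for s c :: nat and t :: real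
        by (cases "s = 0") (use that in auto)
      have z: "?t = 0" if "?s = 0"
      proof -
        have "\<forall>j<r. wt a j = 0" using that by simp
        then show ?thesis by (intro sum.neutral) auto
      qed
      have A: "(if ?s * (pp * n) = 0 then 0 else ?t / real ?s) * real (?s * (pp * n)) = ?t * real (pp * n)"
        by (rule h[OF z pn])
      have B: "(if (?s + wt a r) * (pp * n) = 0 then 0 else (?t + wt a r * \<rho> i r) / real (?s + wt a r)) * real ((?s + wt a r) * (pp * n)) = (?t + wt a r * \<rho> i r) * real (pp * n)"
        by (rule h[OF _ pn]) (use z in simp)
      have V: "(if nlen (concat (map (part a) [0..<r])) = 0 then 0 else ?t / real ?s) * real (nlen (concat (map (part a) [0..<r]))) + \<rho> i r * real (nlen (part a r)) =
        (if nlen (concat (map (part a) [0..<r]) @ part a r) = 0 then 0 else (\<Sum>j<Suc r. wt a j * \<rho> i j) / real (\<Sum>j<Suc r. wt a j)) * real (nlen (concat (map (part a) [0..<r]) @ part a r))"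
        using n3 unfolding eq n1 n2 A by (simp only: sum.lessThan_Suc B) (simp add: algebra_simps)
      have fin: "cycle_stat (?\<Psi> i) (if nlen (concat (map (part a) [0..<r]) @ part a r) = 0 then 0 else (\<Sum>j<Suc r. wt a j * \<rho> i j) / real (\<Sum>j<Suc r. wt a j)) 0 (concat (map (part a) [0..<r]) @ part a r)"
        by (rule cycle_stat_append[OF Suc(1) st V]) (use r in simp_all)
      show ?case unfolding eq by (rule fin)
  qed
  have stat: "cycle_stat (?\<Psi> i) (v a i) \<eta> (C a)" if a: "a \<in> {..<k} \<rightarrow>\<^sub>E {..M}" and i: "i < k" for a i
  proof -
    have ny: "nlen (ys a) = (k * M) * (pp * n)" by (rule nlen_ys[OF a])
    have ny0: "nlen (ys a) \<noteq> 0" unfolding ny using kM pp n by simp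
    have ws: "real (\<Sum>j<Suc k. wt a j) = real (k * M)" using wt_sum[OF a] by (simp only: lessThan_Suc_atMost)
    have sy: "cycle_stat (?\<Psi> i) ((\<Sum>j\<le>k. wt a j * \<rho> i j) / real (k * M)) 0 (ys a)"
      using stat_ys[of "Suc k" i a] ny0 ws unfolding ys_def[symmetric] by (simp only: lessThan_Suc_atMost if_False order_refl)
    show ?thesis unfolding C_def
    proof (rule cycle_stat_append[OF stat_xs[OF i] sy])
      have N: "real (nlen (xs @ ys a)) = (real d + 1) * (real (k * M) * real (pp * n))"
        unfolding nlen_simps ny nlen_xs by (simp add: algebra_simps)
      have Nx: "real (nlen xs) = real d * (real (k * M) * real (pp * n))" unfolding nlen_xs by (simp add: algebra_simps)
      have Ny: "real (nlen (ys a)) = real (k * M) * real (pp * n)" unfolding ny by simp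
      show "b i * real (nlen xs) + (\<Sum>j\<le>k. wt a j * \<rho> i j) / real (k * M) * real (nlen (ys a)) = v a i * real (nlen (xs @ ys a))"
        unfolding N Nx Ny v_def by (simp add: field_simps)
      have "\<eta> * real (nlen xs) \<le> \<eta> * real (nlen (xs @ ys a))" using \<eta>(1) by (intro mult_left_mono) auto
      then show "\<eta> * real (nlen xs) + 0 * real (nlen (ys a)) \<le> \<eta> * real (nlen (xs @ ys a))" by simp
    qed
  qed
  have v2: "\<bar>v a i\<bar> \<le> 2" if a: "a \<in> {..<k} \<rightarrow>\<^sub>E {..M}" and i: "i < k" for a i
  proof -
    have "(\<Sum>j\<le>k. wt a j * \<rho> i j) \<le> (\<Sum>j\<le>k. real (wt a j) * 1)"
      using \<rho>01 by (intro sum_mono mult_left_mono) auto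
    also have "\<dots> = real (k * M)" using wt_sum[OF a] by (simp flip: of_nat_sum)
    finally have 1: "(\<Sum>j\<le>k. wt a j * \<rho> i j) / real (k * M) \<le> 1" using kM by (simp add: divide_le_eq_1)
    have 2: "0 \<le> (\<Sum>j\<le>k. wt a j * \<rho> i j) / real (k * M)" using \<rho>01 by (intro divide_nonneg_nonneg sum_nonneg mult_nonneg_nonneg) auto
    have "\<bar>real d * b i\<bar> \<le> real d * 2" unfolding abs_mult using b2[OF i] by (intro mult_mono) auto
    moreover have "\<bar>x + y\<bar> \<le> 2 * (c + 1)" if "\<bar>x\<bar> \<le> c * 2" "0 \<le> y" "y \<le> 1" for x y c :: real
      using that by (simp add: abs_le_iff)
    ultimately have "\<bar>real d * b i + (\<Sum>j\<le>k. wt a j * \<rho> i j) / real (k * M)\<bar> \<le> 2 * (real d + 1)" using 1 2 by blast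
    then show ?thesis unfolding v_def by (simp add: abs_divide divide_le_eq)
  qed
  have sep: "\<exists>i<k. \<zeta> / M \<le> \<bar>v a i - v a' i\<bar>" if a: "a \<in> {..<k} \<rightarrow>\<^sub>E {..M}" "a' \<in> {..<k} \<rightarrow>\<^sub>E {..M}" "a \<noteq> a'" for a a'
  proof -
    have "\<exists>i<k. a i \<noteq> a' i"
    proof (rule ccontr)
      assume "\<not> ?thesis"
      then have "a = a'" using a(1,2) by (intro PiE_ext) auto
      then show False using a(3) by simp
    qed
    then obtain i0 where i0: "i0 < k" "a i0 \<noteq> a' i0" by blast
    then have "1 \<le> \<bar>real (wt a i0) - real (wt a' i0)\<bar>" by (auto simp: wt_def)
    then have ex: "\<exists>i<k. 1 \<le> \<bar>real (wt a i) - real (wt a' i)\<bar>" using i0(1) by blast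
    have "(\<Sum>j\<le>k. real (wt a j)) = (\<Sum>j\<le>k. real (wt a' j))"
      unfolding of_nat_sum[symmetric] wt_sum[OF a(1)] wt_sum[OF a(2)] ..
    from separated_mixtures[OF k \<rho> ex this] obtain i where i: "i < k"
      "1 / 4 \<le> \<bar>(\<Sum>j\<le>k. wt a j * \<rho> i j) - (\<Sum>j\<le>k. wt a' j * \<rho> i j)\<bar>" by blast
    have "v a i - v a' i = ((\<Sum>j\<le>k. wt a j * \<rho> i j) - (\<Sum>j\<le>k. wt a' j * \<rho> i j)) / (real (k * M) * (real d + 1))"
      unfolding v_def by (simp add: diff_divide_distrib add_divide_distrib)
    then have "\<bar>v a i - v a' i\<bar> = \<bar>(\<Sum>j\<le>k. wt a j * \<rho> i j) - (\<Sum>j\<le>k. wt a' j * \<rho> i j)\<bar> / (real (k * M) * (real d + 1))"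
      by (simp add: abs_divide abs_mult)
    moreover have "(1 / 4) / (real (k * M) * (real d + 1)) \<le> \<bar>(\<Sum>j\<le>k. wt a j * \<rho> i j) - (\<Sum>j\<le>k. wt a' j * \<rho> i j)\<bar> / (real (k * M) * (real d + 1))"
      by (rule divide_right_mono[OF i(2)]) simp
    moreover have "\<zeta> / M = (1 / 4) / (real (k * M) * (real d + 1))" unfolding \<zeta> by (simp add: mult_ac)
    ultimately show ?thesis using i(1) by auto
  qed
  have ysD: "\<exists>j. j \<le> k \<and> x = ({Q j}, p j, - B * p j)" if x: "x \<in> set (ys a)" for x a
  proof -
    obtain j where j: "j \<in> set [0..<Suc k]" "x \<in> set (part a j)"
      using x unfolding ys_def set_concat set_map by blast
    have "x = ({Q j}, p j, - B * p j)" using j(2) unfolding part_def in_set_replicate by blast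
    moreover have "j \<le> k" using j(1) unfolding set_upt by simp
    ultimately show ?thesis by blast
  qed
  have energy: "energy_ok (P - 8 * \<gamma>) (C a)" if a: "a \<in> {..<k} \<rightarrow>\<^sub>E {..M}" for a
    unfolding C_def
  proof (rule energy_okI)
    \<comment> \<open>The family has exponent P - 6 \<gamma>, so at P - 8 \<gamma> each of its slots
      has a surplus of 2 \<gamma> n; half of it already pays for the types, by the choice of
      d.\<close>
    have en: "2 * \<gamma> * n \<le> slot_energy (P - 8 * \<gamma>) (W, n, lam)"
      using W(6) by (simp add: slot_energy_def algebra_simps)
    have "0 \<le> 2 * \<gamma> * n" using \<gamma> by simp
    then show "0 \<le> slot_energy (P - 8 * \<gamma>) x" if "x \<in> set xs" for x
      using that en unfolding xs_def by (auto split: if_splits)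
    let ?c = "B + \<bar>P - 8 * \<gamma>\<bar>"
    show c0: "0 \<le> ?c" using FD(4) by simp
    show "- ?c * real (fst (snd x)) \<le> slot_energy (P - 8 * \<gamma>) x" if xa: "x \<in> set (ys a)" for x
    proof -
      obtain j where j: "j \<le> k" "x = ({Q j}, p j, - B * p j)" using ysD[OF xa] by blast
      have "(P - 8 * \<gamma>) * p j \<le> \<bar>P - 8 * \<gamma>\<bar> * p j" by (intro mult_right_mono) auto
      then show ?thesis unfolding j(2) slot_energy_def by (simp add: algebra_simps)
    qed
    have "?c * real (nlen (ys a)) \<le> (real d * \<gamma>) * real (nlen (ys a))" using d by (intro mult_right_mono) auto
    also have "\<dots> = real (d * (k * M) * pp) * (\<gamma> * n)" unfolding nlen_ys[OF a] by simp
    also have "\<dots> \<le> real (d * (k * M) * pp) * slot_energy (P - 8 * \<gamma>) (W, n, lam)"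
    proof (rule mult_left_mono)
      have "\<gamma> * n \<le> 2 * \<gamma> * n" using \<gamma> by simp
      then show "\<gamma> * n \<le> slot_energy (P - 8 * \<gamma>) (W, n, lam)" using en by linarith
    qed simp
    also have "\<dots> = sum_list (map (slot_energy (P - 8 * \<gamma>)) xs)"
      by (simp add: xs_def sum_list_replicate)
    finally show "?c * real (nlen (ys a)) \<le> sum_list (map (slot_energy (P - 8 * \<gamma>)) xs)" .
  qed
  have slots: "finite (fst x) \<and> fst x \<noteq> {} \<and> fst x \<subseteq> G \<and> \<nu> \<le> real (fst (snd x)) \<and>
           (\<forall>w\<in>fst x. length w = fst (snd x) \<and> snd (snd x) \<le> F w)" if x: "x \<in> set (C a)" for x a
  proof -
    consider "x = (W, n, lam)" | j where "j \<le> k" "x = ({Q j}, p j, - B * p j)"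
    proof -
      assume thesis: "x = (W, n, lam) \<Longrightarrow> thesis" "\<And>j. j \<le> k \<Longrightarrow> x = ({Q j}, p j, - B * p j) \<Longrightarrow> thesis"
      have "x \<in> set xs \<or> x \<in> set (ys a)" using x by (simp add: C_def)
      then show thesis
      proof
        assume "x \<in> set xs"
        then show thesis using thesis(1) unfolding xs_def in_set_replicate by blast
      next
        assume "x \<in> set (ys a)"
        then show thesis using thesis(2) ysD by blast
      qed
    qed
    then show ?thesis
    proof cases
      case 1
      then show ?thesis using W(2,3,4,5) n0[OF W(1)] by auto
    next
      case (2 j)
      have "- B * p j \<le> F (Q j)" using FD(2)[of "Q j"] by (simp add: p_def abs_le_iff)
      then show ?thesis using 2 Q(1)[OF 2(1)] n0[OF Q(2)[OF 2(1)]] by (simp add: p_def)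
    qed
  qed
  have ne: "C a \<noteq> []" if a: "a \<in> {..<k} \<rightarrow>\<^sub>E {..M}" for a
  proof
    assume "C a = []"
    then have "nlen (ys a) = 0" by (simp add: C_def)
    then show False unfolding nlen_ys[OF a] using kM pp n by simp
  qed
  show ?thesis
    by (rule exI[of _ v], rule exI[of _ C]) (use sep ne energy slots v2 stat in \<open>simp only: \<eta>_def[symmetric]; blast\<close>)
qed

end

section \<open>Points with high emergence carry full pressure\<close>

context potential
begin

lemma PP_M_subset: "Z \<subseteq> Z' \<Longrightarrow> PP_M X f Z s N \<le> PP_M X f Z' s N"
  unfolding PP_M_def by (rule INF_superset_mono) auto

text \<open>The loss \<gamma> consists of \<gamma>/4 for the limit, \<gamma>/2 for approximating
  \<open>f\<close> and \<gamma>/4 for the incomplete windows at the end.\<close>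

lemma weight_sum_lower:
  assumes \<gamma>: "0 < \<gamma>" and \<psi>: "\<And>x. x \<in> X \<Longrightarrow> \<bar>f x - \<psi> (pre l x)\<bar> \<le> \<gamma> / 2"
  shows "\<forall>\<^sub>F N in sequentially. exp (N * (P_top X f - \<gamma>)) \<le> (\<Sum>w\<in>lang_n X N. exp (wsum l \<psi> w))"
proof -
  have fB0: "0 \<le> fB" using fB(1) by simp
  have "P_top X f - \<gamma> / 4 < P_top X f" using \<gamma> by simp
  then have ev: "\<forall>\<^sub>F N in sequentially. P_top X f - \<gamma> / 4 < ln (Zn N) / N" by (rule order_tendstoD(1)[OF P_top_lim])
  obtain N0 :: nat where N0: "fB * l / (\<gamma> / 4) \<le> N0" using real_arch_simple by blast
  have "\<forall>\<^sub>F N in sequentially. P_top X f - \<gamma> / 4 < ln (Zn N) / N \<and> N0 + 1 \<le> N"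
    using ev eventually_ge_at_top[of "N0 + 1"] by eventually_elim auto
  then show ?thesis
  proof eventually_elim
    case (elim N)
    have "fB * l / (\<gamma> / 4) \<le> N" using N0 elim by linarith
    then have lN: "fB * l \<le> \<gamma> / 4 * N" using \<gamma> by (simp add: field_simps)
    have "0 < real N" using elim by simp
    then have "(P_top X f - \<gamma> / 4) * N < ln (Zn N)" using elim pos_less_divide_eq by blast
    then have "exp ((P_top X f - \<gamma> / 4) * N) < exp (ln (Zn N))" by simp
    then have 1: "exp ((P_top X f - \<gamma> / 4) * N) \<le> Zn N" using Zn_pos by simp
    have "Zn N \<le> (\<Sum>w\<in>lang_n X N. exp (N * (\<gamma> / 2) + fB * l) * exp (wsum l \<psi> w))"
      unfolding Zn_def
    proof (rule sum_mono)
      fix w assume w: "w \<in> lang_n X N"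
      have "sbirk w \<le> N * (\<gamma> / 2) + fB * l + wsum l \<psi> w"
      proof (rule sbirk_le[OF w])
        fix x assume x: "x \<in> X" "pre N x = w"
        have "\<bar>birk f N x - wsum l \<psi> (pre N x)\<bar> \<le> N * (\<gamma> / 2) + fB * l"
          by (rule birk_wsum) (use \<psi> fB(2) fB0 shift_in[OF x(1)] \<gamma> in auto)
        then show "birk f N x \<le> N * (\<gamma> / 2) + fB * l + wsum l \<psi> w" using x(2) by (simp add: abs_le_iff)
      qed
      then show "exp (sbirk w) \<le> exp (N * (\<gamma> / 2) + fB * l) * exp (wsum l \<psi> w)" by (simp flip: exp_add)
    qed
    also have "\<dots> = exp (N * (\<gamma> / 2) + fB * l) * (\<Sum>w\<in>lang_n X N. exp (wsum l \<psi> w))" by (simp add: sum_distrib_left)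
    finally have "exp ((P_top X f - \<gamma> / 4) * N) \<le> exp (N * (\<gamma> / 2) + fB * l) * (\<Sum>w\<in>lang_n X N. exp (wsum l \<psi> w))" using 1 by linarith
    then have "exp (- (N * (\<gamma> / 2) + fB * l)) * exp ((P_top X f - \<gamma> / 4) * N) \<le> exp (- (N * (\<gamma> / 2) + fB * l)) * (exp (N * (\<gamma> / 2) + fB * l) * (\<Sum>w\<in>lang_n X N. exp (wsum l \<psi> w)))"
      by (rule mult_left_mono) simp
    also have "\<dots> = (\<Sum>w\<in>lang_n X N. exp (wsum l \<psi> w))" by (simp add: mult.assoc[symmetric] flip: exp_add)
    finally have "exp (- (N * (\<gamma> / 2) + fB * l) + (P_top X f - \<gamma> / 4) * N) \<le> (\<Sum>w\<in>lang_n X N. exp (wsum l \<psi> w))" by (simp only: exp_add)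
    moreover have "N * (P_top X f - \<gamma>) \<le> - (N * (\<gamma> / 2) + fB * l) + (P_top X f - \<gamma> / 4) * N"
      using lN by (simp add: algebra_simps)
    then have "exp (N * (P_top X f - \<gamma>)) \<le> exp (- (N * (\<gamma> / 2) + fB * l) + (P_top X f - \<gamma> / 4) * N)" by simp
    ultimately show ?case by linarith
  qed
qed

end

text \<open>One set of points must serve every k and M at once, so the stages run through all
  triples (k, M, a) and return to each infinitely often.\<close>

lemma (in spec_shift) high_emergence_mass:
  assumes pos: pos_entropy and s: "s < P_top X f"
  shows "\<exists>N. 0 < PP_M X f (high_emergence X) s N"
proof -
  define P where "P = P_top X f"
  \<comment> \<open>Twelve shares: eight are lost in the cycles and four in the mass
    estimate.\<close>
  define \<gamma> where "\<gamma> = (P - s) / 12"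
  have \<gamma>: "0 < \<gamma>" "s + 4 * \<gamma> = P - 8 * \<gamma>" using s by (auto simp: \<gamma>_def P_def field_simps)
  obtain l \<psi> where \<psi>: "\<And>w. \<bar>\<psi> w\<bar> \<le> fB" "\<And>x. x \<in> X \<Longrightarrow> \<bar>f x - \<psi> (pre l x)\<bar> \<le> \<gamma> / 2"
    using local_approx[of "\<gamma> / 2"] \<gamma>(1) by auto
  let ?F = "wsum l \<psi>"
  have F: "almost_additive (fB * l) fB ?F" by (rule almost_additive_wsum) (rule \<psi>(1))
  have PF: "\<forall>\<^sub>F N in sequentially. exp (N * (P - \<gamma>)) \<le> (\<Sum>w\<in>lang_n X N. exp (?F w))"
    unfolding P_def by (rule weight_sum_lower[OF \<gamma>(1) \<psi>(2)])
  define d where "d = nat \<lceil>(fB + \<bar>P - 8 * \<gamma>\<bar>) / \<gamma>\<rceil>"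
  have d: "fB + \<bar>P - 8 * \<gamma>\<bar> \<le> real d * \<gamma>"
  proof -
    have "(fB + \<bar>P - 8 * \<gamma>\<bar>) / \<gamma> \<le> d" unfolding d_def by linarith
    then show ?thesis using \<gamma>(1) by (simp add: pos_divide_le_eq)
  qed
  define K0 where "K0 = ln (real \<tau> + 1) + 2 * (fB * l) + fB * \<tau> + (\<bar>s\<bar> + \<gamma> + fB) * \<tau>"
  have "\<forall>k :: nat. \<exists>L D. 1 \<le> L \<and> (\<forall>i\<le>k. \<forall>j\<le>k. i \<noteq> j \<longrightarrow> D i \<inter> D j = {}) \<and>
    (\<forall>j\<le>k. \<forall>\<theta>>0 :: real. \<forall>n0. \<exists>P\<in>G. n0 \<le> length P \<and> (1 - \<theta>) * length P \<le> wsum L (indicat_real (D j)) P)"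
    by (intro allI singular_types[OF pos])
  from choice[OF this] obtain L where "\<forall>k :: nat. \<exists>D. 1 \<le> L k \<and> (\<forall>i\<le>k. \<forall>j\<le>k. i \<noteq> j \<longrightarrow> D i \<inter> D j = {}) \<and>
    (\<forall>j\<le>k. \<forall>\<theta>>0 :: real. \<forall>n0. \<exists>P\<in>G. n0 \<le> length P \<and> (1 - \<theta>) * length P \<le> wsum (L k) (indicat_real (D j)) P)"
    ..
  from choice[OF this] obtain D where LD: "\<forall>k :: nat. 1 \<le> L k \<and> (\<forall>i\<le>k. \<forall>j\<le>k. i \<noteq> j \<longrightarrow> D k i \<inter> D k j = {}) \<and>
    (\<forall>j\<le>k. \<forall>\<theta>>0 :: real. \<forall>n0. \<exists>P\<in>G. n0 \<le> length P \<and> (1 - \<theta>) * length P \<le> wsum (L k) (indicat_real (D k j)) P)"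
    ..
  have L: "\<And>k. 1 \<le> L k" and disj: "\<And>(k :: nat) i j. i \<le> k \<Longrightarrow> j \<le> k \<Longrightarrow> i \<noteq> j \<Longrightarrow> D k i \<inter> D k j = {}"
    and types: "\<And>(k :: nat) j (\<theta> :: real) n0. j \<le> k \<Longrightarrow> 0 < \<theta> \<Longrightarrow> \<exists>P\<in>G. n0 \<le> length P \<and> (1 - \<theta>) * length P \<le> wsum (L k) (indicat_real (D k j)) P"
    using LD by simp_all
  define \<zeta> where "\<zeta> k = 1 / (4 * real k * (real d + 1))" for k :: nat
  have \<zeta>: "0 < \<zeta> k" if "1 \<le> k" for k using that by (simp add: \<zeta>_def)
  \<comment> \<open>Least slot lengths: K0/\<gamma> is what the mass estimate needs to pay for gaps
    and parses, and the last term makes the gap error of the statistics at most \<zeta> / (32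
    M).\<close>
  define \<nu> where "\<nu> k M = max 1 (max (K0 / \<gamma>) ((2 * real (L k) + 3 * \<tau>) * (32 * real M / \<zeta> k)))" for k M
  define good where "good k M v C \<longleftrightarrow>
     (\<forall>a\<in>{..<k} \<rightarrow>\<^sub>E {..M}. \<forall>b\<in>{..<k} \<rightarrow>\<^sub>E {..M}. a \<noteq> b \<longrightarrow> (\<exists>i<k. \<zeta> k / M \<le> \<bar>v a i - v b i\<bar>)) \<and>
     (\<forall>a\<in>{..<k} \<rightarrow>\<^sub>E {..M}. C a \<noteq> [] \<and> energy_ok (P - 8 * \<gamma>) (C a) \<and>
        (\<forall>x\<in>set (C a). finite (fst x) \<and> fst x \<noteq> {} \<and> fst x \<subseteq> G \<and> \<nu> k M \<le> real (fst (snd x)) \<and>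
           (\<forall>w\<in>fst x. length w = fst (snd x) \<and> snd (snd x) \<le> ?F w)) \<and>
        (\<forall>i<k. \<bar>v a i\<bar> \<le> 2 \<and> cycle_stat (wsum (L k) (indicat_real (D k i))) (v a i) (\<zeta> k / M / 32) (C a)))"
    for k M :: nat and v :: "(nat \<Rightarrow> nat) \<Rightarrow> nat \<Rightarrow> real" and C
  have "\<exists>v C. good k M v C" if "1 \<le> k" "1 \<le> M" for k M
    unfolding good_def by (rule cycles_exist[OF F \<gamma>(1) PF that(1) L that(2) disj types d \<zeta>_def])
  then have ex: "\<exists>y. good k M (fst y) (snd y)" if "1 \<le> k" "1 \<le> M" for k M using that by simp
  define v C where "v k M = fst (SOME y. good k M (fst y) (snd y))" and "C k M = snd (SOME y. good k M (fst y) (snd y))" for k M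
  have good: "good k M (v k M) (C k M)" if "1 \<le> k" "1 \<le> M" for k M
    unfolding v_def C_def by (rule someI_ex[OF ex[OF that]])
  \<comment> \<open>Only the first component of the decoded pair is used, so the free second
    component makes every triple recur infinitely often. A list stands for the frequency vector
    because the triples must be countable.\<close>
  define dec where "dec q = (from_nat (fst (prod_decode q)) :: nat \<times> nat \<times> nat list)" for q
  define kq where "kq q = Suc (fst (dec q))" for q
  define Mq where "Mq q = Suc (fst (snd (dec q)))" for q
  \<comment> \<open>Cutting entries off at \<open>Mq q\<close> and padding with 0 makes every code a
    point of the grid, while genuine grid points are left unchanged.\<close>
  define aq where "aq q = restrict (\<lambda>i. min (Mq q) (if i < length (snd (snd (dec q))) then snd (snd (dec q)) ! i else 0)) {..<kq q}" for q
  define Cq where "Cq q = C (kq q) (Mq q) (aq q)" for q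
  have kM: "1 \<le> kq q" "1 \<le> Mq q" "aq q \<in> {..<kq q} \<rightarrow>\<^sub>E {..Mq q}" for q by (auto simp: kq_def Mq_def aq_def)
  have Cq: "Cq q \<noteq> []" "energy_ok (P - 8 * \<gamma>) (Cq q)"
    "\<And>x. x \<in> set (Cq q) \<Longrightarrow> finite (fst x) \<and> fst x \<noteq> {} \<and> fst x \<subseteq> G \<and> \<nu> (kq q) (Mq q) \<le> real (fst (snd x)) \<and>
           (\<forall>w\<in>fst x. length w = fst (snd x) \<and> snd (snd x) \<le> ?F w)"
    "\<And>i. i < kq q \<Longrightarrow> \<bar>v (kq q) (Mq q) (aq q) i\<bar> \<le> 2 \<and>
       cycle_stat (wsum (L (kq q)) (indicat_real (D (kq q) i))) (v (kq q) (Mq q) (aq q) i) (\<zeta> (kq q) / Mq q / 32) (Cq q)" for q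
  proof -
    note g = good[OF kM(1,2), of q q, unfolded good_def, THEN conjunct2, rule_format, OF kM(3)[of q], folded Cq_def]
    show "Cq q \<noteq> []" using g by (elim conjE)
    show "energy_ok (P - 8 * \<gamma>) (Cq q)" using g by (elim conjE)
    show "finite (fst x) \<and> fst x \<noteq> {} \<and> fst x \<subseteq> G \<and> \<nu> (kq q) (Mq q) \<le> real (fst (snd x)) \<and>
           (\<forall>w\<in>fst x. length w = fst (snd x) \<and> snd (snd x) \<le> ?F w)" if "x \<in> set (Cq q)" for x
      using g that by (elim conjE) (rule bspec)
    show "\<bar>v (kq q) (Mq q) (aq q) i\<bar> \<le> 2 \<and>
       cycle_stat (wsum (L (kq q)) (indicat_real (D (kq q) i))) (v (kq q) (Mq q) (aq q) i) (\<zeta> (kq q) / Mq q / 32) (Cq q)" if "i < kq q" for i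
      using g that by (elim conjE) simp
  qed
  interpret S: staged m X f G \<tau> g Cq
    by unfold_locales (use Cq(1,3) in auto)
  have slot: "\<exists>q. slot Cq i \<in> set (Cq q)" for i by (rule S.slot_in)
  have nu: "K0 \<le> \<gamma> * real (fst (snd (slot Cq i)))" for i
  proof -
    obtain q where q: "slot Cq i \<in> set (Cq q)" using slot by blast
    have "K0 / \<gamma> \<le> \<nu> (kq q) (Mq q)" by (simp add: \<nu>_def)
    also have "\<dots> \<le> real (fst (snd (slot Cq i)))" using Cq(3)[OF q] by blast
    finally show ?thesis using \<gamma>(1) by (simp add: pos_divide_le_eq mult.commute)
  qed
  let ?Z = "S.lim_seq ` {c. \<forall>j. c j \<in> fst (slot Cq j)}"
  have "\<exists>N. 0 < PP_M X f ?Z s N"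
  proof (rule S.mass_positive[where \<gamma> = \<gamma> and \<psi> = \<psi> and l = l and lam = "\<lambda>i. snd (snd (slot Cq i))" and s' = "P - 8 * \<gamma>"])
    show "\<bar>f x - \<psi> (pre l x)\<bar> \<le> \<gamma>" if "x \<in> X" for x using \<psi>(2)[OF that] \<gamma>(1) by linarith
    show "snd (snd (slot Cq i)) \<le> ?F w" if "w \<in> fst (slot Cq i)" for i w
      using slot[of i] Cq(3) that by blast
    show "0 \<le> (\<Sum>i<r. ln (real (card (fst (slot Cq i)))) + snd (snd (slot Cq i)) - (P - 8 * \<gamma>) * real (fst (snd (slot Cq i))))" for r
      by (rule S.staged_energy[OF Cq(2)])
    show "\<exists>r0. \<forall>r\<ge>r0. real (fst (snd (slot Cq r))) \<le> e * real (S.nom r)" if "0 < e" for e :: real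
      by (rule S.staged_slow[OF that])
    show "ln (real \<tau> + 1) + 2 * (fB * real l) + fB * real \<tau> + (\<bar>s\<bar> + \<gamma> + fB) * real \<tau> \<le> \<gamma> * real (fst (snd (slot Cq i)))" for i
      using nu[of i] by (simp only: K0_def)
  qed (use \<gamma> \<psi>(1) in auto)
  moreover have "?Z \<subseteq> high_emergence X"
  proof
    fix x assume "x \<in> ?Z"
    then obtain c where c: "\<And>j. c j \<in> fst (slot Cq j)" and x: "x = S.lim_seq c" by auto
    have xX: "x \<in> X" unfolding x by (rule S.lim_seq_in[OF c])
    show "x \<in> high_emergence X"
    proof (rule high_emergenceI[OF xX])
      fix k :: nat assume k: "1 \<le> k"
      let ?\<psi> = "\<lambda>i. indicat_real (D k i)"
      have visit: "\<exists>n\<ge>n0. \<forall>i<k. \<bar>wsum (L k) (?\<psi> i) (pre n x) - v k M a i * n\<bar> \<le> \<zeta> k / M / 8 * n"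
        if M: "1 \<le> M" and a: "a \<in> {..<k} \<rightarrow>\<^sub>E {..M}" for M a n0
      proof -
        \<comment> \<open>Large enough that the influence of earlier stages, of order 1/(q + 1), is
          also at most \<zeta> / (32 M); the code q of the pair is at least j.\<close>
        define j where "j = n0 + nat \<lceil>(2 * real (L k) + 3 * \<tau> + 3) * (32 * real M / \<zeta> k)\<rceil>"
        define q where "q = prod_encode (to_nat (k - 1, M - 1, map a [0..<k]), j)"
        have jq: "j \<le> q" unfolding q_def by (rule le_prod_encode_2)
        have dec: "dec q = (k - 1, M - 1, map a [0..<k])" by (simp add: dec_def q_def)
        have kk: "kq q = k" and MM: "Mq q = M" using k M by (auto simp: kq_def Mq_def dec)
        have aa: "aq q = a"
        proof
          fix i
          show "aq q i = a i"
            using a unfolding aq_def kk MM dec by (cases "i < k") (auto simp: PiE_iff extensional_def min_def intro: antisym)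
        qed
        define n where "n = length (S.glued c (length (stages Cq (Suc q)) - 1))"
        have eps: "(\<zeta> k / M / 32 + (2 * real (L k) + 3 * \<tau>) / \<nu> k M + (2 * real (L k) + 3 * \<tau> + 3) / Suc q) \<le> \<zeta> k / M / 8"
        proof -
          have le_sum3: "y + u + w \<le> 4 * y" if "u \<le> y" "w \<le> y" "0 \<le> y" for u w y :: real
            using that by linarith
          have frac: "u / w \<le> 1 / r" if "u * r \<le> w" "0 < w" "0 < r" for u w r :: real
            using that by (simp add: field_simps)
          have r: "0 < 32 * real M / \<zeta> k" using M \<zeta>[OF k] by simp
          have "(2 * real (L k) + 3 * \<tau>) * (32 * real M / \<zeta> k) \<le> \<nu> k M" "0 < \<nu> k M" by (auto simp: \<nu>_def)
          then have 1: "(2 * real (L k) + 3 * \<tau>) / \<nu> k M \<le> 1 / (32 * real M / \<zeta> k)"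
            by (rule frac[OF _ _ r])
          have "(2 * real (L k) + 3 * \<tau> + 3) * (32 * real M / \<zeta> k) \<le> Suc q" using jq unfolding j_def by linarith
          then have 2: "(2 * real (L k) + 3 * \<tau> + 3) / Suc q \<le> 1 / (32 * real M / \<zeta> k)"
            by (rule frac[OF _ _ r]) simp
          have y: "1 / (32 * real M / \<zeta> k) = \<zeta> k / M / 32" "\<zeta> k / M / 8 = 4 * (\<zeta> k / M / 32)" "0 \<le> \<zeta> k / M / 32"
            using \<zeta>[OF k] by simp_all
          show ?thesis using 1[unfolded y(1)] 2[unfolded y(1)] y(3) unfolding y(2) by (rule le_sum3)
        qed
        have st: "q \<le> n \<and> \<bar>wsum (L k) (?\<psi> i) (pre n x) - v k M a i * n\<bar> \<le> \<zeta> k / M / 8 * n" if i: "i < k" for i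
        proof -
          have al: "almost_additive (1 * real (L k)) 1 (wsum (L k) (?\<psi> i))" by (rule almost_additive_wsum) (simp add: indicator_def)
          have cs: "\<bar>v k M a i\<bar> \<le> 2" "cycle_stat (wsum (L k) (?\<psi> i)) (v k M a i) (\<zeta> k / M / 32) (Cq q)"
            using Cq(4)[of i q] i unfolding kk MM aa by blast+
          have nn: "0 < \<nu> k M" "\<And>x. x \<in> set (Cq q) \<Longrightarrow> \<nu> k M \<le> real (fst (snd x))"
            using Cq(3)[of _ q] unfolding kk MM by (auto simp: \<nu>_def)
          have e0: "0 \<le> \<zeta> k / M / 32" using \<zeta>[OF k] by simp
          note ss = S.staged_statistics[OF c al cs nn e0 n_def]
          have "\<bar>wsum (L k) (?\<psi> i) (pre n x) - v k M a i * n\<bar> \<le>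
            (\<zeta> k / M / 32 + (2 * (1 * real (L k)) + 3 * \<tau>) / \<nu> k M + (2 * (1 * real (L k)) + 3 * \<tau> + 3) / Suc q) * n"
            unfolding x by (rule ss(2))
          also have "\<dots> \<le> \<zeta> k / M / 8 * n" using eps by (intro mult_right_mono) auto
          finally show ?thesis using ss(1) by blast
        qed
        have "n0 \<le> q" using jq by (simp add: j_def)
        moreover have "q \<le> n" using st[of 0] k by simp
        ultimately show ?thesis using st by (intro exI[of _ n]) auto
      qed
      show "\<exists>L \<psi> \<zeta>. 0 < (\<zeta> :: real) \<and> (\<forall>i<k. \<forall>w. 0 \<le> \<psi> i w \<and> \<psi> i w \<le> (1 :: real)) \<and>
      (\<forall>M\<ge>1. \<exists>v :: (nat \<Rightarrow> nat) \<Rightarrow> nat \<Rightarrow> real.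
        (\<forall>a\<in>{..<k} \<rightarrow>\<^sub>E {..M}. \<forall>b\<in>{..<k} \<rightarrow>\<^sub>E {..M}. a \<noteq> b \<longrightarrow> (\<exists>i<k. \<zeta> / M \<le> \<bar>v a i - v b i\<bar>)) \<and>
        (\<forall>a\<in>{..<k} \<rightarrow>\<^sub>E {..M}. \<forall>n0. \<exists>n\<ge>n0. \<forall>i<k. \<bar>wsum L (\<psi> i) (pre n x) - v a i * n\<bar> \<le> \<zeta> / M / 8 * n))"
      proof (rule exI[of _ "L k"], rule exI[of _ ?\<psi>], rule exI[of _ "\<zeta> k"], intro conjI allI impI)
        show "0 < \<zeta> k" by (rule \<zeta>[OF k])
        fix M :: nat assume M: "1 \<le> M"
        have "\<forall>a\<in>{..<k} \<rightarrow>\<^sub>E {..M}. \<forall>b\<in>{..<k} \<rightarrow>\<^sub>E {..M}. a \<noteq> b \<longrightarrow> (\<exists>i<k. \<zeta> k / M \<le> \<bar>v k M a i - v k M b i\<bar>)"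
          using good[OF k M] unfolding good_def by (elim conjE)
        moreover have "\<forall>a\<in>{..<k} \<rightarrow>\<^sub>E {..M}. \<forall>n0. \<exists>n\<ge>n0. \<forall>i<k. \<bar>wsum (L k) (?\<psi> i) (pre n x) - v k M a i * n\<bar> \<le> \<zeta> k / M / 8 * n"
          by (intro ballI allI) (rule visit[OF M])
        ultimately show "\<exists>v :: (nat \<Rightarrow> nat) \<Rightarrow> nat \<Rightarrow> real.
        (\<forall>a\<in>{..<k} \<rightarrow>\<^sub>E {..M}. \<forall>b\<in>{..<k} \<rightarrow>\<^sub>E {..M}. a \<noteq> b \<longrightarrow> (\<exists>i<k. \<zeta> k / M \<le> \<bar>v a i - v b i\<bar>)) \<and>
        (\<forall>a\<in>{..<k} \<rightarrow>\<^sub>E {..M}. \<forall>n0. \<exists>n\<ge>n0. \<forall>i<k. \<bar>wsum (L k) (?\<psi> i) (pre n x) - v a i * n\<bar> \<le> \<zeta> k / M / 8 * n)"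
          by (intro exI[of _ "v k M"] conjI)
      qed auto
    qed
  qed
  ultimately show ?thesis by (elim exE) (rule exI, erule less_le_trans, erule PP_M_subset)
qed

theorem theorem1p1:
  fixes m :: nat and X :: "seq set" and G :: "nat list set" and f :: "seq \<Rightarrow> real"
  assumes "shift_space m X"
    and "G \<subseteq> lang X"
    and "W_spec X G"
    and "edit_approachable X G"
    and "continuous_on X f"
    and "P_inf X f < P_top X f"
  shows "PP_pressure X f (high_emergence X) = P_top X f"
proof -
  obtain \<tau> where \<tau>: "\<forall>u\<in>G. \<forall>v\<in>G. \<exists>w\<in>lang X. length w \<le> \<tau> \<and> u @ w @ v \<in> G"
    using assms(3) by (auto simp: W_spec_def)
  obtain g where g: "mistake_function g" "\<forall>w\<in>lang X. \<exists>v\<in>G. edit_dist w v \<le> g (length w)"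
    using assms(4) by (auto simp: edit_approachable_def)
  interpret spec_shift m X f G \<tau> g
    by unfold_locales (use assms \<tau> g in auto)
  show ?thesis
    by (rule PP_pressure_eqI[OF _ high_emergence_mass[OF pos_entropyI[OF assms(6)]]])
       (auto simp: high_emergence_def)
qed

end
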